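(* Let $n\ge 3$ be an integer. Let $Q_n$ be the set of all $2^n$ binary strings of length $n$, equipped with the Hamming distance, and let $\mathrm{VR}(Q_n;2)$ be its Vietoris--Rips complex at scale $2$. Then $\mathrm{VR}(Q_n;2)$ is homotopy equivalent to the $c_n$-fold wedge sum of $3$-spheres, namely \[\mathrm{VR}(Q_n;2)\simeq \bigvee\nolimits^{c_n} S^3,\qquad\text{where}\qquad c_n=\sum_{0\le j<i<n}(j+1)\left(2^{n-2}-2^{i-1}\right),\] the sum being over all pairs of integers $(i,j)$ with $0\le j<i<n$.
   Context: The Hamming distance between two binary strings of the same length is the number of positions in which their entries differ. (Equivalently, $Q_n$ is the vertex set of the $n$-dimensional hypercube graph with the shortest path metric.) For a metric space $X$ and $r\ge 0$, the Vietoris--Rips complex $\mathrm{VR}(X;r)$ is the simplicial complex with vertex set $X$ in which a finite nonempty subset $\sigma\subseteq X$ is a simplex if and only if its diameter $\sup_{x,x'\in\sigma}d(x,x')$ is at most $r$. A simplicial complex is identified with its geometric realization. $\bigvee^{c}S^3$ denotes the wedge sum of $c$ copies of the $3$-sphere $S^3$; the $0$-fold wedge sum is a single point. *)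

theory Defs
  imports "HOL-Analysis.Analysis"
begin

text \<open>Abstract simplicial complexes are represented by their sets of (finite, nonempty) simplices.\<close>

definition vietoris_rips :: "'a set \<Rightarrow> ('a \<Rightarrow> 'a \<Rightarrow> real) \<Rightarrow> real \<Rightarrow> 'a set set" where
  "vietoris_rips M d r =
     {\<sigma>. finite \<sigma> \<and> \<sigma> \<noteq> {} \<and> \<sigma> \<subseteq> M \<and> (SUP (x, y)\<in>\<sigma> \<times> \<sigma>. d x y) \<le> r}"

lemma vietoris_rips_iff:
  "\<sigma> \<in> vietoris_rips M d r \<longleftrightarrow>
     finite \<sigma> \<and> \<sigma> \<noteq> {} \<and> \<sigma> \<subseteq> M \<and> (\<forall>x\<in>\<sigma>. \<forall>y\<in>\<sigma>. d x y \<le> r)"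
proof -
  have "(SUP (x, y)\<in>\<sigma> \<times> \<sigma>. d x y) \<le> r \<longleftrightarrow> (\<forall>x\<in>\<sigma>. \<forall>y\<in>\<sigma>. d x y \<le> r)"
    if "finite \<sigma>" "\<sigma> \<noteq> {}"
  proof -
    have "bdd_above ((\<lambda>(x, y). d x y) ` (\<sigma> \<times> \<sigma>))"
      using that by (intro bdd_above_finite) auto
    then show ?thesis
      using that by (subst cSUP_le_iff) auto
  qed
  then show ?thesis
    by (auto simp: vietoris_rips_def)
qed

text \<open>Points are given by barycentric coordinates; the topology is the weak (coherent) one,
  each closed simplex carrying its Euclidean topology.\<close>

definition closed_simplex :: "'a set \<Rightarrow> ('a \<Rightarrow> real) set" where
  "closed_simplex \<sigma> = {a. (\<forall>v. 0 \<le> a v) \<and> (\<forall>v. v \<notin> \<sigma> \<longrightarrow> a v = 0) \<and> (\<Sum>v\<in>\<sigma>. a v) = 1}"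

definition geometric_realization :: "'a set set \<Rightarrow> ('a \<Rightarrow> real) topology" where
  "geometric_realization K = topology (\<lambda>U. U \<subseteq> (\<Union>\<sigma>\<in>K. closed_simplex \<sigma>) \<and>
     (\<forall>\<sigma>\<in>K. openin (subtopology (powertop_real UNIV) (closed_simplex \<sigma>)) (closed_simplex \<sigma> \<inter> U)))"

lemma istopology_geometric_realization:
  "istopology (\<lambda>U. U \<subseteq> (\<Union>\<sigma>\<in>K. closed_simplex \<sigma>) \<and>
     (\<forall>\<sigma>\<in>K. openin (subtopology (powertop_real UNIV) (closed_simplex \<sigma>)) (closed_simplex \<sigma> \<inter> U)))"
proof -
  have 1: "closed_simplex \<sigma> \<inter> (S \<inter> T) = (closed_simplex \<sigma> \<inter> S) \<inter> (closed_simplex \<sigma> \<inter> T)"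
    for \<sigma> S and T :: "('a \<Rightarrow> real) set"
    by blast
  have 2: "closed_simplex \<sigma> \<inter> \<Union>\<K> = (\<Union>U\<in>\<K>. closed_simplex \<sigma> \<inter> U)"
    for \<sigma> and \<K> :: "('a \<Rightarrow> real) set set"
    by blast
  show ?thesis
    unfolding istopology_def 1 2 by blast
qed

lemma openin_geometric_realization:
  "openin (geometric_realization K) U \<longleftrightarrow> U \<subseteq> (\<Union>\<sigma>\<in>K. closed_simplex \<sigma>) \<and>
     (\<forall>\<sigma>\<in>K. openin (subtopology (powertop_real UNIV) (closed_simplex \<sigma>)) (closed_simplex \<sigma> \<inter> U))"
  unfolding geometric_realization_def topology_inverse'[OF istopology_geometric_realization] ..

lemma topspace_geometric_realization [simp]:
  "topspace (geometric_realization K) = (\<Union>\<sigma>\<in>K. closed_simplex \<sigma>)"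
proof (rule subset_antisym)
  show "topspace (geometric_realization K) \<subseteq> (\<Union>\<sigma>\<in>K. closed_simplex \<sigma>)"
    using openin_topspace[of "geometric_realization K"] unfolding openin_geometric_realization by (rule conjunct1)
  have "openin (geometric_realization K) (\<Union>\<sigma>\<in>K. closed_simplex \<sigma>)"
    unfolding openin_geometric_realization
  proof (intro conjI ballI)
    fix \<sigma> assume "\<sigma> \<in> K"
    then have "closed_simplex \<sigma> \<inter> (\<Union>\<sigma>\<in>K. closed_simplex \<sigma>) = closed_simplex \<sigma>"
      by blast
    then show "openin (subtopology (powertop_real UNIV) (closed_simplex \<sigma>))
        (closed_simplex \<sigma> \<inter> (\<Union>\<sigma>\<in>K. closed_simplex \<sigma>))"
      using openin_topspace[of "subtopology (powertop_real UNIV) (closed_simplex \<sigma>)"] by simp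
  qed simp
  then show "(\<Union>\<sigma>\<in>K. closed_simplex \<sigma>) \<subseteq> topspace (geometric_realization K)"
    by (rule openin_subset)
qed

lemma closedin_closed_simplex:
  assumes "finite \<sigma>"
  shows "closedin (powertop_real UNIV) (closed_simplex \<sigma>)"
proof -
  have cont: "continuous_map (powertop_real UNIV) euclideanreal (\<lambda>a. a v)" for v :: 'a
    by (rule continuous_map_product_projection) simp
  have pre: "closedin (powertop_real UNIV) {a. f a \<in> S}"
    if "continuous_map (powertop_real UNIV) euclideanreal f" "closed S"
    for f :: "('a \<Rightarrow> real) \<Rightarrow> real" and S
    using closedin_continuous_map_preimage[OF that(1), of S] that(2) by simp
  have 1: "closedin (powertop_real UNIV) (\<Inter>v. {a. a v \<in> {0..}} :: ('a \<Rightarrow> real) set)"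
    by (intro closedin_Inter; clarsimp simp del: atLeast_iff split del: if_split; intro pre cont) auto
  have 2: "closedin (powertop_real UNIV)
      (\<Inter>v. {a. a v \<in> (if v \<in> \<sigma> then UNIV else {0})} :: ('a \<Rightarrow> real) set)"
    by (intro closedin_Inter; clarsimp simp del: atLeast_iff split del: if_split; intro pre cont) auto
  have 3: "closedin (powertop_real UNIV) {a. (\<Sum>v\<in>\<sigma>. a v) \<in> {1}}"
    by (intro pre continuous_map_sum cont) (use assms in auto)
  have "closed_simplex \<sigma> = (\<Inter>v. {a. a v \<in> {0..}}) \<inter>
      (\<Inter>v. {a. a v \<in> (if v \<in> \<sigma> then UNIV else {0})}) \<inter> {a. (\<Sum>v\<in>\<sigma>. a v) \<in> {1}}"
    by (force simp: closed_simplex_def set_eq_iff)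
  then show ?thesis
    using closedin_Int[OF closedin_Int[OF 1 2] 3] by simp
qed

lemma geometric_realization_finite:
  assumes "finite K" "\<And>\<sigma>. \<sigma> \<in> K \<Longrightarrow> finite \<sigma>"
  shows "geometric_realization K =
    subtopology (powertop_real UNIV) (\<Union>\<sigma>\<in>K. closed_simplex \<sigma>)"
proof (rule topology_eq[THEN iffD2], intro allI iffI)
  let ?P = "powertop_real UNIV :: ('a \<Rightarrow> real) topology"
  let ?R = "\<Union>\<sigma>\<in>K. closed_simplex \<sigma>"
  fix U
  show "openin (subtopology ?P ?R) U" if "openin (geometric_realization K) U"
  proof -
    have op: "openin (subtopology ?P (closed_simplex \<sigma>)) (closed_simplex \<sigma> \<inter> U)" if "\<sigma> \<in> K" for \<sigma>
      using \<open>openin (geometric_realization K) U\<close> that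
      by (auto simp: openin_geometric_realization)
    have U: "U \<subseteq> ?R"
      using that by (simp add: openin_geometric_realization)
    have "closedin ?P (closed_simplex \<sigma> - U)" if \<sigma>: "\<sigma> \<in> K" for \<sigma>
    proof -
      have "closedin (subtopology ?P (closed_simplex \<sigma>)) (closed_simplex \<sigma> - closed_simplex \<sigma> \<inter> U)"
        using closedin_diff[OF closedin_topspace op[OF \<sigma>]] by simp
      moreover have "closed_simplex \<sigma> - closed_simplex \<sigma> \<inter> U = closed_simplex \<sigma> - U"
        by blast
      ultimately show ?thesis
        using closedin_closed_simplex[OF assms(2)[OF \<sigma>]] closedin_trans_full by metis
    qed
    then have "closedin ?P (\<Union>\<sigma>\<in>K. closed_simplex \<sigma> - U)"
      using assms(1) by (intro closedin_Union) auto
    then have "closedin (subtopology ?P ?R) (?R - U)"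
      by (intro closedin_subset_topspace) (auto simp: UN_extend_simps simp del: UN_simps)
    then show ?thesis
      using U by (simp add: openin_closedin)
  qed
  show "openin (geometric_realization K) U" if op: "openin (subtopology ?P ?R) U"
  proof -
    obtain T where T: "openin ?P T" "U = T \<inter> ?R"
      using op unfolding openin_subtopology by blast
    have "openin (subtopology ?P (closed_simplex \<sigma>)) (closed_simplex \<sigma> \<inter> U)" if "\<sigma> \<in> K" for \<sigma>
    proof -
      have "closed_simplex \<sigma> \<inter> U = T \<inter> closed_simplex \<sigma>"
        unfolding T(2) using that by blast
      then show ?thesis
        unfolding openin_subtopology using T(1) by blast
    qed
    moreover have "U \<subseteq> ?R"
      unfolding T(2) by (rule Int_lower2)
    ultimately show ?thesis
      unfolding openin_geometric_realization by blast
  qed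
qed

text \<open>The wedge of the spaces \<open>X i\<close> (\<open>i \<in> I\<close>) at the base points \<open>p i\<close>: the common base point
  is \<open>None\<close>, and the topology is the final one with respect to the inclusions of the \<open>X i\<close>.
  Over the empty index set this is a single point.\<close>

definition wedge_inclusion :: "('i \<Rightarrow> 'a) \<Rightarrow> 'i \<Rightarrow> 'a \<Rightarrow> ('i \<times> 'a) option" where
  "wedge_inclusion p i x = (if x = p i then None else Some (i, x))"

definition wedge_sum :: "('i \<Rightarrow> 'a topology) \<Rightarrow> ('i \<Rightarrow> 'a) \<Rightarrow> 'i set \<Rightarrow> ('i \<times> 'a) option topology" where
  "wedge_sum X p I = topology (\<lambda>U.
     U \<subseteq> insert None (\<Union>i\<in>I. wedge_inclusion p i ` topspace (X i)) \<and>
     (\<forall>i\<in>I. openin (X i) {x \<in> topspace (X i). wedge_inclusion p i x \<in> U}))"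

lemma istopology_wedge_sum:
  "istopology (\<lambda>U. U \<subseteq> insert None (\<Union>i\<in>I. wedge_inclusion p i ` topspace (X i)) \<and>
     (\<forall>i\<in>I. openin (X i) {x \<in> topspace (X i). wedge_inclusion p i x \<in> U}))"
proof -
  have 1: "{x \<in> topspace (X i). wedge_inclusion p i x \<in> S \<inter> T} =
      {x \<in> topspace (X i). wedge_inclusion p i x \<in> S} \<inter>
      {x \<in> topspace (X i). wedge_inclusion p i x \<in> T}" for i S T
    by auto
  have 2: "{x \<in> topspace (X i). wedge_inclusion p i x \<in> \<Union>\<K>} =
      (\<Union>U\<in>\<K>. {x \<in> topspace (X i). wedge_inclusion p i x \<in> U})" for i \<K>
    by auto
  show ?thesis
    unfolding istopology_def 1 2 by blast
qed

lemma openin_wedge_sum: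
  "openin (wedge_sum X p I) U \<longleftrightarrow>
     U \<subseteq> insert None (\<Union>i\<in>I. wedge_inclusion p i ` topspace (X i)) \<and>
     (\<forall>i\<in>I. openin (X i) {x \<in> topspace (X i). wedge_inclusion p i x \<in> U})"
  unfolding wedge_sum_def topology_inverse'[OF istopology_wedge_sum] ..

lemma topspace_wedge_sum:
  "topspace (wedge_sum X p I) = insert None (\<Union>i\<in>I. wedge_inclusion p i ` topspace (X i))"
    (is "_ = ?W")
proof (rule subset_antisym)
  show "topspace (wedge_sum X p I) \<subseteq> ?W"
    using openin_topspace[of "wedge_sum X p I"] unfolding openin_wedge_sum by (rule conjunct1)
  have "{x \<in> topspace (X i). wedge_inclusion p i x \<in> ?W} = topspace (X i)" if "i \<in> I" for i
    using that by blast
  then have "openin (wedge_sum X p I) ?W"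
    unfolding openin_wedge_sum by simp
  then show "?W \<subseteq> topspace (wedge_sum X p I)"
    by (rule openin_subset)
qed

text \<open>For a nonempty index set this is the usual quotient of the disjoint union.\<close>

lemma quotient_map_wedge_sum:
  assumes "I \<noteq> {}" "\<And>i. i \<in> I \<Longrightarrow> p i \<in> topspace (X i)"
  shows "quotient_map (sum_topology X I) (wedge_sum X p I) (\<lambda>(i, x). wedge_inclusion p i x)"
proof -
  obtain i where i: "i \<in> I"
    using assms(1) by blast
  have "None = wedge_inclusion p i (p i)"
    by (simp add: wedge_inclusion_def)
  then have "None \<in> (\<Union>i\<in>I. wedge_inclusion p i ` topspace (X i))"
    using i assms(2)[OF i] by blast
  then have W: "topspace (wedge_sum X p I) = (\<Union>i\<in>I. wedge_inclusion p i ` topspace (X i))"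
    by (auto simp: topspace_wedge_sum)
  have "(\<lambda>(i, x). wedge_inclusion p i x) ` topspace (sum_topology X I) = topspace (wedge_sum X p I)"
    unfolding W by force
  moreover have "openin (sum_topology X I)
      {z \<in> topspace (sum_topology X I). (\<lambda>(i, x). wedge_inclusion p i x) z \<in> U} \<longleftrightarrow>
      openin (wedge_sum X p I) U"
    if "U \<subseteq> topspace (wedge_sum X p I)" for U
    using that
    by (auto simp: openin_sum_topology openin_wedge_sum topspace_wedge_sum cong: conj_cong)
  ultimately show ?thesis
    by (simp add: quotient_map_def)
qed

text \<open>The base point \<open>(1, 0, 0, 0)\<close> of each 3-sphere is immaterial up to homeomorphism.\<close>

definition wedge_of_3_spheres :: "nat \<Rightarrow> (nat \<times> (nat \<Rightarrow> real)) option topology" where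
  "wedge_of_3_spheres c =
     wedge_sum (\<lambda>_. nsphere 3) (\<lambda>_ k. if k = 0 then 1 else 0) {..<c}"

definition binary_strings :: "nat \<Rightarrow> bool list set" where
  "binary_strings n = {xs. length xs = n}"

text \<open>The bound on both lengths makes the function symmetric on all lists, as
  \<^locale>\<open>Metric_space\<close> requires.\<close>

definition hamming_dist :: "'a list \<Rightarrow> 'a list \<Rightarrow> real" where
  "hamming_dist xs ys = real (card {i. i < length xs \<and> i < length ys \<and> xs ! i \<noteq> ys ! i})"

lemma Metric_space_hamming_lists: "Metric_space {xs :: 'a list. length xs = n} hamming_dist"
proof
  fix x y z :: "'a list"
  show "0 \<le> hamming_dist x y"
    by (simp add: hamming_dist_def)
  show "hamming_dist x y = hamming_dist y x"
  proof -
    have "{i. i < length x \<and> i < length y \<and> x ! i \<noteq> y ! i} =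
        {i. i < length y \<and> i < length x \<and> y ! i \<noteq> x ! i}"
      by auto
    then show ?thesis
      by (simp only: hamming_dist_def)
  qed
  assume x: "x \<in> {xs. length xs = n}" and y: "y \<in> {xs. length xs = n}"
  have "hamming_dist x y = 0 \<longleftrightarrow> {i. i < n \<and> x ! i \<noteq> y ! i} = {}"
    using x y by (simp add: hamming_dist_def)
  also have "\<dots> \<longleftrightarrow> x = y"
    using x y by (auto intro: nth_equalityI)
  finally show "hamming_dist x y = 0 \<longleftrightarrow> x = y" .
  assume z: "z \<in> {xs. length xs = n}"
  have "card {i. i < n \<and> x ! i \<noteq> z ! i} \<le>
      card ({i. i < n \<and> x ! i \<noteq> y ! i} \<union> {i. i < n \<and> y ! i \<noteq> z ! i})"
    by (intro card_mono) auto
  also have "\<dots> \<le> card {i. i < n \<and> x ! i \<noteq> y ! i} + card {i. i < n \<and> y ! i \<noteq> z ! i}"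
    by (rule card_Un_le)
  finally show "hamming_dist x z \<le> hamming_dist x y + hamming_dist y z"
    using x y z by (simp add: hamming_dist_def)
qed

lemma Metric_space_hamming: "Metric_space (binary_strings n) hamming_dist"
  unfolding binary_strings_def by (rule Metric_space_hamming_lists)

text \<open>In every summand \<open>1 \<le> i \<le> n - 1\<close>, so for \<open>n \<ge> 2\<close> none of the natural-number
  subtractions below is truncated.\<close>

definition sphere_count :: "nat \<Rightarrow> nat" where
  "sphere_count n = (\<Sum>(i, j) \<in> {(i, j). j < i \<and> i < n}. (j + 1) * (2 ^ (n - 2) - 2 ^ (i - 1)))"

end

theory Submission
  imports Defs
begin

text \<open>
  Appending its parity to a binary string of length \<open>n\<close> identifies \<open>Q\<^sub>n\<close> with the sets of even size
  among the subsets of \<open>{0, \<dots>, n}\<close>, and Hamming distance at most 2 becomes symmetric difference of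
  size at most 2. A maximal clique of this relation is either the set of all \<open>n + 1\<close> even neighbours
  of an odd set (a star) or the set of the four even vertices of a three-dimensional face of the
  \<open>(n + 1)\<close>-cube (a tetrahedron); this is \<open>even_cliques_eq\<close>, and it holds because a family of pairwise
  intersecting pairs either has a common element or is a triangle. Any three vertices of a
  tetrahedron have a common odd neighbour, so the complex consists of the stars together with one
  3-cell for every three-dimensional face of the cube. The picture to keep in mind is the 3-skeleton
  of the \<open>(n + 1)\<close>-cube.

  Collapsing a cube to its vertex 0 one coordinate at a time, the last coordinate first, consumes
  exactly those 3-faces of the 3-skeleton in which every coordinate beyond the largest direction
  is 0. Accordingly, the stars together with the tetrahedra of these low faces form a contractible
  complex (\<open>contractible_low_complex\<close>). To pass from \<open>k + 1\<close> to \<open>k\<close> coordinates one has to get rid of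
  the vertices that contain \<open>k\<close>: first of the simplices with three or more such vertices, then of
  those with two, then of those with one. At each stage the simplices to be deleted have a cone as link, and
  deleting the open star of such a simplex is a deformation retraction (\<open>homotopy_equivalent_antistar\<close>).

  The tetrahedra that are left out are facets, so the whole complex arises from a contractible one by
  attaching 3-simplices along their boundaries, and it is a wedge of as many 3-spheres
  (\<open>homotopy_equivalent_wedge_of_spheres\<close>): the contraction extends to the whole complex, and
  collapsing the contractible part to a point turns every attached simplex into a sphere.

  For the number of these spheres, fix directions \<open>a < b < c\<close>. There are \<open>2 ^ (n - 2)\<close> faces with these
  directions, and \<open>2 ^ (c - 2)\<close> of them are low. With \<open>c = i + 1\<close> and \<open>b = j + 1\<close> there are \<open>j + 1\<close>
  choices of \<open>a\<close>, which gives \<open>sphere_count n\<close> (\<open>card_critical_tetras\<close>).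
\<close>

section \<open>Polyhedra of finite simplicial complexes\<close>

definition finite_complex :: "'a set set \<Rightarrow> bool" where
  "finite_complex K \<longleftrightarrow>
     finite K \<and> (\<forall>\<sigma>\<in>K. finite \<sigma> \<and> \<sigma> \<noteq> {} \<and> (\<forall>\<tau>\<subseteq>\<sigma>. \<tau> \<noteq> {} \<longrightarrow> \<tau> \<in> K))"

definition polyhedron :: "'a set set \<Rightarrow> ('a \<Rightarrow> real) set" where
  "polyhedron K = (\<Union>\<sigma>\<in>K. closed_simplex \<sigma>)"

definition support :: "('a \<Rightarrow> real) \<Rightarrow> 'a set" where
  "support a = {v. a v \<noteq> 0}"

lemma finite_complexD:
  assumes "finite_complex K"
  shows "finite K" "\<And>\<sigma>. \<sigma> \<in> K \<Longrightarrow> finite \<sigma>" "\<And>\<sigma>. \<sigma> \<in> K \<Longrightarrow> \<sigma> \<noteq> {}"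
    "\<And>\<sigma> \<tau>. \<sigma> \<in> K \<Longrightarrow> \<tau> \<subseteq> \<sigma> \<Longrightarrow> \<tau> \<noteq> {} \<Longrightarrow> \<tau> \<in> K"
  using assms unfolding finite_complex_def by blast+

lemma finite_complexI:
  assumes "finite K" "\<And>\<sigma>. \<sigma> \<in> K \<Longrightarrow> finite \<sigma>" "\<And>\<sigma>. \<sigma> \<in> K \<Longrightarrow> \<sigma> \<noteq> {}"
    "\<And>\<sigma> \<tau>. \<sigma> \<in> K \<Longrightarrow> \<tau> \<subseteq> \<sigma> \<Longrightarrow> \<tau> \<noteq> {} \<Longrightarrow> \<tau> \<in> K"
  shows "finite_complex K"
  using assms unfolding finite_complex_def by blast

lemma finite_complex_subset:
  assumes "finite_complex K" "L \<subseteq> K" "\<And>\<sigma> \<tau>. \<lbrakk>\<sigma> \<in> L; \<tau> \<subseteq> \<sigma>; \<tau> \<noteq> {}; \<tau> \<in> K\<rbrakk> \<Longrightarrow> \<tau> \<in> L"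
  shows "finite_complex L"
proof (rule finite_complexI)
  show "finite L" using assms(2) finite_complexD(1)[OF assms(1)] by (rule finite_subset)
next
  fix \<sigma> assume \<sigma>: "\<sigma> \<in> L"
  then have "\<sigma> \<in> K" using assms(2) by blast
  note D = finite_complexD(2-4)[OF assms(1) this]
  show "finite \<sigma>" "\<sigma> \<noteq> {}" by (fact D(1), fact D(2))
  show "\<tau> \<in> L" if "\<tau> \<subseteq> \<sigma>" "\<tau> \<noteq> {}" for \<tau>
    using assms(3)[OF \<sigma> that D(3)[OF that]] .
qed

lemma geometric_realization_eq_top_of_set:
  assumes "finite_complex K"
  shows "geometric_realization K = top_of_set (polyhedron K)"
  using geometric_realization_finite[of K] finite_complexD[OF assms]
  by (simp add: polyhedron_def euclidean_product_topology)

lemma closed_simplex_iff: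
  assumes "finite \<sigma>"
  shows "a \<in> closed_simplex \<sigma> \<longleftrightarrow> support a \<subseteq> \<sigma> \<and> (\<forall>v. 0 \<le> a v) \<and> sum a (support a) = 1"
proof -
  have "sum a \<sigma> = sum a (support a)" if "support a \<subseteq> \<sigma>"
    using that assms by (intro sum.mono_neutral_right) (auto simp: support_def)
  moreover have "(\<forall>v. v \<notin> \<sigma> \<longrightarrow> a v = 0) \<longleftrightarrow> support a \<subseteq> \<sigma>"
    by (auto simp: support_def)
  ultimately show ?thesis
    unfolding closed_simplex_def by auto
qed

lemma support_nonempty: "sum a (support a) = 1 \<Longrightarrow> support a \<noteq> {}"
  by auto

text \<open>
  A point lies in the relative interior of exactly one simplex, namely its support; membership of points in subcomplexes thereby reduces to membership of a finite set in a family.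
\<close>

lemma polyhedron_iff:
  assumes "finite_complex K"
  shows "a \<in> polyhedron K \<longleftrightarrow> support a \<in> K \<and> (\<forall>v. 0 \<le> a v) \<and> sum a (support a) = 1"
proof
  assume "a \<in> polyhedron K"
  then obtain \<sigma> where \<sigma>: "\<sigma> \<in> K" "a \<in> closed_simplex \<sigma>"
    by (auto simp: polyhedron_def)
  then show "support a \<in> K \<and> (\<forall>v. 0 \<le> a v) \<and> sum a (support a) = 1"
    using finite_complexD[OF assms] support_nonempty by (metis closed_simplex_iff)
next
  assume a: "support a \<in> K \<and> (\<forall>v. 0 \<le> a v) \<and> sum a (support a) = 1"
  then have "a \<in> closed_simplex (support a)"
    using finite_complexD(2)[OF assms] by (simp add: closed_simplex_iff)
  then show "a \<in> polyhedron K"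
    using a by (auto simp: polyhedron_def)
qed

lemma continuous_on_Min_image:
  fixes g :: "'i \<Rightarrow> 'b::topological_space \<Rightarrow> real"
  assumes "finite \<sigma>" "\<sigma> \<noteq> {}" "\<And>v. v \<in> \<sigma> \<Longrightarrow> continuous_on S (g v)"
  shows "continuous_on S (\<lambda>x. Min ((\<lambda>v. g v x) ` \<sigma>))"
  using assms
proof (induction \<sigma> rule: finite_ne_induct)
  case (singleton v)
  then have "continuous_on S (g v)" by blast
  then show ?case unfolding image_insert image_empty Min_singleton .
next
  case (insert v \<sigma>)
  have "continuous_on S (\<lambda>x. min (g v x) (Min ((\<lambda>v. g v x) ` \<sigma>)))"
    by (rule continuous_on_min) (blast intro: insert)+
  moreover have "Min ((\<lambda>v. g v x) ` insert v \<sigma>) = min (g v x) (Min ((\<lambda>v. g v x) ` \<sigma>))" for x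
    using insert.hyps by simp
  ultimately show ?case by presburger
qed

lemma continuous_on_coordinate [continuous_intros]:
  "continuous_on S (\<lambda>a. a v)" for S :: "('a \<Rightarrow> real) set"
  by (rule continuous_on_product_then_coordinatewise[OF continuous_on_id])

lemma continuous_on_snd_coordinate [continuous_intros]:
  "continuous_on S (\<lambda>p. snd p v)" for S :: "('b::topological_space \<times> ('a \<Rightarrow> real)) set"
  by (rule continuous_on_product_then_coordinatewise[OF continuous_on_snd[OF continuous_on_id]])

lemma homotopic_with_top_of_setI:
  fixes h :: "real \<Rightarrow> 'a::topological_space \<Rightarrow> 'b::topological_space"
  assumes "continuous_on ({0..1} \<times> S) (\<lambda>(t, x). h t x)"
    and "\<And>t x. \<lbrakk>0 \<le> t; t \<le> 1; x \<in> S\<rbrakk> \<Longrightarrow> h t x \<in> T"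
    and "\<And>x. x \<in> S \<Longrightarrow> h 0 x = f x" "\<And>x. x \<in> S \<Longrightarrow> h 1 x = g x"
  shows "homotopic_with (\<lambda>_. True) (top_of_set S) (top_of_set T) f g"
proof -
  have "continuous_map (prod_topology (top_of_set {0..1}) (top_of_set S)) (top_of_set T) (\<lambda>(t, x). h t x)"
    using assms(1,2) by auto
  moreover have "\<forall>x\<in>topspace (top_of_set S). (case (0::real, x) of (t, x) \<Rightarrow> h t x) = f x"
    "\<forall>x\<in>topspace (top_of_set S). (case (1::real, x) of (t, x) \<Rightarrow> h t x) = g x"
    using assms(3,4) by simp_all
  ultimately show ?thesis
    by (subst homotopic_with) blast+
qed

definition min_coord :: "'a set \<Rightarrow> ('a \<Rightarrow> real) \<Rightarrow> real" where
  "min_coord \<sigma> a = Min (a ` \<sigma>)"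

lemma min_coord_le: "finite \<sigma> \<Longrightarrow> v \<in> \<sigma> \<Longrightarrow> min_coord \<sigma> a \<le> a v"
  by (simp add: min_coord_def)

lemma min_coord_attained:
  assumes "finite \<sigma>" "\<sigma> \<noteq> {}"
  obtains v where "v \<in> \<sigma>" "a v = min_coord \<sigma> a"
proof -
  have "min_coord \<sigma> a \<in> a ` \<sigma>"
    unfolding min_coord_def using assms by (intro Min_in) auto
  then show thesis using that by auto
qed

lemma min_coord_nonneg:
  assumes "finite \<sigma>" "\<sigma> \<noteq> {}" "\<forall>v. 0 \<le> a v"
  shows "0 \<le> min_coord \<sigma> a"
  using min_coord_attained[OF assms(1,2)] assms(3) by metis

lemma min_coord_eq_0_iff:
  assumes "finite \<sigma>" "\<sigma> \<noteq> {}" "\<forall>v. 0 \<le> a v"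
  shows "min_coord \<sigma> a = 0 \<longleftrightarrow> \<not> \<sigma> \<subseteq> support a"
proof
  assume "min_coord \<sigma> a = 0"
  moreover obtain v where "v \<in> \<sigma>" "a v = min_coord \<sigma> a"
    using min_coord_attained[OF assms(1,2)] .
  ultimately show "\<not> \<sigma> \<subseteq> support a" by (auto simp: support_def)
next
  assume "\<not> \<sigma> \<subseteq> support a"
  then obtain v where "v \<in> \<sigma>" "a v = 0" by (auto simp: support_def)
  then show "min_coord \<sigma> a = 0"
    using min_coord_le[OF assms(1), of v a] min_coord_nonneg[OF assms] by simp
qed

lemma continuous_on_min_coord:
  assumes "finite \<sigma>" "\<sigma> \<noteq> {}"
  shows "continuous_on S (min_coord \<sigma>)"
  unfolding min_coord_def using assms by (intro continuous_on_Min_image continuous_on_coordinate)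

section \<open>Deletion of simplices whose link is a cone\<close>

definition antistar :: "'a set set \<Rightarrow> 'a set \<Rightarrow> 'a set set" where
  "antistar K \<sigma> = {\<tau> \<in> K. \<not> \<sigma> \<subseteq> \<tau>}"

text \<open>
  The hypothesis \<open>cone\<close> says that the link of \<open>\<sigma>\<close> is a cone with apex \<open>v\<close>. The retraction subtracts from all
  barycentric coordinates on \<open>\<sigma>\<close> their minimum and moves the lost mass to \<open>v\<close>. This kills a vertex
  of \<open>\<sigma>\<close>, the support grows at most by \<open>v\<close>, and nothing moves unless the support contains \<open>\<sigma>\<close>. The
  formula is the same on all simplices, so continuity is immediate; scaling the moved mass by \<open>t\<close>
  gives the homotopy.
\<close>

lemma homotopy_equivalent_antistar:
  assumes K: "finite_complex K" and \<sigma>: "finite \<sigma>" "\<sigma> \<noteq> {}" "v \<notin> \<sigma>"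
    and cone: "\<And>\<tau>. \<lbrakk>\<tau> \<in> K; \<sigma> \<subseteq> \<tau>\<rbrakk> \<Longrightarrow> insert v \<tau> \<in> K"
  shows "geometric_realization K homotopy_equivalent_space geometric_realization (antistar K \<sigma>)"
proof -
  let ?m = "min_coord \<sigma>"
  define h where "h t a = (\<lambda>u. a u - (if u \<in> \<sigma> then t * ?m a else 0)
      + (if u = v then t * (real (card \<sigma>) * ?m a) else 0))" for t and a :: "'a \<Rightarrow> real"
  have L: "finite_complex (antistar K \<sigma>)"
    by (rule finite_complex_subset[OF K]) (auto simp: antistar_def)
  have PL: "a \<in> polyhedron (antistar K \<sigma>) \<longleftrightarrow> a \<in> polyhedron K \<and> \<not> \<sigma> \<subseteq> support a" for a
    unfolding polyhedron_iff[OF K] polyhedron_iff[OF L] by (auto simp: antistar_def)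
  note m_le = min_coord_le[OF \<sigma>(1)] and m_ge = min_coord_nonneg[OF \<sigma>(1,2)]
  have m_0: "?m a = 0" if "\<forall>v. 0 \<le> a v" "\<not> \<sigma> \<subseteq> support a" for a
    using min_coord_eq_0_iff[OF \<sigma>(1,2) that(1)] that(2) by blast
  have h_0: "h t a = a" if "?m a = 0" for t a
    using that by (auto simp: h_def)
  have h_K: "h t a \<in> polyhedron K" if t: "0 \<le> t" "t \<le> 1" and a: "a \<in> polyhedron K" for t a
  proof (cases "?m a = 0")
    case True
    then show ?thesis using a h_0 by simp
  next
    case False
    have a': "support a \<in> K" "\<forall>v. 0 \<le> a v" "sum a (support a) = 1"
      using a by (auto simp: polyhedron_iff[OF K])
    then have sub: "\<sigma> \<subseteq> support a" using False m_0 by blast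
    let ?\<tau> = "insert v (support a)"
    have \<tau>: "?\<tau> \<in> K" "finite ?\<tau>" using cone[OF a'(1) sub] finite_complexD(2)[OF K cone[OF a'(1) sub]] by simp_all
    have pos: "0 \<le> h t a u" for u
    proof -
      have "t * ?m a \<le> 1 * ?m a" using t m_ge[OF a'(2)] by (intro mult_right_mono) auto
      moreover have "0 \<le> t * (real (card \<sigma>) * ?m a)" using t m_ge[OF a'(2)] by simp
      ultimately show ?thesis using m_le[of u a] a'(2)[rule_format, of u] by (auto simp: h_def)
    qed
    have "sum (h t a) ?\<tau> = sum a ?\<tau> - (\<Sum>u\<in>?\<tau>. if u \<in> \<sigma> then t * ?m a else 0)
        + (\<Sum>u\<in>?\<tau>. if u = v then t * (real (card \<sigma>) * ?m a) else 0)"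
      by (simp add: h_def sum.distrib sum_subtractf)
    also have "sum a ?\<tau> = 1"
    proof -
      have "sum a ?\<tau> = sum a (support a)"
        using \<tau> by (intro sum.mono_neutral_right) (auto simp: support_def)
      then show ?thesis using a' by simp
    qed
    also have "(\<Sum>u\<in>?\<tau>. if u \<in> \<sigma> then t * ?m a else 0) = (\<Sum>u\<in>\<sigma>. t * ?m a)"
    proof -
      have "?\<tau> \<inter> \<sigma> = \<sigma>" using sub by blast
      then show ?thesis using sum.inter_restrict[OF \<tau>(2), of "\<lambda>_. t * ?m a" \<sigma>] by simp
    qed
    also have "(\<Sum>u\<in>?\<tau>. if u = v then t * (real (card \<sigma>) * ?m a) else 0) = t * (real (card \<sigma>) * ?m a)"
      using \<tau> by simp
    finally have "sum (h t a) ?\<tau> = 1" by simp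
    moreover have "support (h t a) \<subseteq> ?\<tau>"
      using sub by (auto simp: support_def h_def split: if_splits)
    ultimately have "h t a \<in> closed_simplex ?\<tau>"
      using pos by (auto simp: closed_simplex_def support_def)
    then show ?thesis using \<tau> by (auto simp: polyhedron_def)
  qed
  have h_L: "h 1 a \<in> polyhedron (antistar K \<sigma>)" if a: "a \<in> polyhedron K" for a
  proof -
    obtain u where u: "u \<in> \<sigma>" "a u = ?m a" using min_coord_attained[OF \<sigma>(1,2)] .
    then have "u \<notin> support (h 1 a)" using \<sigma> by (auto simp: support_def h_def)
    then show ?thesis
      using h_K[of 1 a] a u by (auto simp: PL)
  qed
  have fix_L: "a \<in> polyhedron K" "h t a = a" if "a \<in> polyhedron (antistar K \<sigma>)" for t a
    using that m_0[of a] h_0[of a] by (simp_all add: PL polyhedron_iff[OF K])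
  have cont: "continuous_on S (\<lambda>(t, a). h t a)" for S
  proof -
    have m: "continuous_on S (\<lambda>p. ?m (snd p))"
      by (rule continuous_on_compose2[OF continuous_on_min_coord[OF \<sigma>(1,2), of UNIV]
            continuous_on_snd[OF continuous_on_id]]) simp
    show ?thesis
      unfolding case_prod_unfold
    proof (rule continuous_on_coordinatewise_then_product)
      show "continuous_on S (\<lambda>p. h (fst p) (snd p) u)" for u
        unfolding h_def
        by (cases "u \<in> \<sigma>"; cases "u = v"; simp only: if_True if_False simp_thms;
            intro continuous_on_add continuous_on_diff continuous_on_mult continuous_on_const
              continuous_on_fst continuous_on_id continuous_on_snd_coordinate m)
    qed
  qed
  have "continuous_on S (h 1)" for S
  proof -
    have "continuous_on S ((\<lambda>(t, a). h t a) \<circ> (\<lambda>a. (1, a)))"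
      by (intro continuous_on_compose cont continuous_intros)
    then show ?thesis by (simp add: o_def)
  qed
  then have "retraction_maps (top_of_set (polyhedron K)) (top_of_set (polyhedron (antistar K \<sigma>))) (h 1) id"
    using h_L fix_L by (auto simp: retraction_maps_def)
  moreover have "homotopic_with (\<lambda>_. True) (top_of_set (polyhedron K)) (top_of_set (polyhedron K)) id (h 1)"
    by (rule homotopic_with_top_of_setI[where h = h])
      (use cont h_K in \<open>auto simp: h_def\<close>)
  ultimately show ?thesis
    unfolding geometric_realization_eq_top_of_set[OF K] geometric_realization_eq_top_of_set[OF L]
    by (intro deformation_retract_imp_homotopy_equivalent_space) (auto simp: homotopic_with_symD)
qed

text \<open>
  The stars are deleted one after another. Since the apexes lie in no member of \<open>S\<close>, adding an apex to
  a simplex never creates a member of \<open>S\<close> as a face, so the cone condition survives all deletions.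
\<close>

lemma homotopy_equivalent_delete_stars:
  assumes K: "finite_complex K" and fin: "finite S"
    and S: "\<And>\<sigma>. \<sigma> \<in> S \<Longrightarrow> finite \<sigma> \<and> \<sigma> \<noteq> {} \<and>
      (\<exists>v. v \<notin> \<Union>S \<and> (\<forall>\<tau>\<in>K. \<sigma> \<subseteq> \<tau> \<longrightarrow> insert v \<tau> \<in> K))"
  shows "finite_complex {\<tau> \<in> K. \<forall>\<sigma>\<in>S. \<not> \<sigma> \<subseteq> \<tau>} \<and> geometric_realization K homotopy_equivalent_space
    geometric_realization {\<tau> \<in> K. \<forall>\<sigma>\<in>S. \<not> \<sigma> \<subseteq> \<tau>}"
proof -
  have "finite_complex {\<tau> \<in> K. \<forall>\<sigma>\<in>T. \<not> \<sigma> \<subseteq> \<tau>} \<and> geometric_realization K homotopy_equivalent_space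
    geometric_realization {\<tau> \<in> K. \<forall>\<sigma>\<in>T. \<not> \<sigma> \<subseteq> \<tau>}" if "T \<subseteq> S" for T
    using finite_subset[OF that fin] that
  proof (induction T rule: finite_induct)
    case empty
    then show ?case using K by (simp add: homotopy_equivalent_space_refl)
  next
    case (insert \<sigma> T)
    let ?L = "{\<tau> \<in> K. \<forall>\<sigma>\<in>T. \<not> \<sigma> \<subseteq> \<tau>}"
    have IH: "finite_complex ?L" "geometric_realization K homotopy_equivalent_space geometric_realization ?L"
      using insert by auto
    have eq: "antistar ?L \<sigma> = {\<tau> \<in> K. \<forall>\<sigma>\<in>insert \<sigma> T. \<not> \<sigma> \<subseteq> \<tau>}"
      by (auto simp: antistar_def)
    obtain v where v: "v \<notin> \<Union>S" "\<forall>\<tau>\<in>K. \<sigma> \<subseteq> \<tau> \<longrightarrow> insert v \<tau> \<in> K" and \<sigma>: "finite \<sigma>" "\<sigma> \<noteq> {}"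
      using S[of \<sigma>] insert.prems by auto
    have "insert v \<tau> \<in> ?L" if "\<tau> \<in> ?L" "\<sigma> \<subseteq> \<tau>" for \<tau>
    proof -
      have "\<rho> \<subseteq> \<tau>" if "\<rho> \<in> T" "\<rho> \<subseteq> insert v \<tau>" for \<rho>
        using that v(1) insert.prems by blast
      then show ?thesis using that v(2) by blast
    qed
    moreover have "v \<notin> \<sigma>" using v(1) insert.prems by auto
    ultimately have "geometric_realization ?L homotopy_equivalent_space geometric_realization (antistar ?L \<sigma>)"
      by (intro homotopy_equivalent_antistar[OF IH(1) \<sigma>])
    moreover have "finite_complex (antistar ?L \<sigma>)"
      by (rule finite_complex_subset[OF IH(1)]) (auto simp: antistar_def)
    ultimately show ?case
      using homotopy_eqv_trans[OF IH(2)] unfolding eq by blast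
  qed
  then show ?thesis by blast
qed

section \<open>Relabelling of vertices\<close>

lemma homeomorphic_relabelled_realization:
  assumes K: "finite_complex K" and inj: "inj_on f (\<Union>K)"
  shows "finite_complex ((`) f ` K)"
    "geometric_realization K homeomorphic_space geometric_realization ((`) f ` K)"
proof -
  show L: "finite_complex ((`) f ` K)"
  proof (rule finite_complexI)
    fix \<rho> assume "\<rho> \<in> (`) f ` K"
    then obtain \<sigma> where \<sigma>: "\<sigma> \<in> K" "\<rho> = f ` \<sigma>" by blast
    then show "finite \<rho>" "\<rho> \<noteq> {}" using finite_complexD(2,3)[OF K \<sigma>(1)] by simp_all
    fix \<tau> assume \<tau>: "\<tau> \<subseteq> \<rho>" "\<tau> \<noteq> {}"
    then obtain \<sigma>' where \<sigma>': "\<sigma>' \<subseteq> \<sigma>" "\<tau> = f ` \<sigma>'" using \<sigma>(2) by (meson subset_imageE)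
    then have "\<sigma>' \<in> K" using finite_complexD(4)[OF K \<sigma>(1)] \<tau>(2) by blast
    then show "\<tau> \<in> (`) f ` K" using \<sigma>'(2) by blast
  qed (use finite_complexD(1)[OF K] in simp)
  define V where "V = \<Union>K"
  define F where "F a = (\<lambda>w. if w \<in> f ` V then a (inv_into V f w) else 0)" for a :: "'a \<Rightarrow> real"
  define G where "G b = (\<lambda>v. if v \<in> V then b (f v) else 0)" for b :: "'b \<Rightarrow> real"
  have inj: "inj_on f V" using inj by (simp add: V_def)
  have F: "F a \<in> polyhedron ((`) f ` K)" "G (F a) = a" if "a \<in> polyhedron K" for a
  proof -
    have a: "support a \<in> K" "\<forall>v. 0 \<le> a v" "sum a (support a) = 1"
      using that by (auto simp: polyhedron_iff[OF K])
    have sV: "support a \<subseteq> V" using a(1) by (auto simp: V_def)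
    have Ff: "F a (f v) = a v" if "v \<in> V" for v using that inj by (simp add: F_def)
    have s: "support (F a) = f ` support a"
    proof
      show "support (F a) \<subseteq> f ` support a"
        using Ff by (force simp: support_def F_def split: if_splits)
      show "f ` support a \<subseteq> support (F a)"
        using Ff sV by (fastforce simp: support_def)
    qed
    have "sum (F a) (f ` support a) = sum a (support a)"
      using sV Ff inj by (subst sum.reindex) (auto simp: subset_iff intro: inj_on_subset intro!: sum.cong)
    then show "F a \<in> polyhedron ((`) f ` K)"
      using a s by (auto simp: polyhedron_iff[OF L] F_def)
    show "G (F a) = a"
    proof
      show "G (F a) v = a v" for v
        using Ff sV by (cases "v \<in> V") (auto simp: G_def support_def)
    qed
  qed
  have G: "G b \<in> polyhedron K" "F (G b) = b" if "b \<in> polyhedron ((`) f ` K)" for b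
  proof -
    have b: "support b \<in> (`) f ` K" "\<forall>v. 0 \<le> b v" "sum b (support b) = 1"
      using that by (auto simp: polyhedron_iff[OF L])
    then obtain \<sigma> where \<sigma>: "\<sigma> \<in> K" "support b = f ` \<sigma>" by auto
    have \<sigma>V: "\<sigma> \<subseteq> V" using \<sigma> by (auto simp: V_def)
    have s: "support (G b) = \<sigma>"
    proof
      show "support (G b) \<subseteq> \<sigma>"
      proof
        fix v assume "v \<in> support (G b)"
        then have "v \<in> V" "f v \<in> support b" by (auto simp: support_def G_def split: if_splits)
        then show "v \<in> \<sigma>" using \<sigma> \<sigma>V inj by (metis inj_on_image_mem_iff)
      qed
      show "\<sigma> \<subseteq> support (G b)" using \<sigma> \<sigma>V by (auto simp: support_def G_def)
    qed
    have "sum (G b) \<sigma> = sum b (f ` \<sigma>)"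
      using \<sigma>V inj by (subst sum.reindex) (auto simp: G_def subset_iff intro: inj_on_subset intro!: sum.cong)
    then show "G b \<in> polyhedron K"
      using b s \<sigma> by (auto simp: polyhedron_iff[OF K] G_def)
    show "F (G b) = b"
    proof
      fix w
      show "F (G b) w = b w"
      proof (cases "w \<in> f ` V")
        case True
        then show ?thesis using inj by (auto simp: F_def G_def)
      next
        case False
        then have "w \<notin> support b" using \<sigma> \<sigma>V by auto
        then show ?thesis using False by (simp add: F_def support_def)
      qed
    qed
  qed
  have F_cont: "continuous_on S F" for S
  proof (rule continuous_on_coordinatewise_then_product)
    show "continuous_on S (\<lambda>a. F a w)" for w
      by (cases "w \<in> f ` V") (simp_all add: F_def continuous_on_coordinate)
  qed
  have G_cont: "continuous_on S G" for S
  proof (rule continuous_on_coordinatewise_then_product)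
    show "continuous_on S (\<lambda>b. G b v)" for v
      by (cases "v \<in> V") (simp_all add: G_def continuous_on_coordinate)
  qed
  have "homeomorphic_maps (top_of_set (polyhedron K)) (top_of_set (polyhedron ((`) f ` K))) F G"
    using F G F_cont G_cont by (auto simp: homeomorphic_maps_def)
  then show "geometric_realization K homeomorphic_space geometric_realization ((`) f ` K)"
    unfolding geometric_realization_eq_top_of_set[OF K] geometric_realization_eq_top_of_set[OF L]
    by (rule homeomorphic_maps_imp_homeomorphic_space)
qed

section \<open>The sphere as a simplex modulo its boundary\<close>

lemma compact_closed_simplex:
  assumes "finite \<sigma>"
  shows "compact (closed_simplex \<sigma>)"
proof -
  have "compactin (powertop_real UNIV) (PiE UNIV (\<lambda>_::'a. {0..1::real}))"
    by (simp add: compactin_PiE)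
  moreover have "closed_simplex \<sigma> \<subseteq> PiE UNIV (\<lambda>_. {0..1})"
  proof
    fix a assume a: "a \<in> closed_simplex \<sigma>"
    have "a v \<le> 1" for v
    proof (cases "v \<in> \<sigma>")
      case True
      then have "a v \<le> sum a \<sigma>"
        using a assms by (intro member_le_sum) (auto simp: closed_simplex_def)
      then show ?thesis using a by (simp add: closed_simplex_def)
    next
      case False
      then show ?thesis using a by (simp add: closed_simplex_def)
    qed
    then show "a \<in> PiE UNIV (\<lambda>_. {0..1})" using a by (auto simp: closed_simplex_def)
  qed
  ultimately have "compactin (powertop_real UNIV) (closed_simplex \<sigma>)"
    using closedin_closed_simplex[OF assms] closed_compactin by blast
  then show ?thesis by (simp add: euclidean_product_topology)
qed

definition sphere_base :: "nat \<Rightarrow> real" where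
  "sphere_base = (\<lambda>k. if k = 0 then 1 else 0)"

definition spread :: "nat \<Rightarrow> (nat \<Rightarrow> 'a) \<Rightarrow> ('a \<Rightarrow> real) \<Rightarrow> real" where
  "spread d e a = (\<Sum>i\<le>d. (a (e i) - a (e 0))\<^sup>2)"

text \<open>
  For \<open>m \<noteq> 0\<close> this is inverse stereographic projection from \<open>sphere_base\<close>, applied to the vector
  with coordinates \<open>(a (e i) - a (e 0)) / m\<close> and cleared of denominators \<open>m\<close>. On the boundary of the
  simplex \<open>m = 0\<close>, and the formula still makes sense and gives the base point: the map identifies the
  simplex modulo its boundary with the sphere.
\<close>

definition simplex_to_sphere :: "nat \<Rightarrow> (nat \<Rightarrow> 'a) \<Rightarrow> ('a \<Rightarrow> real) \<Rightarrow> nat \<Rightarrow> real" where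
  "simplex_to_sphere d e a = (\<lambda>i.
     let m = min_coord (e ` {..d}) a; s = spread d e a in
     if i = 0 then (s - m\<^sup>2) / (s + m\<^sup>2)
     else if i \<le> d then 2 * m * (a (e i) - a (e 0)) / (s + m\<^sup>2) else 0)"

lemma topspace_nsphere: "topspace (nsphere d) = {x. (\<Sum>i\<le>d. (x i)\<^sup>2) = 1 \<and> (\<forall>i>d. x i = 0)}"
  by (simp add: nsphere)

lemma spread_nonneg: "0 \<le> spread d e a"
  by (simp add: spread_def sum_nonneg)

lemma spread_shift: "spread d e a = (\<Sum>i\<in>{1..d}. (a (e i) - a (e 0))\<^sup>2)"
proof -
  have "{..d} = insert 0 {1..d}" by auto
  then show ?thesis by (simp add: spread_def)
qed

lemma sum_atMost_shift: "(\<Sum>i\<le>d. f i) = f 0 + (\<Sum>i\<in>{1..d}. f i)" for f :: "nat \<Rightarrow> real"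
proof -
  have "{..d} = insert 0 {1..d}" by auto
  then show ?thesis by simp
qed

text \<open>
  A vanishing spread makes all coordinates equal, hence positive, so that their minimum cannot vanish
  as well.
\<close>

lemma denominator_pos:
  assumes a: "a \<in> closed_simplex (e ` {..d})"
  shows "0 < spread d e a + (min_coord (e ` {..d}) a)\<^sup>2"
proof (rule ccontr)
  assume "\<not> ?thesis"
  moreover have "0 \<le> (min_coord (e ` {..d}) a)\<^sup>2" by simp
  ultimately have s: "spread d e a = 0" and m: "min_coord (e ` {..d}) a = 0"
    using spread_nonneg[of d e a] by (smt (verit) zero_eq_power2)+
  have eq: "a (e i) = a (e 0)" if "i \<le> d" for i
  proof -
    have "(a (e i) - a (e 0))\<^sup>2 \<le> spread d e a"
      unfolding spread_def using that by (intro member_le_sum) auto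
    then show ?thesis by (simp add: s)
  qed
  obtain v where "v \<in> e ` {..d}" "a v = 0"
    using min_coord_attained[of "e ` {..d}" a] m by auto
  then obtain j where "j \<le> d" "a (e j) = 0" by auto
  then have "a (e i) = 0" if "i \<le> d" for i using eq[OF that] eq[of j] by linarith
  then have "sum a (e ` {..d}) = 0" by (intro sum.neutral) auto
  then show False using a by (simp add: closed_simplex_def)
qed

lemma simplex_to_sphere_in_sphere:
  assumes a: "a \<in> closed_simplex (e ` {..d})"
  shows "simplex_to_sphere d e a \<in> topspace (nsphere d)"
proof -
  define m where "m = min_coord (e ` {..d}) a"
  define s where "s = spread d e a"
  have pos: "s + m\<^sup>2 > 0" using denominator_pos[OF a] by (simp add: m_def s_def)
  have "(\<Sum>i\<in>{1..d}. (simplex_to_sphere d e a i)\<^sup>2)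
      = (\<Sum>i\<in>{1..d}. (2 * m / (s + m\<^sup>2))\<^sup>2 * (a (e i) - a (e 0))\<^sup>2)"
    by (intro sum.cong)
      (auto simp: simplex_to_sphere_def m_def[symmetric] s_def[symmetric] Let_def power_mult_distrib power_divide)
  also have "\<dots> = (2 * m / (s + m\<^sup>2))\<^sup>2 * s"
    by (simp add: s_def spread_shift sum_distrib_left)
  finally have "(\<Sum>i\<le>d. (simplex_to_sphere d e a i)\<^sup>2)
      = ((s - m\<^sup>2) / (s + m\<^sup>2))\<^sup>2 + (2 * m / (s + m\<^sup>2))\<^sup>2 * s"
    by (simp only: sum_atMost_shift) (simp add: simplex_to_sphere_def m_def[symmetric] s_def[symmetric] Let_def)
  also have "\<dots> = ((s - m\<^sup>2)\<^sup>2 + 4 * m\<^sup>2 * s) / (s + m\<^sup>2)\<^sup>2"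
    by (simp add: power_divide add_divide_distrib power_mult_distrib)
  also have "(s - m\<^sup>2)\<^sup>2 + 4 * m\<^sup>2 * s = (s + m\<^sup>2)\<^sup>2"
    by (simp add: power2_eq_square algebra_simps)
  finally show ?thesis
    using pos by (simp add: topspace_nsphere simplex_to_sphere_def Let_def)
qed

lemma continuous_on_simplex_to_sphere:
  "continuous_on (closed_simplex (e ` {..d})) (simplex_to_sphere d e)"
proof (rule continuous_on_coordinatewise_then_product)
  fix i
  let ?S = "closed_simplex (e ` {..d})"
  have m: "continuous_on ?S (min_coord (e ` {..d}))"
    by (rule continuous_on_min_coord) auto
  have s: "continuous_on ?S (spread d e)"
    unfolding spread_def by (intro continuous_intros)
  have nz: "spread d e a + (min_coord (e ` {..d}) a)\<^sup>2 \<noteq> 0" if "a \<in> ?S" for a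
    using denominator_pos[OF that] by simp
  consider "i = 0" | "0 < i" "i \<le> d" | "d < i" by linarith
  then show "continuous_on ?S (\<lambda>a. simplex_to_sphere d e a i)"
  proof cases
    case 1
    then show ?thesis
      unfolding simplex_to_sphere_def Let_def
      by (simp, intro continuous_intros m s ballI nz)
  next
    case 2
    then show ?thesis
      unfolding simplex_to_sphere_def Let_def
      by (simp, intro continuous_intros m s ballI nz)
  next
    case 3
    then show ?thesis by (simp add: simplex_to_sphere_def)
  qed
qed

lemma simplex_to_sphere_eq_base_iff:
  assumes a: "a \<in> closed_simplex (e ` {..d})"
  shows "simplex_to_sphere d e a = sphere_base \<longleftrightarrow> min_coord (e ` {..d}) a = 0"
proof -
  define m where "m = min_coord (e ` {..d}) a"
  define s where "s = spread d e a"
  have pos: "s + m\<^sup>2 > 0" using denominator_pos[OF a] by (simp add: m_def s_def)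
  show ?thesis
  proof
    assume "min_coord (e ` {..d}) a = 0"
    then show "simplex_to_sphere d e a = sphere_base"
      using denominator_pos[OF a] by (auto simp: simplex_to_sphere_def sphere_base_def)
  next
    assume "simplex_to_sphere d e a = sphere_base"
    then have "simplex_to_sphere d e a 0 = sphere_base 0" by simp
    then have "(s - m\<^sup>2) / (s + m\<^sup>2) = 1"
      by (simp only: simplex_to_sphere_def sphere_base_def m_def s_def Let_def refl if_True)
    then have "s - m\<^sup>2 = s + m\<^sup>2" by (simp add: divide_eq_1_iff)
    then have "m = 0" by simp
    then show "min_coord (e ` {..d}) a = 0" by (simp add: m_def)
  qed
qed

text \<open>
  Stereographic projection recovers the differences of the coordinates divided by their minimum
  \<open>m\<close>. Division by \<open>m\<close> makes the smallest coordinate 1, which fixes the remaining common shift, and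
  the sum of the coordinates fixes the scale.
\<close>

lemma simplex_to_sphere_inj:
  assumes a: "a \<in> closed_simplex (e ` {..d})" "min_coord (e ` {..d}) a \<noteq> 0"
    and b: "b \<in> closed_simplex (e ` {..d})" "min_coord (e ` {..d}) b \<noteq> 0"
    and eq: "simplex_to_sphere d e a = simplex_to_sphere d e b"
  shows "a = b"
proof -
  let ?m = "min_coord (e ` {..d})"
  have nn: "\<forall>v. 0 \<le> x v" "sum x (e ` {..d}) = 1" "\<And>v. v \<notin> e ` {..d} \<Longrightarrow> x v = 0"
    if "x \<in> closed_simplex (e ` {..d})" for x
    using that by (auto simp: closed_simplex_def)
  have pos: "?m x > 0" if "x \<in> closed_simplex (e ` {..d})" "?m x \<noteq> 0" for x
    using min_coord_nonneg[of "e ` {..d}" x] nn(1)[OF that(1)] that(2) by auto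
  \<comment> \<open>inverse stereographic projection recovers \<open>u / m\<close>\<close>
  have rec: "(x (e i) - x (e 0)) / ?m x
      = (if i = 0 then 0 else simplex_to_sphere d e x i / (1 - simplex_to_sphere d e x 0))"
    if x: "x \<in> closed_simplex (e ` {..d})" "?m x \<noteq> 0" and i: "i \<le> d" for x i
  proof (cases "i = 0")
    case False
    let ?D = "spread d e x + (?m x)\<^sup>2"
    have D: "?D > 0" using denominator_pos[OF x(1)] .
    have "1 - simplex_to_sphere d e x 0 = 2 * (?m x)\<^sup>2 / ?D"
      using D by (simp add: simplex_to_sphere_def Let_def field_simps)
    moreover have "simplex_to_sphere d e x i = 2 * ?m x * (x (e i) - x (e 0)) / ?D"
      using False i by (simp add: simplex_to_sphere_def Let_def)
    ultimately show ?thesis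
      using D x(2) False by (simp add: power2_eq_square)
  qed simp
  define \<delta> where "\<delta> = a (e 0) / ?m a - b (e 0) / ?m b"
  have diff: "a (e i) / ?m a - b (e i) / ?m b = \<delta>" if "i \<le> d" for i
  proof -
    have "(a (e i) - a (e 0)) / ?m a = (b (e i) - b (e 0)) / ?m b"
      unfolding rec[OF a that] rec[OF b that] eq ..
    then show ?thesis by (simp add: \<delta>_def diff_divide_distrib)
  qed
  have one: "\<exists>i\<le>d. x (e i) / ?m x = 1" "\<forall>i\<le>d. 1 \<le> x (e i) / ?m x"
    if x: "x \<in> closed_simplex (e ` {..d})" "?m x \<noteq> 0" for x
  proof -
    obtain v where "v \<in> e ` {..d}" "x v = ?m x"
      using min_coord_attained[of "e ` {..d}" x] by auto
    then show "\<exists>i\<le>d. x (e i) / ?m x = 1" using x by auto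
    show "\<forall>i\<le>d. 1 \<le> x (e i) / ?m x"
      using pos[OF x] min_coord_le[of "e ` {..d}" _ x] by (auto simp: field_simps)
  qed
  have "\<delta> = 0"
  proof (rule antisym)
    obtain i where "i \<le> d" "a (e i) / ?m a = 1" using one(1)[OF a] by blast
    then show "\<delta> \<le> 0" using diff[of i] one(2)[OF b] by fastforce
    obtain i where "i \<le> d" "b (e i) / ?m b = 1" using one(1)[OF b] by blast
    then show "0 \<le> \<delta>" using diff[of i] one(2)[OF a] by fastforce
  qed
  then have quot: "a v / ?m a = b v / ?m b" for v
    using diff nn(3)[OF a(1)] nn(3)[OF b(1)] by (cases "v \<in> e ` {..d}") auto
  have "1 / ?m a = (\<Sum>v\<in>e ` {..d}. a v / ?m a)"
    using nn(2)[OF a(1)] by (simp flip: sum_divide_distrib)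
  also have "\<dots> = 1 / ?m b"
    using nn(2)[OF b(1)] by (simp add: quot flip: sum_divide_distrib)
  finally have "?m a = ?m b" using a(2) b(2) by (simp add: field_simps)
  then have "a v = b v" for v using quot[of v] a(2) by simp
  then show ?thesis by blast
qed

text \<open>
  A point other than the base point is the image of the point whose coordinates are those of its
  stereographic projection, with \<open>0\<close> in front, shifted so that the minimum is 1, and then
  normalised.
\<close>

lemma simplex_to_sphere_surj:
  assumes inj: "inj_on e {..d}" and d: "0 < d" and p: "p \<in> topspace (nsphere d)"
  shows "p \<in> simplex_to_sphere d e ` closed_simplex (e ` {..d})"
proof (cases "p = sphere_base")
  case True
  define a where "a = (\<lambda>v. if v = e 0 then 1 else 0 :: real)"
  have a: "a \<in> closed_simplex (e ` {..d})"
    by (auto simp: closed_simplex_def a_def)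
  have "e 1 \<noteq> e 0" using inj d by (auto dest: inj_onD)
  then have "\<not> e ` {..d} \<subseteq> support a"
    using d by (auto simp: support_def a_def image_subset_iff intro!: exI[of _ 1])
  then have "min_coord (e ` {..d}) a = 0"
    by (subst min_coord_eq_0_iff) (auto simp: a_def)
  then show ?thesis
    using simplex_to_sphere_eq_base_iff[OF a] a True by (metis image_eqI)
next
  case False
  have sq: "(p 0)\<^sup>2 + (\<Sum>i\<in>{1..d}. (p i)\<^sup>2) = 1" and out: "\<And>i. d < i \<Longrightarrow> p i = 0"
    using p by (auto simp: topspace_nsphere sum_atMost_shift)
  have "p 0 \<noteq> 1"
  proof
    assume "p 0 = 1"
    then have "(\<Sum>i\<in>{1..d}. (p i)\<^sup>2) = 0" using sq by simp
    then have "\<forall>i\<in>{1..d}. p i = 0" by (simp add: sum_nonneg_eq_0_iff)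
    then have "p i = sphere_base i" for i
      using out[of i] \<open>p 0 = 1\<close> by (cases "i = 0"; cases "i \<le> d") (auto simp: sphere_base_def)
    then show False using False by auto
  qed
  moreover have "p 0 \<le> 1"
  proof -
    have "(p 0)\<^sup>2 \<le> 1" using sq sum_nonneg[of "{1..d}" "\<lambda>i. (p i)\<^sup>2"] by simp
    then show ?thesis using power2_le_imp_le[of "p 0" 1] by simp
  qed
  ultimately have p0: "p 0 < 1" by simp
  define y where "y i = (if i = 0 then 0 else p i / (1 - p 0))" for i
  define M where "M = Min (y ` {..d})"
  define W where "W = (\<Sum>i\<le>d. y i - M + 1)"
  define a where "a v = (if v \<in> e ` {..d} then (y (inv_into {..d} e v) - M + 1) / W else 0)" for v
  have ge: "1 \<le> y i - M + 1" if "i \<le> d" for i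
    using that by (simp add: M_def)
  have "W \<ge> (\<Sum>i\<le>d. 1)" unfolding W_def by (intro sum_mono) (use ge in auto)
  then have W: "W > 0" by simp
  have ae: "a (e i) = (y i - M + 1) / W" if "i \<le> d" for i
    using that inj by (simp add: a_def)
  have pos: "0 \<le> a v" for v
  proof (cases "v \<in> e ` {..d}")
    case True
    then obtain i where "i \<le> d" "v = e i" by auto
    then show ?thesis using ae ge[of i] W by simp
  qed (simp add: a_def)
  have "sum a (e ` {..d}) = (\<Sum>i\<le>d. (y i - M + 1) / W)"
    using inj ae by (simp add: sum.reindex)
  also have "\<dots> = W / W" by (simp only: sum_divide_distrib[symmetric] W_def)
  finally have a: "a \<in> closed_simplex (e ` {..d})"
    using W pos by (simp add: closed_simplex_def a_def)
  have m: "min_coord (e ` {..d}) a = 1 / W"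
  proof (rule antisym)
    have "M \<in> y ` {..d}" unfolding M_def by (intro Min_in) auto
    then obtain i where "i \<le> d" "y i = M" by auto
    then show "min_coord (e ` {..d}) a \<le> 1 / W"
      using min_coord_le[of "e ` {..d}" "e i" a] ae[of i] by simp
    obtain v where "v \<in> e ` {..d}" "a v = min_coord (e ` {..d}) a"
      using min_coord_attained[of "e ` {..d}" a] by auto
    then obtain j where "j \<le> d" "min_coord (e ` {..d}) a = a (e j)" by auto
    then show "1 / W \<le> min_coord (e ` {..d}) a"
      using ae[of j] ge[of j] W by (simp add: divide_right_mono)
  qed
  have u: "a (e i) - a (e 0) = y i / W" if "i \<le> d" for i
    using ae[OF that] ae[of 0] by (simp add: y_def diff_divide_distrib[symmetric])
  have "spread d e a = (\<Sum>i\<in>{1..d}. (p i)\<^sup>2 / ((1 - p 0)\<^sup>2 * W\<^sup>2))"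
    unfolding spread_shift by (intro sum.cong) (auto simp: u y_def power_divide power_mult_distrib)
  also have "\<dots> = (1 - (p 0)\<^sup>2) / ((1 - p 0)\<^sup>2 * W\<^sup>2)"
    using sq by (simp flip: sum_divide_distrib)
  also have "1 - (p 0)\<^sup>2 = (1 + p 0) * (1 - p 0)"
    by (simp add: power2_eq_square algebra_simps)
  finally have s: "spread d e a = (1 + p 0) / ((1 - p 0) * W\<^sup>2)"
    using p0 by (simp add: power2_eq_square)
  have m2: "(min_coord (e ` {..d}) a)\<^sup>2 = (1 - p 0) / ((1 - p 0) * W\<^sup>2)"
    using p0 m by (simp add: power_divide)
  have sm: "spread d e a + (min_coord (e ` {..d}) a)\<^sup>2 = 2 / ((1 - p 0) * W\<^sup>2)"
    "spread d e a - (min_coord (e ` {..d}) a)\<^sup>2 = 2 * p 0 / ((1 - p 0) * W\<^sup>2)"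
    unfolding s m2 add_divide_distrib[symmetric] diff_divide_distrib[symmetric]
    by (rule arg_cong2[where f = divide]; simp)+
  have "simplex_to_sphere d e a i = p i" for i
  proof -
    consider "i = 0" | "0 < i" "i \<le> d" | "d < i" by linarith
    then show ?thesis
    proof cases
      case 1
      then show ?thesis using p0 W by (simp add: simplex_to_sphere_def Let_def sm)
    next
      case 2
      have "simplex_to_sphere d e a i = 2 * (1 / W) * (y i / W) / (2 / ((1 - p 0) * W\<^sup>2))"
        unfolding simplex_to_sphere_def Let_def sm(1)
        unfolding m u[OF 2(2)] using 2 by simp
      also have "\<dots> = p i" using 2 p0 W by (simp add: y_def power2_eq_square)
      finally show ?thesis .
    next
      case 3
      then show ?thesis using out by (simp add: simplex_to_sphere_def)
    qed
  qed
  then show ?thesis using a by (metis ext imageI)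
qed

lemma quotient_map_simplex_to_sphere:
  assumes "inj_on e {..d}" "0 < d"
  shows "quotient_map (top_of_set (closed_simplex (e ` {..d}))) (nsphere d) (simplex_to_sphere d e)"
proof (rule continuous_imp_quotient_map)
  let ?S = "closed_simplex (e ` {..d})"
  show "continuous_map (top_of_set ?S) (nsphere d) (simplex_to_sphere d e)"
    using continuous_on_simplex_to_sphere[of e d] simplex_to_sphere_in_sphere[of _ e d]
    unfolding nsphere euclidean_product_topology
    by (auto simp: continuous_map_in_subtopology topspace_nsphere)
  show "compact_space (top_of_set ?S)"
    by (simp add: compact_space_subtopology compact_closed_simplex)
  show "Hausdorff_space (nsphere d)"
    unfolding nsphere_def by (intro Hausdorff_space_subtopology Hausdorff_Euclidean_space)
  show "simplex_to_sphere d e ` topspace (top_of_set ?S) = topspace (nsphere d)"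
    using simplex_to_sphere_in_sphere[of _ e d] simplex_to_sphere_surj[OF assms] by auto
qed

section \<open>Attaching simplices to a contractible complex\<close>

lemma closed_closed_simplex: "finite \<sigma> \<Longrightarrow> closed (closed_simplex \<sigma>)"
  using closedin_closed_simplex[of \<sigma>] by (simp add: euclidean_product_topology)

lemma closed_polyhedron:
  assumes "finite_complex K"
  shows "closed (polyhedron K)"
  unfolding polyhedron_def
  by (intro closed_UN finite_complexD(1)[OF assms] ballI closed_closed_simplex finite_complexD(2)[OF assms])

context
  fixes K C :: "'a set set"
  assumes K: "finite_complex K" and CK: "C \<subseteq> K"
    and facet: "\<And>\<sigma> \<tau>. \<lbrakk>\<sigma> \<in> C; \<tau> \<in> K; \<sigma> \<subseteq> \<tau>\<rbrakk> \<Longrightarrow> \<tau> = \<sigma>"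
begin

lemma finite_complex_remove_facets: "finite_complex (K - C)"
proof (rule finite_complex_subset[OF K])
  fix \<sigma> \<tau> assume a: "\<sigma> \<in> K - C" "\<tau> \<subseteq> \<sigma>" "\<tau> \<in> K"
  have "\<tau> \<notin> C"
  proof
    assume "\<tau> \<in> C"
    then have "\<sigma> = \<tau>" using facet[of \<tau> \<sigma>] a by blast
    then show False using a \<open>\<tau> \<in> C\<close> by blast
  qed
  then show "\<tau> \<in> K - C" using a by blast
qed blast

lemma polyhedron_remove_facets_iff:
  "a \<in> polyhedron (K - C) \<longleftrightarrow> a \<in> polyhedron K \<and> support a \<notin> C"
  unfolding polyhedron_iff[OF K] polyhedron_iff[OF finite_complex_remove_facets] by blast

lemma facetD:
  assumes "\<sigma> \<in> C"
  shows "finite \<sigma>" "\<sigma> \<noteq> {}" "closed_simplex \<sigma> \<subseteq> polyhedron K"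
proof -
  have \<sigma>: "\<sigma> \<in> K" using assms CK by blast
  show "finite \<sigma>" "\<sigma> \<noteq> {}" using finite_complexD(2,3)[OF K \<sigma>] .
  show "closed_simplex \<sigma> \<subseteq> polyhedron K" using \<sigma> by (auto simp: polyhedron_def)
qed

text \<open>
  Facets are maximal, so no proper face of \<open>\<sigma>\<close> is in \<open>C\<close>, and removing \<open>C\<close> takes away only the interior
  of \<open>\<sigma>\<close>, where no coordinate on \<open>\<sigma>\<close> vanishes.
\<close>

lemma facet_point_cases:
  assumes \<sigma>: "\<sigma> \<in> C" and a: "a \<in> closed_simplex \<sigma>"
  shows "a \<in> polyhedron (K - C) \<longleftrightarrow> min_coord \<sigma> a = 0"
    and "a \<notin> polyhedron (K - C) \<Longrightarrow> support a = \<sigma>"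
proof -
  note f = facetD[OF \<sigma>]
  have aK: "a \<in> polyhedron K" using f(3) a by blast
  have s: "support a \<subseteq> \<sigma>" "\<forall>v. 0 \<le> a v" using a by (auto simp: closed_simplex_iff[OF f(1)])
  have "support a \<in> C \<longleftrightarrow> support a = \<sigma>"
    using facet[of "support a" \<sigma>] \<sigma> s CK by blast
  then have eq: "a \<in> polyhedron (K - C) \<longleftrightarrow> support a \<noteq> \<sigma>"
    using aK by (simp add: polyhedron_remove_facets_iff)
  then show "a \<notin> polyhedron (K - C) \<Longrightarrow> support a = \<sigma>" by blast
  show "a \<in> polyhedron (K - C) \<longleftrightarrow> min_coord \<sigma> a = 0"
    unfolding eq min_coord_eq_0_iff[OF f(1,2) s(2)] using s(1) by blast
qed

lemma polyhedron_facet_cover: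
  assumes "a \<in> polyhedron K" "a \<notin> polyhedron (K - C)"
  shows "support a \<in> C" "a \<in> closed_simplex (support a)"
proof -
  show s: "support a \<in> C" using assms by (simp add: polyhedron_remove_facets_iff)
  show "a \<in> closed_simplex (support a)"
    using assms(1) facetD(1)[OF s] by (simp add: polyhedron_iff[OF K] closed_simplex_iff)
qed

text \<open>
  Homotopy extension for a complex \<open>K\<close> and the subcomplex left when a set \<open>C\<close> of facets is removed.
  At time \<open>t\<close>, a facet is expanded from its barycentre by the factor \<open>1 + t\<close>. A point that stays inside
  is moved accordingly; a point that leaves the facet, having reached the distance \<open>r > 1\<close> from the
  barycentre, is projected radially to the boundary and moved from there by the given homotopy up to
  time \<open>r - 1\<close>.
\<close>

lemma homotopy_extension_facets:
  assumes h: "continuous_on ({0..1} \<times> polyhedron (K - C)) h"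
    and h_into: "h ` ({0..1} \<times> polyhedron (K - C)) \<subseteq> polyhedron (K - C)"
    and h_0: "\<And>a. a \<in> polyhedron (K - C) \<Longrightarrow> h (0, a) = a"
  obtains H where "continuous_on ({0..1::real} \<times> polyhedron K) H"
    "H ` ({0..1} \<times> polyhedron K) \<subseteq> polyhedron K"
    "\<And>a. a \<in> polyhedron K \<Longrightarrow> H (0, a) = a"
    "\<And>t a. a \<in> polyhedron (K - C) \<Longrightarrow> H (t, a) = h (t, a)"
proof -
  let ?I = "{0..1::real}" and ?A = "polyhedron (K - C)"
  \<comment> \<open>the radial distance from the barycentre after the expansion, scaled to 1 on the boundary\<close>
  define rad where "rad \<sigma> x = (1 + fst x) * (1 - real (card \<sigma>) * min_coord \<sigma> (snd x))"
    for \<sigma> :: "'a set" and x :: "real \<times> ('a \<Rightarrow> real)"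
  define expand where "expand \<sigma> x =
      (\<lambda>v. (1 + fst x) * snd x v - (if v \<in> \<sigma> then fst x / real (card \<sigma>) else 0))"
    for \<sigma> :: "'a set" and x :: "real \<times> ('a \<Rightarrow> real)"
  define proj where "proj \<sigma> a =
      (\<lambda>v. (a v - (if v \<in> \<sigma> then min_coord \<sigma> a else 0)) / (1 - real (card \<sigma>) * min_coord \<sigma> a))"
    for \<sigma> :: "'a set" and a :: "'a \<Rightarrow> real"
  define G where "G \<sigma> x = (if rad \<sigma> x \<le> 1 then expand \<sigma> x else h (rad \<sigma> x - 1, proj \<sigma> (snd x)))"
    for \<sigma> x
  define H where "H x = (if snd x \<in> ?A then h x else G (support (snd x)) x)" for x
  have simplexD: "\<forall>v. 0 \<le> a v" "\<And>v. v \<notin> \<sigma> \<Longrightarrow> a v = 0" "sum a \<sigma> = 1" "0 \<le> min_coord \<sigma> a"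
      "0 < real (card \<sigma>)" "finite \<sigma>"
    if "\<sigma> \<in> C" "a \<in> closed_simplex \<sigma>" for \<sigma> a
    using that facetD[OF that(1)] by (auto simp: closed_simplex_def min_coord_nonneg card_gt_0_iff)
  have expand_0: "expand \<sigma> (0, a) = a" for \<sigma> a
    by (rule ext) (auto simp: expand_def)
  have expand_simplex: "expand \<sigma> (t, a) \<in> closed_simplex \<sigma>"
    if \<sigma>: "\<sigma> \<in> C" and a: "a \<in> closed_simplex \<sigma>" and t: "0 \<le> t" and r: "rad \<sigma> (t, a) \<le> 1" for \<sigma> t a
  proof -
    note D = simplexD[OF \<sigma> a]
    have "t / real (card \<sigma>) \<le> (1 + t) * min_coord \<sigma> a"
      using r D(5) by (simp add: rad_def field_simps)
    also have "\<dots> \<le> (1 + t) * a v" if "v \<in> \<sigma>" for v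
      using t min_coord_le[OF D(6) that] by (intro mult_left_mono) auto
    finally have "0 \<le> expand \<sigma> (t, a) v" for v
      using t D(1) by (auto simp: expand_def)
    moreover have "sum (expand \<sigma> (t, a)) \<sigma> = 1"
      using D(3,5) by (simp add: expand_def sum_subtractf flip: sum_distrib_left)
    ultimately show ?thesis
      using D(2) by (auto simp: closed_simplex_def expand_def)
  qed
  have proj_A: "proj \<sigma> a \<in> ?A"
    if \<sigma>: "\<sigma> \<in> C" and a: "a \<in> closed_simplex \<sigma>" and pos: "1 - real (card \<sigma>) * min_coord \<sigma> a > 0" for \<sigma> a
  proof -
    note D = simplexD[OF \<sigma> a]
    have "0 \<le> proj \<sigma> a v" for v
      using pos D(1) min_coord_le[OF D(6), of v a] by (auto simp: proj_def)
    moreover have "sum (proj \<sigma> a) \<sigma> = 1"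
      using pos D(3) by (simp add: proj_def sum_subtractf flip: sum_divide_distrib)
    ultimately have p: "proj \<sigma> a \<in> closed_simplex \<sigma>"
      using D(2) by (auto simp: closed_simplex_def proj_def)
    obtain v where "v \<in> \<sigma>" "a v = min_coord \<sigma> a"
      using min_coord_attained[OF facetD(1,2)[OF \<sigma>]] .
    then have "v \<in> \<sigma> \<and> v \<notin> support (proj \<sigma> a)" by (simp add: proj_def support_def)
    then show ?thesis using facet_point_cases(2)[OF \<sigma> p] by blast
  qed
  have rad_pos: "1 - real (card \<sigma>) * min_coord \<sigma> a > 0 \<and> rad \<sigma> (t, a) - 1 \<in> ?I"
    if \<sigma>: "\<sigma> \<in> C" and a: "a \<in> closed_simplex \<sigma>" and t: "0 \<le> t" "t \<le> 1" and r: "1 \<le> rad \<sigma> (t, a)" for \<sigma> t a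
  proof -
    note D = simplexD[OF \<sigma> a]
    let ?s = "1 - real (card \<sigma>) * min_coord \<sigma> a"
    have "0 < (1 + t) * ?s" using r by (simp add: rad_def)
    then have s: "0 < ?s" using t by (simp add: zero_less_mult_iff)
    have "?s \<le> 1" using D(4) by simp
    then have "(1 + t) * ?s \<le> 2 * 1" using t s by (intro mult_mono) auto
    then show ?thesis using r s by (simp add: rad_def)
  qed
  have G_cont: "continuous_on (?I \<times> closed_simplex \<sigma>) (G \<sigma>)" if \<sigma>: "\<sigma> \<in> C" for \<sigma>
    unfolding G_def
  proof (rule continuous_on_cases_le)
    let ?S = "?I \<times> closed_simplex \<sigma>"
    have m: "continuous_on S (\<lambda>x. min_coord \<sigma> (snd x))" for S :: "(real \<times> ('a \<Rightarrow> real)) set"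
      by (rule continuous_on_compose2[OF continuous_on_min_coord[OF facetD(1,2)[OF \<sigma>], of UNIV]
            continuous_on_snd[OF continuous_on_id]]) simp
    show rad: "continuous_on ?S (rad \<sigma>)"
      unfolding rad_def
      by (intro continuous_on_mult continuous_on_add continuous_on_diff continuous_on_const
          continuous_on_fst continuous_on_id m)
    show "continuous_on {x \<in> ?S. rad \<sigma> x \<le> 1} (expand \<sigma>)"
    proof (rule continuous_on_coordinatewise_then_product)
      show "continuous_on {x \<in> ?S. rad \<sigma> x \<le> 1} (\<lambda>x. expand \<sigma> x v)" for v
        unfolding expand_def
        by (cases "v \<in> \<sigma>"; simp only: if_True if_False divide_inverse;
            intro continuous_on_mult continuous_on_add continuous_on_diff continuous_on_const
            continuous_on_fst continuous_on_id continuous_on_snd_coordinate)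
    qed
    let ?T = "{x \<in> ?S. 1 \<le> rad \<sigma> x}"
    have T: "1 - real (card \<sigma>) * min_coord \<sigma> (snd x) > 0" "rad \<sigma> x - 1 \<in> ?I" "proj \<sigma> (snd x) \<in> ?A"
      if "x \<in> ?T" for x
      using that rad_pos[OF \<sigma>, of "snd x" "fst x"] proj_A[OF \<sigma>, of "snd x"] by auto
    have "continuous_on ?T (\<lambda>x. proj \<sigma> (snd x))"
    proof (rule continuous_on_coordinatewise_then_product)
      show "continuous_on ?T (\<lambda>x. proj \<sigma> (snd x) v)" for v
        unfolding proj_def
      proof (rule continuous_on_divide)
        show "continuous_on ?T (\<lambda>x. snd x v - (if v \<in> \<sigma> then min_coord \<sigma> (snd x) else 0))"
          by (cases "v \<in> \<sigma>"; simp only: if_True if_False;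
            intro continuous_on_diff continuous_on_const continuous_on_snd_coordinate m)
        show "continuous_on ?T (\<lambda>x. 1 - real (card \<sigma>) * min_coord \<sigma> (snd x))"
          by (intro continuous_on_diff continuous_on_mult continuous_on_const m)
      qed (use T in force)
    qed
    moreover have "continuous_on ?T (\<lambda>x. rad \<sigma> x - 1)"
      by (intro continuous_on_diff continuous_on_const continuous_on_subset[OF rad]) blast
    ultimately have "continuous_on ?T (\<lambda>x. (rad \<sigma> x - 1, proj \<sigma> (snd x)))"
      by (intro continuous_on_Pair)
    then show "continuous_on ?T (\<lambda>x. h (rad \<sigma> x - 1, proj \<sigma> (snd x)))"
      by (rule continuous_on_compose2[OF h]) (use T in blast)
    fix x assume x: "x \<in> ?S" "rad \<sigma> x = 1"
    then have "x \<in> ?T" by simp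
    note Tx = T[OF this]
    have eq: "(1 + fst x) * (1 - real (card \<sigma>) * min_coord \<sigma> (snd x)) = 1"
      using x(2) by (simp add: rad_def)
    have D: "0 < real (card \<sigma>)" using x(1) simplexD(5)[OF \<sigma>, of "snd x"] by auto
    have "expand \<sigma> x v = proj \<sigma> (snd x) v" for v
    proof -
      let ?s = "1 - real (card \<sigma>) * min_coord \<sigma> (snd x)"
      have inv: "1 + fst x = 1 / ?s" using eq Tx(1) by (simp add: field_simps)
      have "fst x / real (card \<sigma>) = (1 + fst x) * min_coord \<sigma> (snd x)"
        using eq D by (simp add: field_simps)
      then have "expand \<sigma> x v = (1 + fst x) * (snd x v - (if v \<in> \<sigma> then min_coord \<sigma> (snd x) else 0))"
        by (simp add: expand_def algebra_simps)
      then show ?thesis unfolding inv proj_def by simp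
    qed
    then show "expand \<sigma> x = h (rad \<sigma> x - 1, proj \<sigma> (snd x))"
      using h_0[OF Tx(3)] x(2) by auto
  qed
  have G_into: "G \<sigma> (t, a) \<in> polyhedron K"
    if \<sigma>: "\<sigma> \<in> C" and a: "a \<in> closed_simplex \<sigma>" and t: "0 \<le> t" "t \<le> 1" for \<sigma> t a
  proof (cases "rad \<sigma> (t, a) \<le> 1")
    case True
    then show ?thesis
      using expand_simplex[OF \<sigma> a t(1)] facetD(3)[OF \<sigma>] by (auto simp: G_def)
  next
    case False
    then have "1 \<le> rad \<sigma> (t, a)" by simp
    note R = rad_pos[OF \<sigma> a t this]
    have "proj \<sigma> a \<in> ?A" using proj_A[OF \<sigma> a] R by blast
    then have "h (rad \<sigma> (t, a) - 1, proj \<sigma> a) \<in> ?A" using h_into R by blast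
    then show ?thesis using False by (simp add: G_def polyhedron_remove_facets_iff)
  qed
  have G_boundary: "G \<sigma> (t, a) = h (t, a)"
    if \<sigma>: "\<sigma> \<in> C" and a: "a \<in> closed_simplex \<sigma>" "a \<in> ?A" and t: "0 \<le> t" for \<sigma> t a
  proof -
    have m: "min_coord \<sigma> a = 0" using facet_point_cases(1)[OF \<sigma> a(1)] a(2) by blast
    have r: "rad \<sigma> (t, a) = 1 + t" by (simp add: rad_def m)
    show ?thesis
    proof (cases "t = 0")
      case True
      then show ?thesis using r h_0[OF a(2)] by (simp add: G_def expand_0)
    next
      case False
      moreover have "proj \<sigma> a = a" by (rule ext) (auto simp: proj_def m)
      ultimately show ?thesis using r t by (simp add: G_def)
    qed
  qed
  have H_G: "H (t, a) = G \<sigma> (t, a)"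
    if \<sigma>: "\<sigma> \<in> C" and a: "a \<in> closed_simplex \<sigma>" and t: "0 \<le> t" for \<sigma> t a
    using G_boundary[OF \<sigma> a _ t] facet_point_cases(2)[OF \<sigma> a] by (cases "a \<in> ?A") (auto simp: H_def)
  have H_A: "H (t, a) = h (t, a)" if "a \<in> ?A" for t a
    using that by (simp add: H_def)
  have AK: "?A \<subseteq> polyhedron K" using polyhedron_remove_facets_iff by blast
  have H_into: "H x \<in> polyhedron K" if x: "x \<in> ?I \<times> polyhedron K" for x
  proof -
    obtain t a where ta: "x = (t, a)" "0 \<le> t" "t \<le> 1" "a \<in> polyhedron K" using x by auto
    show ?thesis
    proof (cases "a \<in> ?A")
      case True
      then have "h (t, a) \<in> ?A" using h_into ta by force
      then show ?thesis using H_A[OF True] AK ta by auto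
    next
      case False
      note s = polyhedron_facet_cover[OF ta(4) False]
      show ?thesis using G_into[OF s ta(2,3)] H_G[OF s ta(2)] ta(1) by simp
    qed
  qed
  have "continuous_on (?I \<times> polyhedron K) H"
  proof -
    let ?X = "top_of_set (?I \<times> polyhedron K)"
    define T where "T j = (case j of None \<Rightarrow> ?I \<times> ?A | Some \<sigma> \<Rightarrow> ?I \<times> closed_simplex \<sigma>)" for j
    have TK: "T j \<subseteq> ?I \<times> polyhedron K" if "j \<in> insert None (Some ` C)" for j
    proof (cases j)
      case None
      then show ?thesis using AK by (simp add: T_def Sigma_mono)
    next
      case (Some \<sigma>)
      then show ?thesis using that facetD(3)[of \<sigma>] by (auto simp: T_def)
    qed
    have "continuous_map ?X euclidean H"
    proof (rule pasting_lemma_closed[where I = "insert None (Some ` C)" and T = T and f = "\<lambda>_. H"])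
      show "finite (insert None (Some ` C))"
        using finite_subset[OF CK finite_complexD(1)[OF K]] by simp
      show "closedin ?X (T j)" if j: "j \<in> insert None (Some ` C)" for j
      proof (rule closed_subset[OF TK[OF j]])
        show "closed (T j)"
        proof (cases j)
          case None
          then show ?thesis
            using closed_Times[OF closed_atLeastAtMost closed_polyhedron[OF finite_complex_remove_facets]] by (simp add: T_def)
        next
          case (Some \<sigma>)
          then have "\<sigma> \<in> C" using j by blast
          then show ?thesis
            using closed_Times[OF closed_atLeastAtMost closed_closed_simplex[OF facetD(1)]] Some by (simp add: T_def)
        qed
      qed
      show "continuous_map (subtopology ?X (T j)) euclidean H" if j: "j \<in> insert None (Some ` C)" for j
      proof -
        have "continuous_on (T j) H"
        proof (cases j)
          case None
          show ?thesis unfolding T_def None option.case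
            by (rule continuous_on_eq[OF h]) (auto simp: H_A)
        next
          case (Some \<sigma>)
          then have \<sigma>: "\<sigma> \<in> C" using j by auto
          show ?thesis unfolding T_def Some option.case
            by (rule continuous_on_eq[OF G_cont[OF \<sigma>]]) (auto simp: H_G[OF \<sigma>])
        qed
        then show ?thesis using TK[OF j] by (simp add: subtopology_subtopology Int_absorb1)
      qed
      show "\<exists>j. j \<in> insert None (Some ` C) \<and> x \<in> T j \<and> H x = H x" if x: "x \<in> topspace ?X" for x
      proof (cases "snd x \<in> ?A")
        case True
        then have "x \<in> T None" using x by (auto simp: T_def)
        then show ?thesis by blast
      next
        case False
        have "snd x \<in> polyhedron K" using x by auto
        note s = polyhedron_facet_cover[OF this False]
        then have "x \<in> T (Some (support (snd x)))" using x by (auto simp: T_def mem_Times_iff)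
        then show ?thesis using s by blast
      qed
    qed simp
    then show ?thesis by simp
  qed
  moreover have "H (0, a) = a" if "a \<in> polyhedron K" for a
  proof (cases "a \<in> ?A")
    case True
    then show ?thesis using H_A h_0 by simp
  next
    case False
    note s = polyhedron_facet_cover[OF that False]
    have "rad (support a) (0, a) \<le> 1" using simplexD(4,5)[OF s] by (simp add: rad_def)
    then show ?thesis using H_G[OF s, of 0] by (simp add: G_def expand_0)
  qed
  moreover have "H ` (?I \<times> polyhedron K) \<subseteq> polyhedron K" using H_into by blast
  ultimately show thesis using that H_A by blast
qed

end

lemma quotient_map_factor:
  assumes "quotient_map X Y f" "continuous_map X Z h"
    and "\<And>x y. \<lbrakk>x \<in> topspace X; y \<in> topspace X; f x = f y\<rbrakk> \<Longrightarrow> h x = h y"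
  shows "\<exists>g. continuous_map Y Z g \<and> (\<forall>x\<in>topspace X. g (f x) = h x)"
proof (rule quotient_map_lift_exists[OF assms])
  fix g assume g: "continuous_map Y Z g" "\<And>x. x \<in> topspace X \<Longrightarrow> g (f x) = h x"
  show ?thesis using g by blast
qed

text \<open>
  The map \<open>f\<close> to the wedge sends the contractible part to the base point and every facet in \<open>C\<close> onto its
  own sphere; it is a quotient map because both topologies are final, for the simplices and for
  the spheres. The contraction extended to \<open>K\<close> gives \<open>H\<close>. Its end map is constant on the contractible
  part and so factors through \<open>f\<close>, which gives the homotopy inverse \<open>g\<close>. Likewise \<open>f \<circ> H\<close> factors
  through \<open>f\<close> at every time, which gives the homotopy from the identity to \<open>f \<circ> g\<close>.
\<close>

theorem homotopy_equivalent_wedge_of_spheres: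
  fixes K C :: "'a set set"
  assumes K: "finite_complex K" and CK: "C \<subseteq> K"
    and facet: "\<And>\<sigma> \<tau>. \<lbrakk>\<sigma> \<in> C; \<tau> \<in> K; \<sigma> \<subseteq> \<tau>\<rbrakk> \<Longrightarrow> \<tau> = \<sigma>"
    and d: "0 < d" and card: "\<And>\<sigma>. \<sigma> \<in> C \<Longrightarrow> card \<sigma> = Suc d"
    and ne: "K - C \<noteq> {}" and contr: "contractible_space (geometric_realization (K - C))"
  shows "geometric_realization K homotopy_equivalent_space
    wedge_sum (\<lambda>_. nsphere d) (\<lambda>_. sphere_base) {..<card C}"
proof -
  note fc = K CK facet
  let ?I = "{0..1::real}" and ?A = "polyhedron (K - C)" and ?P = "polyhedron K"
  let ?X = "top_of_set ?P"
  let ?W = "wedge_sum (\<lambda>_::nat. nsphere d) (\<lambda>_. sphere_base) {..<card C}"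
  let ?incl = "wedge_inclusion (\<lambda>_::nat. sphere_base)"
  have L: "finite_complex (K - C)" by (rule finite_complex_remove_facets[OF fc])
  have X: "geometric_realization K = ?X" by (rule geometric_realization_eq_top_of_set[OF K])
  have AX: "a \<in> ?A \<longleftrightarrow> a \<in> ?P \<and> support a \<notin> C" for a
    by (rule polyhedron_remove_facets_iff[OF fc])

  obtain p where "homotopic_with (\<lambda>_. True) (top_of_set ?A) (top_of_set ?A) id (\<lambda>_. p)"
    using contr unfolding contractible_space_def geometric_realization_eq_top_of_set[OF L] by blast
  then obtain h where h: "continuous_on (?I \<times> ?A) h" "h ` (?I \<times> ?A) \<subseteq> ?A"
    and h01: "\<And>a. h (0, a) = a" "\<And>a. h (1, a) = p"
    unfolding homotopic_with_def by auto
  obtain H where H: "continuous_on (?I \<times> ?P) H" "H ` (?I \<times> ?P) \<subseteq> ?P"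
    and H0: "\<And>a. a \<in> ?P \<Longrightarrow> H (0, a) = a" and HA: "\<And>t a. a \<in> ?A \<Longrightarrow> H (t, a) = h (t, a)"
    using homotopy_extension_facets[OF fc h h01(1)] by blast

  have finC: "finite C" using finite_subset[OF CK finite_complexD(1)[OF K]] .
  obtain \<kappa> where \<kappa>: "bij_betw \<kappa> {..<card C} C"
    using ex_bij_betw_nat_finite[OF finC] by (auto simp: atLeast0LessThan)
  have "\<exists>e. bij_betw e {..d} \<sigma>" if "\<sigma> \<in> C" for \<sigma>
    using card[OF that] facetD(1)[OF fc that] by (intro finite_same_card_bij) auto
  then obtain e where e: "\<And>\<sigma>. \<sigma> \<in> C \<Longrightarrow> bij_betw (e \<sigma>) {..d} \<sigma>" by metis
  define q where "q i = simplex_to_sphere d (e (\<kappa> i))" for i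
  define f where "f a = (if support a \<in> C then
      let i = inv_into {..<card C} \<kappa> (support a) in ?incl i (q i a) else None)" for a
  have \<kappa>C: "\<kappa> i \<in> C" if "i < card C" for i using \<kappa> that by (auto simp: bij_betw_def)
  have ek: "inj_on (e (\<kappa> i)) {..d}" "e (\<kappa> i) ` {..d} = \<kappa> i" if "i < card C" for i
    using e[OF \<kappa>C[OF that]] by (auto simp: bij_betw_def)
  have q: "quotient_map (top_of_set (closed_simplex (\<kappa> i))) (nsphere d) (q i)" if "i < card C" for i
    using quotient_map_simplex_to_sphere[OF ek(1)[OF that] d] unfolding q_def ek(2)[OF that] .
  have q_base: "q i a = sphere_base \<longleftrightarrow> a \<in> ?A" if i: "i < card C" and a: "a \<in> closed_simplex (\<kappa> i)" for i a
    using simplex_to_sphere_eq_base_iff[of a "e (\<kappa> i)" d] a facet_point_cases(1)[OF fc \<kappa>C[OF i] a]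
    unfolding q_def ek(2)[OF i] by blast
  have q_inj: "a = b" if i: "i < card C" and a: "a \<in> closed_simplex (\<kappa> i)" "a \<notin> ?A"
      and b: "b \<in> closed_simplex (\<kappa> i)" "b \<notin> ?A" and eq: "q i a = q i b" for i a b
    using simplex_to_sphere_inj[of a "e (\<kappa> i)" d b] a b eq
      facet_point_cases(1)[OF fc \<kappa>C[OF i] a(1)] facet_point_cases(1)[OF fc \<kappa>C[OF i] b(1)]
    unfolding q_def ek(2)[OF i] by blast
  have f_A: "f a = None" if "a \<in> ?A" for a
    using that by (simp add: f_def AX)
  have f_cell: "f a = ?incl i (q i a)" if i: "i < card C" and a: "a \<in> closed_simplex (\<kappa> i)" for i a
  proof (cases "a \<in> ?A")
    case True
    then show ?thesis using f_A q_base[OF i a] by (simp add: wedge_inclusion_def)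
  next
    case False
    then have s: "support a = \<kappa> i" using facet_point_cases(2)[OF fc \<kappa>C[OF i] a] by blast
    then have "inv_into {..<card C} \<kappa> (support a) = i"
      using \<kappa> i by (simp add: bij_betw_inv_into_left)
    then show ?thesis using \<kappa>C[OF i] s by (simp add: f_def Let_def)
  qed
  have cover: "\<exists>i<card C. a \<in> closed_simplex (\<kappa> i)" if a: "a \<in> ?P" "a \<notin> ?A" for a
  proof -
    note s = polyhedron_facet_cover[OF fc a]
    have "support a \<in> \<kappa> ` {..<card C}" using s(1) \<kappa> by (simp add: bij_betw_def)
    then obtain i where "i < card C" "\<kappa> i = support a" by auto
    then show ?thesis using s by auto
  qed
  have f_Some: "\<exists>i<card C. a \<in> closed_simplex (\<kappa> i) \<and> f a = Some (i, q i a)" if a: "a \<in> ?P" "a \<notin> ?A" for a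
  proof -
    obtain i where i: "i < card C" "a \<in> closed_simplex (\<kappa> i)" using cover[OF a] by blast
    then show ?thesis using f_cell[OF i] q_base[OF i] a(2) by (auto simp: wedge_inclusion_def)
  qed
  have f_eq: "a = b \<or> a \<in> ?A \<and> b \<in> ?A" if ab: "a \<in> ?P" "b \<in> ?P" "f a = f b" for a b
  proof (cases "a \<in> ?A")
    case True
    then show ?thesis using f_A[of a] f_Some[OF ab(2)] ab(3) by force
  next
    case False
    then have "b \<notin> ?A" using f_A[of b] f_Some[OF ab(1)] ab(3) by force
    obtain i where i: "i < card C" "a \<in> closed_simplex (\<kappa> i)" "f a = Some (i, q i a)"
      using f_Some[OF ab(1) False] by blast
    obtain j where j: "j < card C" "b \<in> closed_simplex (\<kappa> j)" "f b = Some (j, q j b)"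
      using f_Some[OF ab(2) \<open>b \<notin> ?A\<close>] by blast
    have "Some (i, q i a) = Some (j, q j b)"
      unfolding i(3)[symmetric] j(3)[symmetric] by (rule ab(3))
    then have ij: "i = j" "q i a = q j b" unfolding option.inject prod.inject by blast+
    have "a = b"
      using q_inj[OF i(1,2) False _ \<open>b \<notin> ?A\<close>] j(2) ij(2) unfolding ij(1) by blast
    then show ?thesis ..
  qed

  have sphere_image: "q i ` closed_simplex (\<kappa> i) = topspace (nsphere d)" if "i < card C" for i
    using q[OF that] by (simp add: quotient_map_def)
  have cell_P: "closed_simplex (\<kappa> i) \<subseteq> ?P" if "i < card C" for i
    by (rule facetD(3)[OF fc \<kappa>C[OF that]])
  have f_quot: "quotient_map ?X ?W f"
    unfolding quotient_map_def
  proof (intro conjI allI impI)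
    show "f ` topspace ?X = topspace ?W"
    proof
      show "f ` topspace ?X \<subseteq> topspace ?W"
      proof
        fix w assume "w \<in> f ` topspace ?X"
        then obtain a where a: "a \<in> ?P" "w = f a" by auto
        show "w \<in> topspace ?W"
        proof (cases "a \<in> ?A")
          case True
          then show ?thesis using f_A a by (simp add: topspace_wedge_sum)
        next
          case False
          then obtain i where "i < card C" "a \<in> closed_simplex (\<kappa> i)" using cover a(1) by blast
          then show ?thesis
            using f_cell[of i a] sphere_image[of i] a(2) by (auto simp: topspace_wedge_sum)
        qed
      qed
      have "None \<in> f ` ?P"
      proof -
        obtain \<sigma> where \<sigma>: "\<sigma> \<in> K - C" using ne by blast
        then obtain v where v: "v \<in> \<sigma>" using finite_complexD(3)[OF L \<sigma>] by blast
        define a where "a = (\<lambda>u. if u = v then 1 else 0 :: real)"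
        have "a \<in> closed_simplex \<sigma>"
          using v finite_complexD(2)[OF L \<sigma>] by (auto simp: a_def closed_simplex_def)
        then have "a \<in> ?A" using \<sigma> by (auto simp: polyhedron_def)
        then show ?thesis using f_A[of a] AX by (metis image_eqI)
      qed
      moreover have "?incl i x \<in> f ` ?P" if i: "i < card C" and x: "x \<in> topspace (nsphere d)" for i x
      proof -
        obtain a where "a \<in> closed_simplex (\<kappa> i)" "x = q i a" using sphere_image[OF i] x by blast
        then show ?thesis using f_cell[OF i] cell_P[OF i] by (metis image_eqI subsetD)
      qed
      ultimately show "topspace ?W \<subseteq> f ` topspace ?X"
        by (auto simp: topspace_wedge_sum)
    qed
    fix U assume U: "U \<subseteq> topspace ?W"
    let ?V = "{a \<in> topspace ?X. f a \<in> U}"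
    \<comment> \<open>on a facet \<open>f\<close> is the quotient map \<open>q i\<close> followed by the inclusion of a sphere\<close>
    have V_cell: "openin (subtopology (powertop_real UNIV) (closed_simplex (\<kappa> i))) (closed_simplex (\<kappa> i) \<inter> ?V)
        \<longleftrightarrow> openin (nsphere d) {x \<in> topspace (nsphere d). ?incl i x \<in> U}" if i: "i < card C" for i
    proof -
      let ?Z = "{x \<in> topspace (nsphere d). ?incl i x \<in> U}"
      let ?S = "top_of_set (closed_simplex (\<kappa> i))"
      have "closed_simplex (\<kappa> i) \<inter> ?V = {a \<in> topspace ?S. q i a \<in> ?Z}"
        using f_cell[OF i] cell_P[OF i] sphere_image[OF i] by auto
      moreover have "openin ?S {a \<in> topspace ?S. q i a \<in> ?Z} \<longleftrightarrow> openin (nsphere d) ?Z"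
        by (rule conjunct2[OF q[OF i, unfolded quotient_map_def], rule_format]) blast
      ultimately show ?thesis by (simp only: euclidean_product_topology)
    qed
    \<comment> \<open>on the other simplices \<open>f\<close> is constant\<close>
    have V_A: "openin (subtopology (powertop_real UNIV) (closed_simplex \<sigma>)) (closed_simplex \<sigma> \<inter> ?V)"
      if \<sigma>: "\<sigma> \<in> K - C" for \<sigma>
    proof -
      have "closed_simplex \<sigma> \<subseteq> ?A" using \<sigma> by (auto simp: polyhedron_def)
      then have "closed_simplex \<sigma> \<inter> ?V = (if None \<in> U then closed_simplex \<sigma> else {})"
        using f_A AX by auto
      then show ?thesis
        using openin_topspace[of "subtopology (powertop_real UNIV) (closed_simplex \<sigma>)"] by simp
    qed
    have "openin ?X ?V \<longleftrightarrow> (\<forall>\<sigma>\<in>K. openin (subtopology (powertop_real UNIV) (closed_simplex \<sigma>)) (closed_simplex \<sigma> \<inter> ?V))"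
      unfolding X[symmetric] openin_geometric_realization by (auto simp: X polyhedron_def)
    also have "\<dots> \<longleftrightarrow> (\<forall>\<sigma>\<in>C. openin (subtopology (powertop_real UNIV) (closed_simplex \<sigma>)) (closed_simplex \<sigma> \<inter> ?V))"
      using V_A CK by blast
    also have "\<dots> \<longleftrightarrow> (\<forall>i<card C. openin (nsphere d) {x \<in> topspace (nsphere d). ?incl i x \<in> U})"
    proof -
      have C: "C = \<kappa> ` {..<card C}" using \<kappa> by (simp add: bij_betw_def)
      have "(\<forall>\<sigma>\<in>C. P \<sigma>) \<longleftrightarrow> (\<forall>i<card C. P (\<kappa> i))" for P by (subst C) auto
      then show ?thesis using V_cell by simp
    qed
    also have "\<dots> \<longleftrightarrow> openin ?W U"
      using U unfolding openin_wedge_sum topspace_wedge_sum by auto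
    finally show "openin ?X ?V \<longleftrightarrow> openin ?W U" .
  qed
  have f_cont: "continuous_map ?X ?W f" by (rule quotient_imp_continuous_map[OF f_quot])

  have H1: "continuous_map ?X ?X (\<lambda>a. H (1, a))"
  proof -
    have "continuous_on ?P (\<lambda>a. H (1, a))"
      by (rule continuous_on_compose2[OF H(1)]) (auto intro!: continuous_on_Pair continuous_on_const continuous_on_id)
    then show ?thesis using H(2) by auto
  qed
  have H1_f: "H (1, a) = H (1, b)" if "a \<in> topspace ?X" "b \<in> topspace ?X" "f a = f b" for a b
    using f_eq[of a b] that HA[of _ 1] h01(2) by auto
  obtain g where g0: "continuous_map ?W ?X g" "\<forall>a\<in>topspace ?X. g (f a) = H (1, a)"
    using quotient_map_factor[OF f_quot H1 H1_f] by blast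
  have g: "continuous_map ?W ?X g" "\<And>a. a \<in> ?P \<Longrightarrow> g (f a) = H (1, a)"
    using g0 by simp_all
  have Hc: "continuous_map (prod_topology (top_of_set ?I) ?X) ?X H"
    using H by auto
  have gf: "homotopic_with (\<lambda>_. True) ?X ?X (g \<circ> f) id"
  proof -
    have "homotopic_with (\<lambda>_. True) ?X ?X id (g \<circ> f)"
      by (subst homotopic_with, simp, intro exI[of _ H] conjI ballI Hc) (auto simp: H0 g(2))
    then show ?thesis by (rule homotopic_with_symD)
  qed
  have fg: "homotopic_with (\<lambda>_. True) ?W ?W (f \<circ> g) id"
  proof -
    have q2: "quotient_map (prod_topology (top_of_set ?I) ?X) (prod_topology (top_of_set ?I) ?W) (\<lambda>(t, a). (t, f a))"
    proof (rule quotient_map_prod_right[OF _ _ f_quot])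
      show "locally_compact_space (top_of_set ?I)"
        by (intro compact_imp_locally_compact_space) (simp add: compact_space_subtopology)
      show "Hausdorff_space (top_of_set ?I) \<or> regular_space (top_of_set ?I)"
        using Hausdorff_space_subtopology[OF Hausdorff_space_euclidean] by blast
    qed
    have fH: "continuous_map (prod_topology (top_of_set ?I) ?X) ?W (f \<circ> H)"
      by (rule continuous_map_compose[OF Hc f_cont])
    have fH_f: "(f \<circ> H) x = (f \<circ> H) y"
      if xy: "x \<in> topspace (prod_topology (top_of_set ?I) ?X)" "y \<in> topspace (prod_topology (top_of_set ?I) ?X)"
        "(\<lambda>(t, a). (t, f a)) x = (\<lambda>(t, a). (t, f a)) y" for x y
    proof -
      obtain t a b where ab: "x = (t, a)" "y = (t, b)" "t \<in> ?I" "a \<in> ?P" "b \<in> ?P" "f a = f b"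
        using xy by auto
      have "h (t, c) \<in> ?A" if "c \<in> ?A" for c using h(2) ab(3) that by blast
      then show ?thesis using f_eq[OF ab(4-6)] ab HA f_A by auto
    qed
    obtain G where G: "continuous_map (prod_topology (top_of_set ?I) ?W) ?W G"
      "\<forall>x\<in>topspace (prod_topology (top_of_set ?I) ?X). G ((\<lambda>(t, a). (t, f a)) x) = (f \<circ> H) x"
      using quotient_map_factor[OF q2 fH fH_f] by blast
    have Gf: "G (t, f a) = f (H (t, a))" if "t \<in> ?I" "a \<in> ?P" for t a
      using bspec[OF G(2), of "(t, a)"] that by simp
    have W: "\<exists>a\<in>?P. w = f a" if "w \<in> topspace ?W" for w
      using f_quot that unfolding quotient_map_def by auto
    have "homotopic_with (\<lambda>_. True) ?W ?W id (f \<circ> g)"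
    proof (subst homotopic_with, simp, intro exI[of _ G] conjI ballI G(1))
      fix w assume "w \<in> topspace ?W"
      then obtain a where a: "a \<in> ?P" "w = f a" using W by blast
      show "G (0, w) = id w" using Gf[of 0 a] a H0 by simp
      show "G (1, w) = (f \<circ> g) w" using Gf[of 1 a] a g(2) by simp
    qed simp_all
    then show ?thesis by (rule homotopic_with_symD)
  qed
  show ?thesis
    unfolding X homotopy_equivalent_space_def using f_cont g(1) gf fg by blast
qed

section \<open>Stars and tetrahedra in the half cube\<close>

definition flip :: "nat \<Rightarrow> nat set \<Rightarrow> nat set" where
  "flip i x = sym_diff x {i}"

definition neighbours :: "nat \<Rightarrow> nat set \<Rightarrow> nat set set" where
  "neighbours k y = (\<lambda>i. flip i y) ` {..<k}"

definition stars :: "nat \<Rightarrow> nat set set set" where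
  "stars k = {\<sigma>. \<sigma> \<noteq> {} \<and> (\<exists>y\<subseteq>{..<k}. odd (card y) \<and> \<sigma> \<subseteq> neighbours k y)}"

text \<open>
  The even vertices of a face of the cube, which is given by the set \<open>D\<close> of its directions and the set
  \<open>B\<close> of the remaining coordinates that are 1.
\<close>

definition tetra :: "nat set \<Rightarrow> nat set \<Rightarrow> nat set set" where
  "tetra B D = {x. x - D = B \<and> even (card x)}"

definition cubes :: "nat \<Rightarrow> (nat set \<times> nat set) set" where
  "cubes k = {(B, D). D \<subseteq> {..<k} \<and> card D = 3 \<and> B \<subseteq> {..<k} - D}"

text \<open>
  The faces that the collapse of the cube to the vertex \<open>{}\<close> uses up: no coordinate beyond the largest
  direction is 1.
\<close>

definition low_cubes :: "nat \<Rightarrow> (nat set \<times> nat set) set" where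
  "low_cubes k = {(B, D) \<in> cubes k. B \<subseteq> {..<Max D}}"

definition stars_and_tetras :: "nat \<Rightarrow> (nat set \<times> nat set) set \<Rightarrow> nat set set set" where
  "stars_and_tetras k Q = stars k \<union> (\<lambda>(B, D). tetra B D) ` Q"

lemma mem_flip [simp]: "j \<in> flip i x \<longleftrightarrow> (j \<in> x \<longleftrightarrow> j \<noteq> i)"
  by (auto simp: flip_def)

lemma flip_flip [simp]: "flip i (flip i x) = x"
  by (rule set_eqI) auto

lemma flip_commute: "flip i (flip j x) = flip j (flip i x)"
  by (rule set_eqI) auto

lemma flip_subset_iff: "flip i x \<subseteq> {..<k} \<longleftrightarrow> x \<subseteq> {..<k}" if "i < k"
  using that by (auto simp: flip_def)

lemma finite_flip [simp]: "finite (flip i x) \<longleftrightarrow> finite x"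
  by (auto simp: flip_def)

lemma even_card_flip [simp]:
  assumes "finite x"
  shows "even (card (flip i x)) \<longleftrightarrow> odd (card x)"
proof (cases "i \<in> x")
  case True
  then have "flip i x = x - {i}" by (auto simp: flip_def)
  moreover have "card x = Suc (card (x - {i}))" using card.remove[OF assms True] .
  ultimately show ?thesis by simp
next
  case False
  then have "flip i x = insert i x" by (auto simp: flip_def)
  then show ?thesis using assms False by simp
qed

lemma card_sym_diff:
  assumes "finite x" "finite y"
  shows "card x + card y = card (sym_diff x y) + 2 * card (x \<inter> y)"
proof -
  have "card x = card (x - y) + card (x \<inter> y)" "card y = card (y - x) + card (x \<inter> y)"
    using card_Int_Diff[OF assms(1), of y] card_Int_Diff[OF assms(2), of x] by (simp_all add: Int_commute)
  moreover have "card (sym_diff x y) = card (x - y) + card (y - x)"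
    using assms by (intro card_Un_disjoint) auto
  ultimately show ?thesis by simp
qed

lemma even_card_sym_diff:
  assumes "finite x" "finite y"
  shows "even (card (sym_diff x y)) \<longleftrightarrow> (even (card x) \<longleftrightarrow> even (card y))"
  using card_sym_diff[OF assms] by presburger

text \<open>
  Two even sets differ in an even number of elements.
\<close>

lemma two_flips:
  assumes "finite x" "finite z" "even (card x)" "even (card z)" "card (sym_diff x z) \<le> 2" "x \<noteq> z"
  obtains i j where "i \<noteq> j" "sym_diff x z = {i, j}" "x = flip i (flip j z)"
proof -
  have "sym_diff x z \<noteq> {}" using assms(6) by blast
  then have "card (sym_diff x z) \<noteq> 0" using assms(1,2) by simp
  moreover have "even (card (sym_diff x z))"
    unfolding even_card_sym_diff[OF assms(1,2)] using assms(3,4) by blast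
  ultimately have "card (sym_diff x z) = 2" using assms(5) by presburger
  then obtain i j where ij: "i \<noteq> j" "sym_diff x z = {i, j}" by (auto simp: card_2_iff)
  have "x = flip i (flip j z)"
  proof (rule set_eqI)
    fix u
    have "u \<in> sym_diff x z \<longleftrightarrow> u = i \<or> u = j" unfolding ij(2) by simp
    then show "u \<in> x \<longleftrightarrow> u \<in> flip i (flip j z)" using ij(1) by auto
  qed
  then show thesis using that ij by blast
qed

lemma card_3_elements:
  assumes "card D = 3"
  obtains a b c where "D = {a, b, c}" "a \<noteq> b" "a \<noteq> c" "b \<noteq> c"
  using assms by (auto simp: card_3_iff)

lemma tetra_eq_flips:
  assumes D: "D = {a, b, c}" "a \<noteq> b" "a \<noteq> c" "b \<noteq> c"
    and B: "finite B" "B \<inter> D = {}" and z: "z \<in> tetra B D"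
  shows "tetra B D = {z, flip a (flip b z), flip a (flip c z), flip b (flip c z)}"
proof
  have zD: "z - D = B" "even (card z)" using z by (auto simp: tetra_def)
  have fin: "finite x" if "x - D = B" for x
  proof -
    have "x \<subseteq> B \<union> D" using that by blast
    then show ?thesis using B(1) D(1) finite_subset by blast
  qed
  show "{z, flip a (flip b z), flip a (flip c z), flip b (flip c z)} \<subseteq> tetra B D"
    using zD fin[OF zD(1)] D(1) by (auto simp: tetra_def)
  show "tetra B D \<subseteq> {z, flip a (flip b z), flip a (flip c z), flip b (flip c z)}"
  proof
    fix x assume "x \<in> tetra B D"
    then have x: "x - D = B" "even (card x)" by (auto simp: tetra_def)
    have sub: "sym_diff x z \<subseteq> D" using x(1) zD(1) by blast
    have ev: "even (card (sym_diff x z))"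
      unfolding even_card_sym_diff[OF fin[OF x(1)] fin[OF zD(1)]] using x zD by blast
    have "card (sym_diff x z) \<le> card D" using sub D(1) by (intro card_mono) auto
    moreover have "card D = 3" using D by simp
    ultimately have "card (sym_diff x z) \<le> 2" using ev by presburger
    show "x \<in> {z, flip a (flip b z), flip a (flip c z), flip b (flip c z)}"
    proof (cases "x = z")
      case False
      obtain i j where ij: "i \<noteq> j" "sym_diff x z = {i, j}" "x = flip i (flip j z)"
        using two_flips[OF fin[OF x(1)] fin[OF zD(1)] x(2) zD(2) \<open>card (sym_diff x z) \<le> 2\<close> False] .
      then have "i \<in> {a, b, c}" "j \<in> {a, b, c}" using sub D(1) by auto
      then show ?thesis using ij(1,3) flip_commute by auto
    qed simp
  qed
qed

lemma cubesD:
  assumes "(B, D) \<in> cubes k"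
  shows "D \<subseteq> {..<k}" "card D = 3" "B \<subseteq> {..<k}" "B \<inter> D = {}" "finite B" "finite D"
  using assms finite_subset[of _ "{..<k}"] by (auto simp: cubes_def)

lemma tetra_vertex:
  assumes "(B, D) \<in> cubes k" "x \<in> tetra B D"
  shows "x \<subseteq> {..<k}" "even (card x)"
  using assms cubesD[OF assms(1)] by (auto simp: tetra_def)

lemma tetra_nonempty:
  assumes "(B, D) \<in> cubes k"
  shows "tetra B D \<noteq> {}"
proof -
  note c = cubesD[OF assms]
  obtain a where a: "a \<in> D" using c(2) by fastforce
  have "B \<in> tetra B D \<or> flip a B \<in> tetra B D"
    using a c(4,5) by (auto simp: tetra_def)
  then show ?thesis by blast
qed

lemma star_vertex:
  assumes "y \<subseteq> {..<k}" "odd (card y)" "x \<in> neighbours k y"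
  shows "x \<subseteq> {..<k}" "even (card x)"
  using assms finite_subset[OF assms(1)] by (auto simp: neighbours_def flip_subset_iff)

text \<open>
  If \<open>w\<close> is missing, the common odd neighbour of the other vertices is the vertex of the face opposite
  to \<open>w\<close>.
\<close>

lemma proper_face_of_tetra:
  assumes cube: "(B, D) \<in> cubes k" and \<tau>: "\<tau> \<subseteq> tetra B D" "\<tau> \<noteq> tetra B D" "\<tau> \<noteq> {}"
  shows "\<tau> \<in> stars k"
proof -
  note c = cubesD[OF cube]
  obtain a b c where D: "D = {a, b, c}" "a \<noteq> b" "a \<noteq> c" "b \<noteq> c" using card_3_elements[OF c(2)] .
  obtain w where w: "w \<in> tetra B D" "w \<notin> \<tau>" using \<tau> by blast
  have wk: "w \<subseteq> {..<k}" "even (card w)" by (rule tetra_vertex[OF cube w(1)])+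
  have fw: "finite w" using finite_subset[OF wk(1)] by simp
  define y where "y = flip a (flip b (flip c w))"
  have lt: "a < k" "b < k" "c < k" using D(1) c(1) by auto
  have y: "y \<subseteq> {..<k}" "odd (card y)"
    using wk fw lt by (auto simp: y_def flip_subset_iff)
  have "flip c y = flip a (flip b w)" "flip b y = flip a (flip c w)" "flip a y = flip b (flip c w)"
    unfolding y_def by (rule set_eqI; auto)+
  then have "\<tau> \<subseteq> {flip c y, flip b y, flip a y}"
    using \<tau>(1) w tetra_eq_flips[OF D c(5,4) w(1)] by auto
  also have "\<dots> \<subseteq> neighbours k y" using lt by (auto simp: neighbours_def)
  finally show ?thesis using y \<tau>(3) by (auto simp: stars_def)
qed

lemma stars_and_tetras_cases:
  assumes "\<sigma> \<in> stars_and_tetras k Q"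
  obtains (star) y where "y \<subseteq> {..<k}" "odd (card y)" "\<sigma> \<subseteq> neighbours k y" "\<sigma> \<noteq> {}"
    | (tetra) B D where "(B, D) \<in> Q" "\<sigma> = tetra B D"
proof (cases "\<sigma> \<in> stars k")
  case True
  then show ?thesis using star unfolding stars_def by blast
next
  case False
  then show ?thesis using assms tetra unfolding stars_and_tetras_def by auto
qed

lemma stars_and_tetras_vertex:
  assumes "\<sigma> \<in> stars_and_tetras k Q" "Q \<subseteq> cubes k" "x \<in> \<sigma>"
  shows "x \<subseteq> {..<k}" "even (card x)" "finite x"
proof -
  have x: "x \<subseteq> {..<k} \<and> even (card x)"
    using assms(1)
  proof (cases rule: stars_and_tetras_cases)
    case (star y)
    have "x \<in> neighbours k y" using star(3) assms(3) by blast
    then show ?thesis using star_vertex[OF star(1,2)] by blast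
  next
    case (tetra B D)
    have "(B, D) \<in> cubes k" "x \<in> tetra B D" using tetra assms(2,3) by blast+
    then show ?thesis using tetra_vertex by blast
  qed
  then show "x \<subseteq> {..<k}" "even (card x)" by blast+
  show "finite x" using x finite_subset[of x "{..<k}"] by simp
qed

lemma stars_and_tetras_dist:
  assumes "\<sigma> \<in> stars_and_tetras k Q" "Q \<subseteq> cubes k" "x \<in> \<sigma>" "z \<in> \<sigma>"
  shows "card (sym_diff x z) \<le> 2"
proof -
  from assms(1) show ?thesis
  proof (cases rule: stars_and_tetras_cases)
    case (star y)
    then have "x \<in> neighbours k y" "z \<in> neighbours k y" using assms(3,4) by blast+
    then obtain i j where "x = flip i y" "z = flip j y" by (auto simp: neighbours_def)
    then have "sym_diff x z \<subseteq> {i, j}" by auto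
    then have "card (sym_diff x z) \<le> card {i, j}" by (intro card_mono) auto
    also have "\<dots> \<le> 2" by (simp add: card_insert_if)
    finally show ?thesis .
  next
    case (tetra B D)
    then have "(B, D) \<in> cubes k" using assms(2) by blast
    note c = cubesD[OF this]
    have xz: "x - D = B" "z - D = B" using assms(3,4) tetra(2) by (auto simp: tetra_def)
    have "card (sym_diff x z) \<le> card D"
      using xz c(6) by (intro card_mono) auto
    moreover have "even (card (sym_diff x z))"
      unfolding even_card_sym_diff[OF stars_and_tetras_vertex(3)[OF assms(1-3)] stars_and_tetras_vertex(3)[OF assms(1,2,4)]]
      using stars_and_tetras_vertex(2)[OF assms(1-3)] stars_and_tetras_vertex(2)[OF assms(1,2,4)] by blast
    ultimately show ?thesis using c(2) by presburger
  qed
qed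

lemma finite_complex_stars_and_tetras:
  assumes Q: "Q \<subseteq> cubes k"
  shows "finite_complex (stars_and_tetras k Q)"
proof (rule finite_complexI)
  have sub: "\<sigma> \<subseteq> Pow {..<k}" if "\<sigma> \<in> stars_and_tetras k Q" for \<sigma>
    using stars_and_tetras_vertex(1)[OF that Q] by blast
  then have "stars_and_tetras k Q \<subseteq> Pow (Pow {..<k})" by blast
  then show "finite (stars_and_tetras k Q)" by (rule finite_subset) simp
  fix \<sigma> assume \<sigma>: "\<sigma> \<in> stars_and_tetras k Q"
  show "finite \<sigma>" using sub[OF \<sigma>] by (rule finite_subset) simp
  show "\<sigma> \<noteq> {}"
    using \<sigma>
  proof (cases rule: stars_and_tetras_cases)
    case (tetra B D)
    then show ?thesis using tetra_nonempty[of B D k] Q by blast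
  qed
  fix \<tau> assume \<tau>: "\<tau> \<subseteq> \<sigma>" "\<tau> \<noteq> {}"
  show "\<tau> \<in> stars_and_tetras k Q"
  proof (cases "\<sigma> \<in> stars k")
    case True
    then have "\<tau> \<in> stars k" using \<tau> unfolding stars_def by blast
    then show ?thesis by (simp add: stars_and_tetras_def)
  next
    case False
    then obtain B D where BD: "(B, D) \<in> Q" "\<sigma> = tetra B D" using \<sigma> by (auto simp: stars_and_tetras_def)
    show ?thesis
    proof (cases "\<tau> = \<sigma>")
      case False
      then have "\<tau> \<in> stars k" using proper_face_of_tetra[of B D k \<tau>] BD \<tau> Q by blast
      then show ?thesis by (simp add: stars_and_tetras_def)
    qed (use \<sigma> in simp)
  qed
qed

text \<open>
  Two different sets with a common neighbour differ in two elements, and only the flips of these two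
  lead to common neighbours. Hence three vertices of a star determine its centre.
\<close>

lemma card_neighbours_Int:
  assumes "y \<noteq> y'" "finite y" "finite y'"
  shows "card (neighbours k y \<inter> neighbours k y') \<le> 2"
proof (cases "neighbours k y \<inter> neighbours k y' = {}")
  case False
  then obtain i i' where i: "flip i y = flip i' y'" by (auto simp: neighbours_def)
  have sub: "j \<in> {i, i'}" if "flip j y = flip j' y'" for j j'
  proof (rule ccontr)
    assume j: "j \<notin> {i, i'}"
    have "j \<in> flip i y \<longleftrightarrow> j \<in> flip i' y'" "j \<in> flip j y \<longleftrightarrow> j \<in> flip j' y'"
      unfolding i that by (rule refl)+
    then have "j' = j" using j by auto
    have "y = flip j (flip j' y')" unfolding that[symmetric] by simp
    then have "y = y'" unfolding \<open>j' = j\<close> by simp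
    then show False using assms(1) by simp
  qed
  have "neighbours k y \<inter> neighbours k y' \<subseteq> (\<lambda>j. flip j y) ` {i, i'}"
    using sub by (auto simp: neighbours_def)
  then have "card (neighbours k y \<inter> neighbours k y') \<le> card ((\<lambda>j. flip j y) ` {i, i'})"
    by (intro card_mono) auto
  also have "\<dots> \<le> card {i, i'}" by (rule card_image_le) simp
  also have "\<dots> \<le> 2" by (simp add: card_insert_if)
  finally show ?thesis .
qed simp

text \<open>
  A simplex with at least \<open>m\<close> marked vertices contains a face that consists of \<open>m\<close> of them, so it
  suffices to delete the stars of such faces. The apexes are unmarked and hence lie in none of these
  faces.
\<close>

lemma delete_marked_faces:
  assumes K: "finite_complex K" and m: "0 < m"
    and cone: "\<And>\<sigma>. \<lbrakk>\<sigma> \<in> K; card \<sigma> = m; \<forall>x\<in>\<sigma>. P x\<rbrakk> \<Longrightarrow>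
      \<exists>v. \<not> P v \<and> (\<forall>\<tau>\<in>K. \<sigma> \<subseteq> \<tau> \<longrightarrow> insert v \<tau> \<in> K)"
  shows "finite_complex {\<tau> \<in> K. card {x \<in> \<tau>. P x} < m}"
    and "geometric_realization K homotopy_equivalent_space
      geometric_realization {\<tau> \<in> K. card {x \<in> \<tau>. P x} < m}"
proof -
  define S where "S = {\<sigma> \<in> K. card \<sigma> = m \<and> (\<forall>x\<in>\<sigma>. P x)}"
  have eq: "{\<tau> \<in> K. \<forall>\<sigma>\<in>S. \<not> \<sigma> \<subseteq> \<tau>} = {\<tau> \<in> K. card {x \<in> \<tau>. P x} < m}"
  proof (intro Collect_cong conj_cong refl iffI ballI notI)
    fix \<tau> assume \<tau>: "\<tau> \<in> K" and no: "\<forall>\<sigma>\<in>S. \<not> \<sigma> \<subseteq> \<tau>"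
    show "card {x \<in> \<tau>. P x} < m"
    proof (rule ccontr)
      assume "\<not> ?thesis"
      then have "m \<le> card {x \<in> \<tau>. P x}" by simp
      then obtain \<sigma> where \<sigma>: "\<sigma> \<subseteq> {x \<in> \<tau>. P x}" "card \<sigma> = m" "finite \<sigma>"
        by (rule obtain_subset_with_card_n)
      have s: "\<sigma> \<subseteq> \<tau>" "\<sigma> \<noteq> {}" using \<sigma> m by auto
      have "\<sigma> \<in> K" by (rule finite_complexD(4)[OF K \<tau> s])
      then have "\<sigma> \<in> S" using \<sigma> by (auto simp: S_def)
      then show False using no s by blast
    qed
  next
    fix \<tau> \<sigma> assume \<tau>: "\<tau> \<in> K" "card {x \<in> \<tau>. P x} < m" and \<sigma>: "\<sigma> \<in> S" "\<sigma> \<subseteq> \<tau>"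
    have "card \<sigma> \<le> card {x \<in> \<tau>. P x}"
      using \<sigma> finite_complexD(2)[OF K \<tau>(1)] by (intro card_mono) (auto simp: S_def)
    then show False using \<tau>(2) \<sigma>(1) by (simp add: S_def)
  qed
  have fS: "finite S" using finite_subset[OF _ finite_complexD(1)[OF K], of S] by (auto simp: S_def)
  have "finite \<sigma> \<and> \<sigma> \<noteq> {} \<and> (\<exists>v. v \<notin> \<Union>S \<and> (\<forall>\<tau>\<in>K. \<sigma> \<subseteq> \<tau> \<longrightarrow> insert v \<tau> \<in> K))" if "\<sigma> \<in> S" for \<sigma>
  proof -
    have \<sigma>: "\<sigma> \<in> K" "card \<sigma> = m" "\<forall>x\<in>\<sigma>. P x" using that by (auto simp: S_def)
    obtain v where "\<not> P v" "\<forall>\<tau>\<in>K. \<sigma> \<subseteq> \<tau> \<longrightarrow> insert v \<tau> \<in> K" using cone[OF \<sigma>] by blast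
    moreover from this have "v \<notin> \<Union>S" by (auto simp: S_def)
    ultimately show ?thesis using finite_complexD(2,3)[OF K \<sigma>(1)] by blast
  qed
  from homotopy_equivalent_delete_stars[OF K fS this]
  show "finite_complex {\<tau> \<in> K. card {x \<in> \<tau>. P x} < m}"
    and "geometric_realization K homotopy_equivalent_space
      geometric_realization {\<tau> \<in> K. card {x \<in> \<tau>. P x} < m}"
    unfolding eq by blast+
qed

section \<open>Contractibility of the low complex\<close>

abbreviation low_complex :: "nat \<Rightarrow> nat set set set" where
  "low_complex k \<equiv> stars_and_tetras k (low_cubes k)"

lemma low_cubes_subset: "low_cubes k \<subseteq> cubes k"
  by (auto simp: low_cubes_def)

lemma low_cubes_Suc:
  "(B, D) \<in> low_cubes (Suc k) \<longleftrightarrow>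
     (B, D) \<in> low_cubes k \<or> k \<in> D \<and> D \<subseteq> {..k} \<and> card D = 3 \<and> B \<subseteq> {..<k} - D"
proof (cases "k \<in> D")
  case True
  show ?thesis
  proof (cases "D \<subseteq> {..k}")
    case D: True
    then have "Max D = k"
      using True finite_subset[OF D] by (intro Max_eqI) auto
    then show ?thesis
      using True D by (auto simp: low_cubes_def cubes_def)
  qed (auto simp: low_cubes_def cubes_def lessThan_Suc_atMost)
next
  case False
  show ?thesis
  proof
    assume "(B, D) \<in> low_cubes (Suc k)"
    then have BD: "D \<subseteq> {..<Suc k}" "card D = 3" "B \<inter> D = {}" "B \<subseteq> {..<Max D}"
      by (auto simp: low_cubes_def cubes_def)
    have D: "D \<subseteq> {..<k}" using BD(1) False by (auto simp: less_Suc_eq)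
    have fin: "finite D" "D \<noteq> {}" using BD(2) card.infinite by fastforce+
    have "Max D < k" using D Max_in[OF fin] by blast
    then have "B \<subseteq> {..<k}" using BD(4) by auto
    then show "(B, D) \<in> low_cubes k \<or> k \<in> D \<and> D \<subseteq> {..k} \<and> card D = 3 \<and> B \<subseteq> {..<k} - D"
      using BD D by (auto simp: low_cubes_def cubes_def)
  next
    assume "(B, D) \<in> low_cubes k \<or> k \<in> D \<and> D \<subseteq> {..k} \<and> card D = 3 \<and> B \<subseteq> {..<k} - D"
    then show "(B, D) \<in> low_cubes (Suc k)"
      using False by (auto simp: low_cubes_def cubes_def less_Suc_eq)
  qed
qed

text \<open>
  A tetrahedron of a low face has at most two vertices that contain \<open>k\<close>: either \<open>k\<close> is one of its
  directions, or \<open>k\<close> lies beyond its largest direction. Hence three such vertices only occur in the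
  star of an odd set that contains \<open>k\<close>.
\<close>

lemma low_complex_top_triple:
  assumes \<tau>: "\<tau> \<in> low_complex (Suc k)" and \<sigma>: "\<sigma> \<subseteq> \<tau>" "card \<sigma> = 3" "\<forall>x\<in>\<sigma>. k \<in> x"
  obtains y where "y \<subseteq> {..<Suc k}" "odd (card y)" "k \<in> y" "\<tau> \<subseteq> neighbours (Suc k) y"
  using \<tau>
proof (cases rule: stars_and_tetras_cases)
  case (star y)
  have "k \<in> y"
  proof (rule ccontr)
    assume "k \<notin> y"
    then have "\<sigma> \<subseteq> {flip k y}"
      using \<sigma>(1,3) star(3) by (fastforce simp: neighbours_def)
    then have "card \<sigma> \<le> card {flip k y}" by (intro card_mono) auto
    then show False using \<sigma>(2) by simp
  qed
  then show thesis using that star by blast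
next
  case (tetra B D)
  have cube: "(B, D) \<in> cubes (Suc k)" using tetra(1) low_cubes_subset by blast
  note c = cubesD[OF cube]
  have \<sigma>_ne: "\<sigma> \<noteq> {}" using \<sigma>(2) by auto
  then obtain w where w: "w \<in> \<sigma>" by blast
  have wk: "k \<in> w" "w \<in> tetra B D" using w \<sigma>(1,3) tetra(2) by blast+
  have BD: "k \<in> D"
  proof (rule ccontr)
    assume "k \<notin> D"
    then have "(B, D) \<in> low_cubes k" using tetra(1) low_cubes_Suc by blast
    then have "k \<notin> B" by (auto simp: low_cubes_def cubes_def)
    then show False using wk \<open>k \<notin> D\<close> by (auto simp: tetra_def)
  qed
  have "card (D - {k}) = 2" using c(2,6) BD by simp
  then obtain a b where ab: "D - {k} = {a, b}" "a \<noteq> b" by (auto simp: card_2_iff)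
  have D: "D = {k, a, b}" "k \<noteq> a" "k \<noteq> b" "a \<noteq> b" using ab BD by auto
  have "\<sigma> \<subseteq> {w, flip a (flip b w)}"
  proof
    fix x assume x: "x \<in> \<sigma>"
    then have "x \<in> {w, flip k (flip a w), flip k (flip b w), flip a (flip b w)}"
      using \<sigma>(1) tetra(2) tetra_eq_flips[OF D c(5,4) wk(2)] by blast
    moreover have "k \<in> x" using x \<sigma>(3) by blast
    ultimately show "x \<in> {w, flip a (flip b w)}" using wk(1) D(2,3) by auto
  qed
  then have "card \<sigma> \<le> card {w, flip a (flip b w)}" by (intro card_mono) auto
  also have "\<dots> \<le> 2" by (simp add: card_insert_if)
  finally show thesis using \<sigma>(2) by simp
qed

lemma in_star: "\<lbrakk>y \<subseteq> {..<k}; odd (card y); \<tau> \<subseteq> neighbours k y; \<tau> \<noteq> {}\<rbrakk> \<Longrightarrow> \<tau> \<in> stars_and_tetras k Q"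
  by (auto simp: stars_and_tetras_def stars_def)

text \<open>
  The three vertices determine the centre \<open>y\<close> of their star, and the apex is the one neighbour of \<open>y\<close>
  without \<open>k\<close>.
\<close>

lemma low_complex_cone_over_triple:
  assumes \<sigma>: "\<sigma> \<in> low_complex (Suc k)" "card \<sigma> = 3" "\<forall>x\<in>\<sigma>. k \<in> x"
  shows "\<exists>v. k \<notin> v \<and> (\<forall>\<tau>\<in>low_complex (Suc k). \<sigma> \<subseteq> \<tau> \<longrightarrow> insert v \<tau> \<in> low_complex (Suc k))"
proof -
  obtain y where y: "y \<subseteq> {..<Suc k}" "odd (card y)" "k \<in> y" "\<sigma> \<subseteq> neighbours (Suc k) y"
    using low_complex_top_triple[OF \<sigma>(1) subset_refl \<sigma>(2,3)] .
  have "insert (flip k y) \<tau> \<in> low_complex (Suc k)" if \<tau>: "\<tau> \<in> low_complex (Suc k)" "\<sigma> \<subseteq> \<tau>" for \<tau>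
  proof -
    obtain y' where y': "y' \<subseteq> {..<Suc k}" "odd (card y')" "k \<in> y'" "\<tau> \<subseteq> neighbours (Suc k) y'"
      using low_complex_top_triple[OF \<tau> \<sigma>(2,3)] .
    have "y' = y"
    proof (rule ccontr)
      assume "y' \<noteq> y"
      then have "card (neighbours (Suc k) y \<inter> neighbours (Suc k) y') \<le> 2"
        using card_neighbours_Int[of y y'] finite_subset[OF y(1)] finite_subset[OF y'(1)] by simp
      moreover have "card \<sigma> \<le> card (neighbours (Suc k) y \<inter> neighbours (Suc k) y')"
        using y(4) y'(4) \<tau>(2) by (intro card_mono) (auto simp: neighbours_def)
      ultimately show False using \<sigma>(2) by simp
    qed
    then have "insert (flip k y) \<tau> \<subseteq> neighbours (Suc k) y"
      using y'(4) by (auto simp: neighbours_def)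
    then show ?thesis by (rule in_star[OF y(1,2)]) simp
  qed
  moreover have "k \<notin> flip k y" using y(3) by simp
  ultimately show ?thesis by blast
qed

lemma marked_insert: "\<not> P v \<Longrightarrow> {x \<in> insert v \<tau>. P x} = {x \<in> \<tau>. P x}"
  by auto

text \<open>
  For vertices \<open>z\<close>, \<open>z'\<close> that contain \<open>k\<close> and differ in \<open>i\<close> and \<open>j\<close>, there are just two vertices without
  \<open>k\<close> at distance 2 from both. Together these four vertices are the tetrahedron of a low face with
  directions \<open>i\<close>, \<open>j\<close>, \<open>k\<close>. Once no simplex has a third vertex with \<open>k\<close>, every simplex on \<open>z\<close>, \<open>z'\<close> is a face of this
  tetrahedron, so either of the two vertices without \<open>k\<close> can be the apex.
\<close>

lemma low_complex_cone_over_pair: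
  fixes k :: nat
  defines "K \<equiv> {\<tau> \<in> low_complex (Suc k). card {x \<in> \<tau>. k \<in> x} < 3}"
  assumes \<sigma>: "\<sigma> \<in> K" "card \<sigma> = 2" "\<forall>x\<in>\<sigma>. k \<in> x"
  shows "\<exists>v. k \<notin> v \<and> (\<forall>\<tau>\<in>K. \<sigma> \<subseteq> \<tau> \<longrightarrow> insert v \<tau> \<in> K)"
proof -
  note lc = low_cubes_subset[of "Suc k"]
  have fc: "finite_complex (low_complex (Suc k))" by (rule finite_complex_stars_and_tetras[OF lc])
  have \<sigma>L: "\<sigma> \<in> low_complex (Suc k)" using \<sigma>(1) by (simp add: K_def)
  obtain z z' where z: "\<sigma> = {z, z'}" "z \<noteq> z'" using \<sigma>(2) by (auto simp: card_2_iff)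
  have zv: "z \<subseteq> {..<Suc k}" "even (card z)" "finite z" "z' \<subseteq> {..<Suc k}" "even (card z')" "finite z'"
    using stars_and_tetras_vertex[OF \<sigma>L lc, of z] stars_and_tetras_vertex[OF \<sigma>L lc, of z'] z(1) by auto
  have kz: "k \<in> z" "k \<in> z'" using \<sigma>(3) z(1) by auto
  have "card (sym_diff z' z) \<le> 2" using stars_and_tetras_dist[OF \<sigma>L lc] z(1) by blast
  then obtain i j where ij: "i \<noteq> j" "sym_diff z' z = {i, j}" "z' = flip i (flip j z)"
    using two_flips[OF zv(6,3,5,2)] z(2) by metis
  have lt: "i < k" "j < k"
  proof -
    have "i \<in> sym_diff z' z" "j \<in> sym_diff z' z" unfolding ij(2) by simp_all
    then show "i < k" "j < k" using zv(1,4) kz by (auto simp: less_Suc_eq)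
  qed
  define D where "D = {i, j, k}"
  define B where "B = z - D"
  have D: "D = {i, j, k}" "i \<noteq> j" "i \<noteq> k" "j \<noteq> k" using ij(1) lt by (auto simp: D_def)
  have low: "(B, D) \<in> low_cubes (Suc k)"
  proof -
    have "D \<subseteq> {..k}" "k \<in> D" using lt by (auto simp: D_def)
    moreover have "card D = 3" using D by simp
    moreover have "B \<subseteq> {..<k} - D"
    proof
      fix u assume "u \<in> B"
      then have "u < Suc k" "u \<notin> D" using zv(1) by (auto simp: B_def)
      moreover from this have "u \<noteq> k" by (auto simp: D_def)
      ultimately show "u \<in> {..<k} - D" by simp
    qed
    ultimately show ?thesis unfolding low_cubes_Suc by blast
  qed
  have zT: "z \<in> tetra B D" using zv(2) by (simp add: tetra_def B_def)
  have T: "tetra B D = {z, z', flip i (flip k z), flip j (flip k z)}"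
    using tetra_eq_flips[OF D _ _ zT] zv(3) unfolding ij(3)[symmetric] by (auto simp: B_def)
  define v where "v = flip i (flip k z)"
  have kv: "k \<notin> v" using kz lt by (auto simp: v_def)
  have "insert v \<tau> \<in> K" if \<tau>: "\<tau> \<in> K" "\<sigma> \<subseteq> \<tau>" for \<tau>
  proof -
    have \<tau>L: "\<tau> \<in> low_complex (Suc k)" and c3: "card {x \<in> \<tau>. k \<in> x} < 3" using \<tau>(1) by (simp_all add: K_def)
    have z\<tau>: "z \<in> \<tau>" "z' \<in> \<tau>" using \<tau>(2) z(1) by auto
    have fin: "finite \<tau>" by (rule finite_complexD(2)[OF fc \<tau>L])
    have "w \<in> tetra B D" if w: "w \<in> \<tau>" for w
    proof (cases "k \<in> w")
      case True
      have "w \<in> {z, z'}"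
      proof (rule ccontr)
        assume "w \<notin> {z, z'}"
        then have "card {w, z, z'} = 3" using z(2) by simp
        moreover have "card {w, z, z'} \<le> card {x \<in> \<tau>. k \<in> x}"
          using fin True kz w z\<tau> by (intro card_mono) auto
        ultimately show False using c3 by simp
      qed
      then show ?thesis unfolding T by blast
    next
      case False
      have wv: "even (card w)" "finite w"
        using stars_and_tetras_vertex[OF \<tau>L lc w] by auto
      have w_flip: "\<exists>p. p \<noteq> k \<and> w = flip p (flip k x)"
        if x: "x \<in> \<tau>" "k \<in> x" for x
      proof -
        have "card (sym_diff w x) \<le> 2" by (rule stars_and_tetras_dist[OF \<tau>L lc w x(1)])
        moreover have "even (card x)" "finite x" using stars_and_tetras_vertex[OF \<tau>L lc x(1)] by auto
        moreover have "w \<noteq> x" using False x(2) by blast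
        ultimately obtain p q where pq: "p \<noteq> q" "sym_diff w x = {p, q}" "w = flip p (flip q x)"
          using two_flips[OF wv(2) _ wv(1)] by metis
        have "k \<in> sym_diff w x" using False x(2) by blast
        then have "k = p \<or> k = q" unfolding pq(2) by simp
        then show ?thesis using pq(1,3) flip_commute by metis
      qed
      obtain p where p: "p \<noteq> k" "w = flip p (flip k z)" using w_flip z\<tau>(1) kz(1) by blast
      obtain q where q: "q \<noteq> k" "w = flip q (flip k z')" using w_flip z\<tau>(2) kz(2) by blast
      have "p \<in> w \<longleftrightarrow> p \<in> flip q (flip k (flip i (flip j z)))" "i \<in> w \<longleftrightarrow> i \<in> flip q (flip k (flip i (flip j z)))"
        "j \<in> w \<longleftrightarrow> j \<in> flip q (flip k (flip i (flip j z)))"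
        using q(2) unfolding ij(3) by simp_all
      then have "p = i \<or> p = j"
        unfolding p(2) using p(1) ij(1) lt by (auto split: if_splits)
      then show ?thesis unfolding T using p(2) by auto
    qed
    then have sub: "insert v \<tau> \<subseteq> tetra B D" unfolding T v_def by blast
    have "tetra B D \<in> low_complex (Suc k)" using low by (auto simp: stars_and_tetras_def)
    then have "insert v \<tau> \<in> low_complex (Suc k)"
      by (rule finite_complexD(4)[OF fc _ sub]) simp
    then show ?thesis using c3 marked_insert[of "\<lambda>x. k \<in> x", OF kv] by (simp add: K_def)
  qed
  then show ?thesis using kv by blast
qed

text \<open>
  When \<open>z\<close> is the only vertex with \<open>k\<close> in a simplex, all others are neighbours of \<open>z - {k}\<close>; so all
  simplices at \<open>z\<close> lie in one star. The apex can be any neighbour of \<open>z - {k}\<close> other than \<open>z\<close>, and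
  there is one because \<open>k\<close> is not 0.
\<close>

lemma low_complex_cone_over_vertex:
  fixes k :: nat
  defines "K \<equiv> {\<tau> \<in> low_complex (Suc k). card {x \<in> \<tau>. k \<in> x} < 2}"
  assumes k: "0 < k" and \<sigma>: "\<sigma> \<in> K" "card \<sigma> = 1" "\<forall>x\<in>\<sigma>. k \<in> x"
  shows "\<exists>v. k \<notin> v \<and> (\<forall>\<tau>\<in>K. \<sigma> \<subseteq> \<tau> \<longrightarrow> insert v \<tau> \<in> K)"
proof -
  note lc = low_cubes_subset[of "Suc k"]
  have fc: "finite_complex (low_complex (Suc k))" by (rule finite_complex_stars_and_tetras[OF lc])
  obtain z where z: "\<sigma> = {z}" "k \<in> z" using \<sigma>(2,3) by (auto simp: card_1_singleton_iff)
  have "\<sigma> \<in> low_complex (Suc k)" using \<sigma>(1) by (simp add: K_def)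
  then have zv: "z \<subseteq> {..<Suc k}" "even (card z)" "finite z"
    using stars_and_tetras_vertex[OF _ lc, of \<sigma> z] z(1) by auto
  define y where "y = flip k z"
  have y: "y \<subseteq> {..<Suc k}" "odd (card y)" "k \<notin> y"
    using zv z(2) by (auto simp: y_def flip_subset_iff)
  define v where "v = flip 0 y"
  have kv: "k \<notin> v" using y(3) k by (simp add: v_def)
  have "insert v \<tau> \<in> K" if \<tau>: "\<tau> \<in> K" "\<sigma> \<subseteq> \<tau>" for \<tau>
  proof -
    have \<tau>L: "\<tau> \<in> low_complex (Suc k)" and c2: "card {x \<in> \<tau>. k \<in> x} < 2" using \<tau>(1) by (simp_all add: K_def)
    have z\<tau>: "z \<in> \<tau>" using \<tau>(2) z(1) by auto
    have fin: "finite \<tau>" by (rule finite_complexD(2)[OF fc \<tau>L])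
    have "w \<in> neighbours (Suc k) y" if w: "w \<in> \<tau>" for w
    proof (cases "k \<in> w")
      case True
      have "w = z"
      proof (rule ccontr)
        assume "w \<noteq> z"
        then have "card {w, z} = 2" by simp
        moreover have "card {w, z} \<le> card {x \<in> \<tau>. k \<in> x}"
          using fin True z(2) w z\<tau> by (intro card_mono) auto
        ultimately show False using c2 by simp
      qed
      then have "w = flip k y" by (simp add: y_def)
      then show ?thesis by (auto simp: neighbours_def)
    next
      case False
      have wv: "w \<subseteq> {..<Suc k}" "even (card w)" "finite w"
        using stars_and_tetras_vertex[OF \<tau>L lc w] by auto
      have "card (sym_diff w z) \<le> 2" by (rule stars_and_tetras_dist[OF \<tau>L lc w z\<tau>])
      moreover have "w \<noteq> z" using False z(2) by blast
      ultimately obtain p q where pq: "p \<noteq> q" "sym_diff w z = {p, q}" "w = flip p (flip q z)"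
        using two_flips[OF wv(3) zv(3) wv(2) zv(2)] by metis
      have "k \<in> sym_diff w z" using False z(2) by blast
      then have "k = p \<or> k = q" unfolding pq(2) by simp
      moreover have "p < Suc k" "q < Suc k"
      proof -
        have "p \<in> sym_diff w z" "q \<in> sym_diff w z" unfolding pq(2) by simp_all
        then show "p < Suc k" "q < Suc k" using wv(1) zv(1) by auto
      qed
      ultimately obtain r where "r < Suc k" "w = flip r (flip k z)"
        using pq(3) flip_commute by metis
      then show ?thesis by (auto simp: neighbours_def y_def)
    qed
    moreover have "v \<in> neighbours (Suc k) y" by (auto simp: v_def neighbours_def)
    ultimately have "insert v \<tau> \<subseteq> neighbours (Suc k) y" by blast
    then have "insert v \<tau> \<in> low_complex (Suc k)" by (rule in_star[OF y(1,2)]) simp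
    then show ?thesis using c2 marked_insert[of "\<lambda>x. k \<in> x", OF kv] by (simp add: K_def)
  qed
  then show ?thesis using kv by blast
qed

text \<open>
  In the star of a set \<open>y\<close> that contains \<open>k\<close>, only the vertex \<open>y - {k}\<close> survives. It also lies in the
  star of the odd set obtained from it by flipping the coordinate 0, and this set is a subset of
  \<open>{..<k}\<close>.
\<close>

lemma low_complex_Suc_bottom:
  assumes k: "0 < k"
  shows "{\<tau> \<in> low_complex (Suc k). card {x \<in> \<tau>. k \<in> x} < 1} = low_complex k"
proof (intro set_eqI iffI)
  note lc = low_cubes_subset
  fix \<tau> assume "\<tau> \<in> {\<tau> \<in> low_complex (Suc k). card {x \<in> \<tau>. k \<in> x} < 1}"
  then have \<tau>: "\<tau> \<in> low_complex (Suc k)" and "card {x \<in> \<tau>. k \<in> x} = 0" by simp_all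
  moreover have "finite \<tau>"
    by (rule finite_complexD(2)[OF finite_complex_stars_and_tetras[OF lc] \<tau>])
  ultimately have none: "\<And>x. x \<in> \<tau> \<Longrightarrow> k \<notin> x" by simp
  from \<tau> show "\<tau> \<in> low_complex k"
  proof (cases rule: stars_and_tetras_cases)
    case (star y)
    show ?thesis
    proof (cases "k \<in> y")
      case True
      have "\<tau> \<subseteq> {flip k y}"
      proof
        fix x assume x: "x \<in> \<tau>"
        then obtain i where "x = flip i y" using star(3) by (auto simp: neighbours_def)
        then show "x \<in> {flip k y}" using none[OF x] True by simp
      qed
      moreover define y' where "y' = flip 0 (flip k y)"
      moreover have "y' \<subseteq> {..<k}" "odd (card y')"
        using star(1,2) True k finite_subset[OF star(1)]
        by (auto simp: y'_def flip_subset_iff less_Suc_eq subset_iff)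
      moreover have "flip k y = flip 0 y'" by (simp add: y'_def)
      then have "flip k y \<in> neighbours k y'" using k by (auto simp: neighbours_def)
      ultimately show ?thesis using in_star[of y' k \<tau>] star(4) by blast
    next
      case False
      have "\<tau> \<subseteq> neighbours k y"
      proof
        fix x assume x: "x \<in> \<tau>"
        then obtain i where i: "i < Suc k" "x = flip i y" using star(3) by (auto simp: neighbours_def)
        then have "i \<noteq> k" using none[OF x] False by auto
        then show "x \<in> neighbours k y" using i by (auto simp: neighbours_def)
      qed
      moreover have "y \<subseteq> {..<k}" using star(1) False by (auto simp: less_Suc_eq)
      ultimately show ?thesis using in_star star(2,4) by blast
    qed
  next
    case (tetra B D)
    have "k \<notin> D"
    proof
      assume kD: "k \<in> D"
      have cube: "(B, D) \<in> cubes (Suc k)" using tetra(1) lc by blast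
      note c = cubesD[OF cube]
      obtain w where w: "w \<in> tetra B D" using tetra_nonempty[OF cube] by blast
      have "card (D - {k}) = 2" using c(2,6) kD by simp
      then obtain a b where ab: "D - {k} = {a, b}" "a \<noteq> b" by (auto simp: card_2_iff)
      have D: "D = {k, a, b}" "k \<noteq> a" "k \<noteq> b" "a \<noteq> b" using ab kD by auto
      have "w \<in> \<tau>" "flip k (flip a w) \<in> \<tau>"
        using tetra_eq_flips[OF D c(5,4) w] tetra(2) by auto
      then show False using none[of w] none[of "flip k (flip a w)"] D(2) by auto
    qed
    then have "(B, D) \<in> low_cubes k" using tetra(1) low_cubes_Suc by blast
    then show ?thesis using tetra(2) by (auto simp: stars_and_tetras_def)
  qed
next
  fix \<tau> assume \<tau>: "\<tau> \<in> low_complex k"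
  have "x \<subseteq> {..<k}" if "x \<in> \<tau>" for x
    using stars_and_tetras_vertex(1)[OF \<tau> low_cubes_subset that] .
  then have none: "{x \<in> \<tau>. k \<in> x} = {}" by auto
  from \<tau> have "\<tau> \<in> low_complex (Suc k)"
  proof (cases rule: stars_and_tetras_cases)
    case (star y)
    then show ?thesis
      by (intro in_star[of y]) (auto simp: neighbours_def)
  next
    case (tetra B D)
    then show ?thesis using low_cubes_Suc by (auto simp: stars_and_tetras_def)
  qed
  then show "\<tau> \<in> {\<tau> \<in> low_complex (Suc k). card {x \<in> \<tau>. k \<in> x} < 1}"
    unfolding mem_Collect_eq none by simp
qed

lemma low_complex_Suc_homotopy_equivalent:
  assumes k: "0 < k"
  shows "geometric_realization (low_complex (Suc k)) homotopy_equivalent_space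
    geometric_realization (low_complex k)"
proof -
  let ?K = "\<lambda>m. {\<tau> \<in> low_complex (Suc k). card {x \<in> \<tau>. k \<in> x} < m}"
  have nest: "{\<tau> \<in> ?K 3. card {x \<in> \<tau>. k \<in> x} < 2} = ?K 2"
    "{\<tau> \<in> ?K 2. card {x \<in> \<tau>. k \<in> x} < 1} = ?K 1"
    by auto
  have pos: "0 < (3::nat)" "0 < (2::nat)" "0 < (1::nat)" by simp_all
  have fin: "finite_complex (low_complex (Suc k))"
    by (rule finite_complex_stars_and_tetras[OF low_cubes_subset])
  note 3 = delete_marked_faces[where P = "\<lambda>x. k \<in> x", OF fin pos(1) low_complex_cone_over_triple]
  note 2 = delete_marked_faces[where P = "\<lambda>x. k \<in> x", OF 3(1) pos(2) low_complex_cone_over_pair,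
      unfolded nest]
  note 1 = delete_marked_faces(2)[where P = "\<lambda>x. k \<in> x", OF 2(1) pos(3)
      low_complex_cone_over_vertex[OF k], unfolded nest]
  show ?thesis
    using homotopy_eqv_trans[OF 3(2) homotopy_eqv_trans[OF 2(2) 1]]
    unfolding low_complex_Suc_bottom[OF k] .
qed

lemma low_complex_1: "low_complex 1 = {{{}}}"
proof -
  have "low_cubes 1 = {}"
  proof -
    have False if "(B, D) \<in> cubes 1" for B D
      using card_mono[OF finite_lessThan cubesD(1)[OF that]] cubesD(2)[OF that] by simp
    then have "cubes 1 = {}" by auto
    then show ?thesis using low_cubes_subset[of 1] by blast
  qed
  moreover have "stars 1 = {{{}}}"
  proof -
    have y: "y = {0}" if "y \<subseteq> {..<1}" "odd (card y)" for y :: "nat set"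
    proof -
      have "y \<subseteq> {0}" using that(1) by auto
      then have "y = {} \<or> y = {0}" by blast
      then show ?thesis using that(2) by auto
    qed
    have n: "neighbours 1 {0} = {{}}"
      by (auto simp: neighbours_def flip_def)
    have "\<sigma> \<in> stars 1 \<longleftrightarrow> \<sigma> \<noteq> {} \<and> \<sigma> \<subseteq> {{}}" for \<sigma>
    proof
      assume "\<sigma> \<in> stars 1"
      then obtain y where "\<sigma> \<noteq> {}" "y \<subseteq> {..<1}" "odd (card y)" "\<sigma> \<subseteq> neighbours 1 y"
        unfolding stars_def by blast
      then show "\<sigma> \<noteq> {} \<and> \<sigma> \<subseteq> {{}}" using y n by simp
    next
      assume "\<sigma> \<noteq> {} \<and> \<sigma> \<subseteq> {{}}"
      then have "\<sigma> \<noteq> {} \<and> {0} \<subseteq> {..<1::nat} \<and> odd (card {0::nat}) \<and> \<sigma> \<subseteq> neighbours 1 {0}"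
        using n by simp
      then show "\<sigma> \<in> stars 1" unfolding stars_def by blast
    qed
    then have "stars 1 = {\<sigma>. \<sigma> \<noteq> {} \<and> \<sigma> \<subseteq> {{}}}" by blast
    then show ?thesis by (auto simp: subset_singleton_iff)
  qed
  ultimately show ?thesis by (simp add: stars_and_tetras_def)
qed

theorem contractible_low_complex:
  assumes "1 \<le> k"
  shows "contractible_space (geometric_realization (low_complex k))"
  using assms
proof (induction k rule: nat_induct_at_least)
  case base
  have "closed_simplex {{} :: nat set} = {\<lambda>x. if x = {} then 1 else 0}"
    by (auto simp: closed_simplex_def fun_eq_iff split: if_splits)
  moreover have "finite_complex (low_complex 1)"
    by (rule finite_complex_stars_and_tetras[OF low_cubes_subset])
  ultimately have "geometric_realization (low_complex 1) = top_of_set {\<lambda>x. if x = {} then 1 else 0}"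
    unfolding low_complex_1 by (simp add: geometric_realization_eq_top_of_set polyhedron_def)
  then show ?case by (simp add: contractible_space_subtopology_singleton)
next
  case (Suc k)
  then show ?case
    using homotopy_equivalent_space_contractibility[OF low_complex_Suc_homotopy_equivalent[of k]] by simp
qed

section \<open>Classification of the cliques\<close>

definition even_cliques :: "nat \<Rightarrow> nat set set set" where
  "even_cliques k = {\<sigma>. \<sigma> \<noteq> {} \<and> (\<forall>x\<in>\<sigma>. x \<subseteq> {..<k} \<and> even (card x)) \<and>
     (\<forall>x\<in>\<sigma>. \<forall>z\<in>\<sigma>. card (sym_diff x z) \<le> 2)}"

text \<open>
  A pair that avoids \<open>a\<close> and a pair that avoids \<open>b\<close> complete \<open>{a, b}\<close> to a triangle, and a pair that
  meets all sides of a triangle is one of them.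
\<close>

lemma intersecting_pairs:
  assumes pairs: "\<And>p. p \<in> P \<Longrightarrow> card p = 2" and meet: "\<And>p q. \<lbrakk>p \<in> P; q \<in> P\<rbrakk> \<Longrightarrow> p \<inter> q \<noteq> {}"
    and p0: "p0 \<in> P" and no_centre: "\<And>i. \<exists>p\<in>P. i \<notin> p"
  obtains a b c where "a \<noteq> b" "a \<noteq> c" "b \<noteq> c" "P = {{a, b}, {a, c}, {b, c}}"
proof -
  obtain a b where ab: "p0 = {a, b}" "a \<noteq> b" using pairs[OF p0] by (auto simp: card_2_iff)
  have abP: "{a, b} \<in> P" using p0 ab by simp
  obtain q where q: "q \<in> P" "a \<notin> q" using no_centre by blast
  have "b \<in> q" using meet[OF abP q(1)] q(2) by auto
  moreover obtain u v where "q = {u, v}" "u \<noteq> v" using pairs[OF q(1)] by (auto simp: card_2_iff)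
  ultimately obtain c where c: "q = {b, c}" "b \<noteq> c" by blast
  have bcP: "{b, c} \<in> P" and ac: "a \<noteq> c" using q c by auto
  obtain r where r: "r \<in> P" "b \<notin> r" using no_centre by blast
  have "a \<in> r" using meet[OF abP r(1)] r(2) by auto
  moreover have "c \<in> r" using meet[OF bcP r(1)] r(2) by auto
  moreover obtain u v where "r = {u, v}" using pairs[OF r(1)] by (auto simp: card_2_iff)
  ultimately have "r = {a, c}" using ac by auto
  then have acP: "{a, c} \<in> P" using r(1) by simp
  have "p \<in> {{a, b}, {a, c}, {b, c}}" if p: "p \<in> P" for p
  proof -
    obtain u v where uv: "p = {u, v}" "u \<noteq> v" using pairs[OF p] by (auto simp: card_2_iff)
    have "u = a \<or> u = b \<or> v = a \<or> v = b" "u = a \<or> u = c \<or> v = a \<or> v = c" "u = b \<or> u = c \<or> v = b \<or> v = c"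
      using meet[OF p abP] meet[OF p acP] meet[OF p bcP] unfolding uv(1) by auto
    then show ?thesis unfolding uv(1) using uv(2) ab(2) ac c(2) by auto
  qed
  then have "P = {{a, b}, {a, c}, {b, c}}" using abP acP bcP by blast
  then show thesis using that ab(2) ac c(2) by blast
qed

text \<open>
  Seen from one vertex \<open>z\<close>, the other vertices of a clique are the pairs of coordinates in which they
  differ from \<open>z\<close>, and these pairs intersect each other. A common element makes the clique part of
  a star, and a triangle makes it a tetrahedron.
\<close>

lemma even_clique_classification:
  assumes k: "0 < k" and \<sigma>: "\<sigma> \<in> even_cliques k"
  shows "\<sigma> \<in> stars_and_tetras k (cubes k)"
proof -
  have ev: "\<And>x. x \<in> \<sigma> \<Longrightarrow> x \<subseteq> {..<k}" "\<And>x. x \<in> \<sigma> \<Longrightarrow> even (card x)" and ne: "\<sigma> \<noteq> {}"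
    and d2: "\<And>x z. \<lbrakk>x \<in> \<sigma>; z \<in> \<sigma>\<rbrakk> \<Longrightarrow> card (sym_diff x z) \<le> 2"
    using \<sigma> by (auto simp: even_cliques_def)
  have fin: "finite x" if "x \<in> \<sigma>" for x using finite_subset[OF ev(1)[OF that]] by simp
  obtain z where z: "z \<in> \<sigma>" using ne by blast
  define P where "P = (\<lambda>x. sym_diff x z) ` (\<sigma> - {z})"
  have flips: "\<exists>i j. i \<noteq> j \<and> sym_diff x z = {i, j} \<and> x = flip i (flip j z)" if x: "x \<in> \<sigma>" "x \<noteq> z" for x
    using two_flips[OF fin[OF x(1)] fin[OF z] ev(2)[OF x(1)] ev(2)[OF z] d2[OF x(1) z] x(2)] by metis
  have Pk: "p \<subseteq> {..<k}" if "p \<in> P" for p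
    using that ev(1) z unfolding P_def by blast
  have star: "\<sigma> \<in> stars_and_tetras k (cubes k)" if i: "i < k" "\<forall>p\<in>P. i \<in> p" for i
  proof (rule in_star)
    show "flip i z \<subseteq> {..<k}" using i(1) ev(1)[OF z] by (simp add: flip_subset_iff)
    show "odd (card (flip i z))" using ev(2)[OF z] fin[OF z] by simp
    show "\<sigma> \<noteq> {}" by (rule ne)
    show "\<sigma> \<subseteq> neighbours k (flip i z)"
    proof
      fix x assume x: "x \<in> \<sigma>"
      show "x \<in> neighbours k (flip i z)"
      proof (cases "x = z")
        case True
        then have "x = flip i (flip i z)" by simp
        then show ?thesis using i(1) unfolding neighbours_def by blast
      next
        case False
        obtain u v where uv: "sym_diff x z = {u, v}" "x = flip u (flip v z)" using flips[OF x False] by blast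
        have xP: "{u, v} \<in> P" using x False unfolding P_def uv(1)[symmetric] by blast
        then have "i \<in> {u, v}" "u < k" "v < k" using i(2) Pk[OF xP] by auto
        then obtain r where "r < k" "x = flip r (flip i z)" using uv(2) flip_commute by auto
        then show ?thesis unfolding neighbours_def by blast
      qed
    qed
  qed
  show ?thesis
  proof (cases "\<exists>i<k. \<forall>p\<in>P. i \<in> p")
    case True
    then show ?thesis using star by blast
  next
    case no: False
    then obtain p0 where p0: "p0 \<in> P" using k by blast
    have pairs: "card p = 2" if p: "p \<in> P" for p
    proof -
      obtain x where x: "x \<in> \<sigma>" "x \<noteq> z" "p = sym_diff x z" using p unfolding P_def by blast
      obtain i j where "i \<noteq> j" "sym_diff x z = {i, j}" using flips[OF x(1,2)] by blast
      then show ?thesis using x(3) by simp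
    qed
    have meet: "p \<inter> q \<noteq> {}" if pq: "p \<in> P" "q \<in> P" for p q
    proof
      assume dis: "p \<inter> q = {}"
      obtain x where x: "x \<in> \<sigma>" "p = sym_diff x z" using pq(1) unfolding P_def by blast
      obtain y where y: "y \<in> \<sigma>" "q = sym_diff y z" using pq(2) unfolding P_def by blast
      have fpq: "finite p" "finite q" using x y fin z by auto
      have "p \<union> q \<subseteq> sym_diff x y" using dis unfolding x(2) y(2) by blast
      then have "card (p \<union> q) \<le> card (sym_diff x y)"
        using fin x(1) y(1) by (intro card_mono) auto
      then show False
        using d2[OF x(1) y(1)] card_Un_disjoint[OF fpq dis] pairs[OF pq(1)] pairs[OF pq(2)] by simp
    qed
    have no_centre: "\<exists>p\<in>P. i \<notin> p" for i
    proof (cases "i < k")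
      case True
      then show ?thesis using no by blast
    next
      case False
      then show ?thesis using p0 Pk[OF p0] by auto
    qed
    obtain a b c where abc: "a \<noteq> b" "a \<noteq> c" "b \<noteq> c" "P = {{a, b}, {a, c}, {b, c}}"
      using intersecting_pairs[OF pairs meet p0 no_centre] .
    define D where "D = {a, b, c}"
    have lt: "a < k" "b < k" "c < k" using Pk abc(4) by auto
    have cube: "(z - D, D) \<in> cubes k"
      using lt abc(1-3) ev(1)[OF z] by (auto simp: cubes_def D_def)
    have zT: "z \<in> tetra (z - D) D" using ev(2)[OF z] by (simp add: tetra_def)
    have T: "tetra (z - D) D = {z, flip a (flip b z), flip a (flip c z), flip b (flip c z)}"
      using tetra_eq_flips[OF D_def abc(1-3) cubesD(5,4)[OF cube] zT] .
    have flip_pair: "x = flip u (flip v z)" if "sym_diff x z = {u, v}" "u \<noteq> v" for x u v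
    proof (rule set_eqI)
      fix w
      have "w \<in> sym_diff x z \<longleftrightarrow> w = u \<or> w = v" unfolding that(1) by simp
      then show "w \<in> x \<longleftrightarrow> w \<in> flip u (flip v z)" using that(2) by auto
    qed
    have "x \<in> tetra (z - D) D" if x: "x \<in> \<sigma>" for x
    proof (cases "x = z")
      case False
      then have "sym_diff x z \<in> P" using x unfolding P_def by (intro imageI) simp
      then have "sym_diff x z = {a, b} \<or> sym_diff x z = {a, c} \<or> sym_diff x z = {b, c}"
        unfolding abc(4) insert_iff empty_iff by meson
      then have "x = flip a (flip b z) \<or> x = flip a (flip c z) \<or> x = flip b (flip c z)"
        using flip_pair[of x a b] flip_pair[of x a c] flip_pair[of x b c] abc(1-3) by meson
      then show ?thesis unfolding T insert_iff empty_iff by meson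
    qed (use zT in simp)
    moreover have "flip u (flip v z) \<in> \<sigma>" if uv: "{u, v} \<in> P" "u \<noteq> v" for u v
    proof -
      obtain x where x: "{u, v} = sym_diff x z" "x \<in> \<sigma> - {z}"
        using uv(1) unfolding P_def by (rule imageE)
      then show ?thesis using flip_pair[OF x(1)[symmetric] uv(2)] by simp
    qed
    then have "tetra (z - D) D \<subseteq> \<sigma>" unfolding T using z abc by simp
    ultimately have "\<sigma> = tetra (z - D) D" by blast
    then show ?thesis using cube unfolding stars_and_tetras_def by auto
  qed
qed

lemma even_cliques_eq:
  assumes "0 < k"
  shows "even_cliques k = stars_and_tetras k (cubes k)"
proof
  show "even_cliques k \<subseteq> stars_and_tetras k (cubes k)"
    using even_clique_classification[OF assms] by blast
  show "stars_and_tetras k (cubes k) \<subseteq> even_cliques k"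
  proof
    fix \<sigma> assume \<sigma>: "\<sigma> \<in> stars_and_tetras k (cubes k)"
    have "\<sigma> \<noteq> {}" by (rule finite_complexD(3)[OF finite_complex_stars_and_tetras[OF subset_refl] \<sigma>])
    then show "\<sigma> \<in> even_cliques k"
      using stars_and_tetras_vertex[OF \<sigma> subset_refl] stars_and_tetras_dist[OF \<sigma> subset_refl]
      unfolding even_cliques_def by blast
  qed
qed

lemma tetra_elements:
  assumes "(B, D) \<in> cubes k"
  obtains a b c w where "D = {a, b, c}" "a \<noteq> b" "a \<noteq> c" "b \<noteq> c" "w \<in> tetra B D"
    "tetra B D = {w, flip a (flip b w), flip a (flip c w), flip b (flip c w)}"
proof -
  note c = cubesD[OF assms]
  obtain a b c' where D: "D = {a, b, c'}" "a \<noteq> b" "a \<noteq> c'" "b \<noteq> c'" using card_3_elements[OF c(2)] .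
  obtain w where w: "w \<in> tetra B D" using tetra_nonempty[OF assms] by blast
  show thesis using that[OF D w tetra_eq_flips[OF D c(5,4) w]] .
qed

lemma card_tetra:
  assumes "(B, D) \<in> cubes k"
  shows "card (tetra B D) = 4"
proof -
  obtain a b c w where D: "D = {a, b, c}" "a \<noteq> b" "a \<noteq> c" "b \<noteq> c"
    and T: "tetra B D = {w, flip a (flip b w), flip a (flip c w), flip b (flip c w)}"
    using tetra_elements[OF assms] .
  have ne: "x \<noteq> y" if "u \<in> x \<longleftrightarrow> u \<notin> y" for x y :: "nat set" and u
    using that by blast
  have "w \<noteq> flip a (flip b w)" by (rule ne[of a]) (simp add: D(2))
  moreover have "w \<noteq> flip a (flip c w)" by (rule ne[of a]) (simp add: D(3))
  moreover have "w \<noteq> flip b (flip c w)" by (rule ne[of b]) (simp add: D(4))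
  moreover have "flip a (flip b w) \<noteq> flip a (flip c w)"
    by (rule ne[of b]) (use D(2,4) in auto)
  moreover have "flip a (flip b w) \<noteq> flip b (flip c w)"
    by (rule ne[of a]) (use D(2,3) in auto)
  moreover have "flip a (flip c w) \<noteq> flip b (flip c w)"
    by (rule ne[of a]) (use D(2,3) in auto)
  ultimately show ?thesis unfolding T by (simp only: card_insert_if finite.intros insert_iff empty_iff) simp
qed

text \<open>
  If \<open>y\<close> were a common neighbour, the direction \<open>i\<close> from \<open>y\<close> to the vertex \<open>w\<close> would have to belong to each
  of the pairs \<open>{a, b}\<close>, \<open>{a, c}\<close>, \<open>{b, c}\<close>.
\<close>

lemma tetra_not_star:
  assumes "(B, D) \<in> cubes k"
  shows "tetra B D \<notin> stars k"
proof
  obtain a b c w where D: "D = {a, b, c}" "a \<noteq> b" "a \<noteq> c" "b \<noteq> c" and w: "w \<in> tetra B D"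
    and T: "tetra B D = {w, flip a (flip b w), flip a (flip c w), flip b (flip c w)}"
    using tetra_elements[OF assms] .
  assume "tetra B D \<in> stars k"
  then obtain y where y: "tetra B D \<subseteq> neighbours k y" unfolding stars_def by blast
  then obtain i where i: "w = flip i y" using w unfolding neighbours_def by blast
  have key: "i = u \<or> i = v" if uv: "flip u (flip v w) \<in> tetra B D" "u \<noteq> v" for u v
  proof (rule ccontr)
    assume no: "\<not> (i = u \<or> i = v)"
    obtain j where j: "flip u (flip v w) = flip j y" using uv(1) y unfolding neighbours_def by blast
    have "u \<in> flip u (flip v w) \<longleftrightarrow> u \<in> flip j y" "v \<in> flip u (flip v w) \<longleftrightarrow> v \<in> flip j y"
      unfolding j by (rule refl)+
    then have "u = j" "v = j" unfolding i using no uv(2) by auto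
    then show False using uv(2) by simp
  qed
  have "i = a \<or> i = b" "i = a \<or> i = c" "i = b \<or> i = c" using key D unfolding T by blast+
  then show False using D by blast
qed

lemma tetra_inj:
  assumes c: "(B, D) \<in> cubes k" "(B', D') \<in> cubes k" and eq: "tetra B D = tetra B' D'"
  shows "B = B' \<and> D = D'"
proof -
  have D: "u \<in> E \<longleftrightarrow> (\<exists>x\<in>tetra A E. \<exists>y\<in>tetra A E. u \<in> x \<and> u \<notin> y)" if AE: "(A, E) \<in> cubes k" for A E u
  proof
    obtain a b c w where E: "E = {a, b, c}" "a \<noteq> b" "a \<noteq> c" "b \<noteq> c" and w: "w \<in> tetra A E"
      and T: "tetra A E = {w, flip a (flip b w), flip a (flip c w), flip b (flip c w)}"
      using tetra_elements[OF AE] .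
    assume "u \<in> E"
    then have "u \<in> flip a (flip b w) \<longleftrightarrow> u \<notin> w" if "u \<noteq> c" using E that by auto
    moreover have "u \<in> flip a (flip c w) \<longleftrightarrow> u \<notin> w" if "u = c" using E that by auto
    ultimately have "\<exists>x\<in>tetra A E. u \<in> x \<longleftrightarrow> u \<notin> w" unfolding T by blast
    then show "\<exists>x\<in>tetra A E. \<exists>y\<in>tetra A E. u \<in> x \<and> u \<notin> y" using w by blast
  next
    assume "\<exists>x\<in>tetra A E. \<exists>y\<in>tetra A E. u \<in> x \<and> u \<notin> y"
    then show "u \<in> E" unfolding tetra_def by blast
  qed
  have DD: "D = D'" by (rule set_eqI) (simp only: D[OF c(1)] D[OF c(2)] eq)
  obtain w where w: "w \<in> tetra B D" using tetra_nonempty[OF c(1)] by blast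
  then have "w - D = B" "w - D' = B'" using eq unfolding tetra_def by blast+
  then show ?thesis using DD by blast
qed

definition critical_tetras :: "nat \<Rightarrow> nat set set set" where
  "critical_tetras k = (\<lambda>(B, D). tetra B D) ` (cubes k - low_cubes k)"

lemma critical_tetras_facets:
  assumes "\<sigma> \<in> critical_tetras k" "\<tau> \<in> stars_and_tetras k (cubes k)" "\<sigma> \<subseteq> \<tau>"
  shows "\<tau> = \<sigma>"
proof -
  obtain B D where BD: "(B, D) \<in> cubes k" "\<sigma> = tetra B D" using assms(1) by (auto simp: critical_tetras_def)
  have ne: "\<sigma> \<noteq> {}" using tetra_nonempty[OF BD(1)] BD(2) by simp
  from assms(2) show ?thesis
  proof (cases rule: stars_and_tetras_cases)
    case (star y)
    then have "\<sigma> \<in> stars k" using assms(3) ne unfolding stars_def by blast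
    then show ?thesis using tetra_not_star BD by blast
  next
    case (tetra B' D')
    have "card \<sigma> = card \<tau>" using card_tetra[OF BD(1)] card_tetra[OF tetra(1)] BD(2) tetra(2) by simp
    moreover have "finite \<tau>" using card_tetra[OF tetra(1)] tetra(2) card.infinite by fastforce
    ultimately show ?thesis using card_subset_eq[of \<tau> \<sigma>] assms(3) by simp
  qed
qed

lemma remove_critical_tetras:
  "stars_and_tetras k (cubes k) - critical_tetras k = low_complex k"
proof -
  have "stars k \<inter> critical_tetras k = {}"
    using tetra_not_star by (auto simp: critical_tetras_def)
  moreover have "(\<lambda>(B, D). tetra B D) ` low_cubes k \<inter> critical_tetras k = {}"
  proof -
    have False if "(B, D) \<in> low_cubes k" "(B', D') \<in> cubes k" "(B', D') \<notin> low_cubes k" "tetra B D = tetra B' D'"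
      for B D B' D'
      using tetra_inj[of B D k B' D'] that low_cubes_subset by blast
    then show ?thesis unfolding critical_tetras_def by fastforce
  qed
  moreover have "(\<lambda>(B, D). tetra B D) ` cubes k = (\<lambda>(B, D). tetra B D) ` low_cubes k \<union> critical_tetras k"
    using low_cubes_subset unfolding critical_tetras_def by blast
  ultimately show ?thesis unfolding stars_and_tetras_def by blast
qed

section \<open>Counting the critical tetrahedra\<close>

text \<open>
  The other two directions lie below the largest one, so \<open>k - 3\<close> coordinates are free in an arbitrary
  face with directions \<open>D\<close> and \<open>Max D - 2\<close> in a low one.
\<close>

lemma card_critical_bases:
  assumes "D \<subseteq> {..<k}" "card D = 3"
  shows "card {B. (B, D) \<in> cubes k - low_cubes k} = 2 ^ (k - 3) - 2 ^ (Max D - 2)"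
proof -
  have fin: "finite D" "D \<noteq> {}" using assms(2) card.infinite by fastforce+
  define M where "M = Max D"
  have M: "M \<in> D" "M < k" using Max_in[OF fin] assms(1) by (auto simp: M_def)
  have DM: "D - {M} \<subseteq> {..<M}"
  proof
    fix u assume "u \<in> D - {M}"
    then show "u \<in> {..<M}" using Max_ge[OF fin(1), of u] by (simp add: M_def)
  qed
  have "{B. (B, D) \<in> cubes k - low_cubes k} = Pow ({..<k} - D) - Pow ({..<M} - (D - {M}))"
    using assms M by (auto simp: cubes_def low_cubes_def M_def)
  also have "card \<dots> = card (Pow ({..<k} - D)) - card (Pow ({..<M} - (D - {M})))"
    using M by (intro card_Diff_subset) auto
  also have "\<dots> = 2 ^ (k - 3) - 2 ^ (M - 2)"
    using assms M DM fin by (simp add: card_Pow card_Diff_subset)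
  finally show ?thesis by (simp add: M_def)
qed

text \<open>
  The index pairs of \<open>sphere_count\<close> are the two larger elements of a three-element set of directions,
  each decreased by one; the factor \<open>j + 1\<close> counts the choices of the smallest.
\<close>

lemma bij_betw_three_subsets:
  "bij_betw (\<lambda>((i, j), a). {a, Suc j, Suc i})
     (SIGMA (i, j):{(i, j). j < i \<and> i < n}. {..j}) {D. D \<subseteq> {..<Suc n} \<and> card D = 3}"
  (is "bij_betw ?f ?S ?T")
proof (rule bij_betw_imageI)
  show "inj_on ?f ?S"
  proof (rule inj_onI)
    fix p q assume p: "p \<in> ?S" and q: "q \<in> ?S" and eq: "?f p = ?f q"
    obtain i j a where p': "p = ((i, j), a)" "j < i" "a \<le> j" using p by auto
    obtain i' j' a' where q': "q = ((i', j'), a')" "j' < i'" "a' \<le> j'" using q by auto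
    have E: "{a, Suc j, Suc i} = {a', Suc j', Suc i'}" using eq p'(1) q'(1) by simp
    have "Max {a, Suc j, Suc i} = Suc i" "Max {a', Suc j', Suc i'} = Suc i'"
      "Min {a, Suc j, Suc i} = a" "Min {a', Suc j', Suc i'} = a'"
      using p'(2,3) q'(2,3) by (auto intro!: Max_eqI Min_eqI)
    then have "i = i'" "a = a'" using E by simp_all
    moreover have "Suc j \<in> {a', Suc j', Suc i'}" unfolding E[symmetric] by simp
    ultimately have "i = i' \<and> j = j' \<and> a = a'" using p'(2,3) by simp
    then show "p = q" using p'(1) q'(1) by simp
  qed
  show "?f ` ?S = ?T"
  proof
    show "?f ` ?S \<subseteq> ?T" by (auto simp: card_insert_if)
    show "?T \<subseteq> ?f ` ?S"
    proof
      fix D assume "D \<in> ?T"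
      then have D: "D \<subseteq> {..<Suc n}" "card D = 3" by auto
      have sorted: "D \<in> ?f ` ?S" if "D = {a, b, c}" "a < b" "b < c" for a b c
      proof -
        have "((c - 1, b - 1), a) \<in> ?S" using that D(1) by auto
        moreover have "?f ((c - 1, b - 1), a) = D" using that by simp
        ultimately show ?thesis by (rule rev_image_eqI[OF _ sym])
      qed
      obtain a b c where "D = {a, b, c}" "a \<noteq> b" "a \<noteq> c" "b \<noteq> c" using card_3_elements[OF D(2)] .
      then consider "a < b \<and> b < c" | "a < c \<and> c < b" | "b < a \<and> a < c"
        | "b < c \<and> c < a" | "c < a \<and> a < b" | "c < b \<and> b < a" by linarith
      then show "D \<in> ?f ` ?S"
        using sorted[of a b c] sorted[of a c b] sorted[of b a c] sorted[of b c a] sorted[of c a b] sorted[of c b a]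
          \<open>D = {a, b, c}\<close> by cases (simp_all add: insert_commute)
    qed
  qed
qed

lemma card_critical_tetras: "card (critical_tetras (Suc n)) = sphere_count n"
proof -
  let ?k = "Suc n"
  let ?T = "{D. D \<subseteq> {..<Suc n} \<and> card D = 3}"
  let ?g = "\<lambda>D. 2 ^ (?k - 3) - 2 ^ (Max D - 2) :: nat"
  let ?P = "{(i, j). j < i \<and> i < n}"
  have "inj_on (\<lambda>(B, D). tetra B D) (cubes ?k - low_cubes ?k)"
  proof (rule inj_onI)
    fix p q assume p: "p \<in> cubes ?k - low_cubes ?k" and q: "q \<in> cubes ?k - low_cubes ?k"
      and eq: "(\<lambda>(B, D). tetra B D) p = (\<lambda>(B, D). tetra B D) q"
    obtain B D B' D' where pq: "p = (B, D)" "q = (B', D')" by (cases p, cases q) blast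
    then show "p = q" using tetra_inj[of B D ?k B' D'] p q eq by simp
  qed
  then have "card (critical_tetras ?k) = card (cubes ?k - low_cubes ?k)"
    unfolding critical_tetras_def by (rule card_image)
  also have "\<dots> = card (SIGMA D:?T. {B. (B, D) \<in> cubes ?k - low_cubes ?k})"
  proof (rule bij_betw_same_card, rule bij_betwI)
    show "prod.swap \<in> cubes ?k - low_cubes ?k \<rightarrow> (SIGMA D:?T. {B. (B, D) \<in> cubes ?k - low_cubes ?k})"
      by (auto simp: cubes_def)
    show "prod.swap \<in> (SIGMA D:?T. {B. (B, D) \<in> cubes ?k - low_cubes ?k}) \<rightarrow> cubes ?k - low_cubes ?k"
      by auto
  qed simp_all
  also have "\<dots> = (\<Sum>D\<in>?T. card {B. (B, D) \<in> cubes ?k - low_cubes ?k})"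
  proof (rule card_SigmaI)
    show "finite ?T" by simp
    show "\<forall>D\<in>?T. finite {B. (B, D) \<in> cubes ?k - low_cubes ?k}"
    proof
      fix D
      have "{B. (B, D) \<in> cubes ?k - low_cubes ?k} \<subseteq> Pow {..<?k}" by (auto simp: cubes_def)
      then show "finite {B. (B, D) \<in> cubes ?k - low_cubes ?k}" by (rule finite_subset) simp
    qed
  qed
  also have "\<dots> = (\<Sum>D\<in>?T. ?g D)"
    by (rule sum.cong[OF refl], rule card_critical_bases) simp_all
  also have "\<dots> = (\<Sum>p\<in>(SIGMA (i, j):?P. {..j}). ?g ((\<lambda>((i, j), a). {a, Suc j, Suc i}) p))"
    by (rule sum.reindex_bij_betw[OF bij_betw_three_subsets, symmetric])
  also have "\<dots> = (\<Sum>p\<in>(SIGMA (i, j):?P. {..j}). (\<lambda>((i, j), a). 2 ^ (n - 2) - 2 ^ (i - 1)) p)"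
  proof (rule sum.cong)
    fix p assume "p \<in> (SIGMA (i, j):?P. {..j})"
    then obtain i j a where p: "p = ((i, j), a)" "j < i" "a \<le> j" by auto
    then have "Max {a, Suc j, Suc i} = Suc i" by (intro Max_eqI) auto
    then show "?g ((\<lambda>((i, j), a). {a, Suc j, Suc i}) p) = (\<lambda>((i, j), a). 2 ^ (n - 2) - 2 ^ (i - 1)) p"
      using p(1) by (simp only: prod.case) simp
  qed simp
  also have "\<dots> = (\<Sum>(i, j)\<in>?P. \<Sum>a\<le>j. 2 ^ (n - 2) - 2 ^ (i - 1))"
  proof -
    have "?P \<subseteq> {..<n} \<times> {..<n}" by auto
    then have "finite ?P" by (rule finite_subset) simp
    then show ?thesis
      by (subst sum.Sigma[symmetric]) (auto simp: case_prod_unfold)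
  qed
  also have "\<dots> = sphere_count n"
    unfolding sphere_count_def by (intro sum.cong) auto
  finally show ?thesis .
qed

section \<open>Binary strings as even sets\<close>

definition ones :: "bool list \<Rightarrow> nat set" where
  "ones xs = {i. i < length xs \<and> xs ! i}"

definition add_parity :: "nat \<Rightarrow> nat set \<Rightarrow> nat set" where
  "add_parity n x = (if even (card x) then x else insert n x)"

lemma hamming_dist_ones:
  assumes "length xs = length ys"
  shows "hamming_dist xs ys = real (card (sym_diff (ones xs) (ones ys)))"
proof -
  have "{i. i < length xs \<and> i < length ys \<and> xs ! i \<noteq> ys ! i} = sym_diff (ones xs) (ones ys)"
    using assms by (auto simp: ones_def)
  then show ?thesis by (simp add: hamming_dist_def)
qed

lemma bij_betw_ones: "bij_betw ones (binary_strings n) (Pow {..<n})"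
proof (rule bij_betwI[where g = "\<lambda>x. map (\<lambda>i. i \<in> x) [0..<n]"])
  show "ones \<in> binary_strings n \<rightarrow> Pow {..<n}" by (auto simp: ones_def binary_strings_def)
  show "(\<lambda>x. map (\<lambda>i. i \<in> x) [0..<n]) \<in> Pow {..<n} \<rightarrow> binary_strings n"
    by (auto simp: binary_strings_def)
  show "map (\<lambda>i. i \<in> ones xs) [0..<n] = xs" if "xs \<in> binary_strings n" for xs
    using that by (intro nth_equalityI) (auto simp: ones_def binary_strings_def)
  show "ones (map (\<lambda>i. i \<in> x) [0..<n]) = x" if "x \<in> Pow {..<n}" for x
    using that by (auto simp: ones_def)
qed

lemma bij_betw_add_parity:
  "bij_betw (add_parity n) (Pow {..<n}) {x. x \<subseteq> {..<Suc n} \<and> even (card x)}"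
proof (rule bij_betwI[where g = "\<lambda>x. x - {n}"])
  have fin: "finite x" "n \<notin> x" if "x \<in> Pow {..<n}" for x using that finite_subset by auto
  show "add_parity n \<in> Pow {..<n} \<rightarrow> {x. x \<subseteq> {..<Suc n} \<and> even (card x)}"
  proof
    fix x assume x: "x \<in> Pow {..<n}"
    have "x \<subseteq> {..<Suc n}" using x by auto
    then show "add_parity n x \<in> {x. x \<subseteq> {..<Suc n} \<and> even (card x)}"
      using fin[OF x] by (simp add: add_parity_def)
  qed
  show "(\<lambda>x. x - {n}) \<in> {x. x \<subseteq> {..<Suc n} \<and> even (card x)} \<rightarrow> Pow {..<n}"
    by (auto simp: less_Suc_eq)
  show "add_parity n x - {n} = x" if "x \<in> Pow {..<n}" for x
    using fin[OF that] by (auto simp: add_parity_def)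
  show "add_parity n (x - {n}) = x" if "x \<in> {x. x \<subseteq> {..<Suc n} \<and> even (card x)}" for x
  proof (cases "n \<in> x")
    case True
    have "finite x" using that finite_subset[of x "{..<Suc n}"] by simp
    then have "card x = Suc (card (x - {n}))" using True by (rule card.remove)
    then have "odd (card (x - {n}))" using that by simp
    then show ?thesis using True by (auto simp: add_parity_def)
  next
    case False
    then show ?thesis using that by (simp add: add_parity_def)
  qed
qed

text \<open>
  The parity bit turns distance 1 into distance 2 and leaves distance 2 alone; it rounds distances up
  to even numbers.
\<close>

lemma card_sym_diff_add_parity:
  assumes "x \<subseteq> {..<n}" "y \<subseteq> {..<n}"
  shows "card (sym_diff (add_parity n x) (add_parity n y)) \<le> 2 \<longleftrightarrow> card (sym_diff x y) \<le> 2"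
proof (cases "even (card x) \<longleftrightarrow> even (card y)")
  case True
  have "sym_diff (add_parity n x) (add_parity n y) = sym_diff x y"
    using assms True by (auto simp: add_parity_def)
  then show ?thesis by simp
next
  case False
  have fin: "finite x" "finite y" using assms finite_subset by auto
  have "sym_diff (add_parity n x) (add_parity n y) = insert n (sym_diff x y)" "n \<notin> sym_diff x y"
    using assms False by (auto simp: add_parity_def)
  then have "card (sym_diff (add_parity n x) (add_parity n y)) = Suc (card (sym_diff x y))"
    using fin by simp
  moreover have "odd (card (sym_diff x y))" using even_card_sym_diff[OF fin] False by blast
  ultimately show ?thesis by presburger
qed

lemma vietoris_rips_relabelled:
  "(`) (add_parity n \<circ> ones) ` vietoris_rips (binary_strings n) hamming_dist 2 = even_cliques (Suc n)"
proof -
  let ?V = "binary_strings n" and ?W = "{x. x \<subseteq> {..<Suc n} \<and> even (card x)}"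
  let ?f = "add_parity n \<circ> ones"
  have bij: "bij_betw ?f ?V ?W"
    by (rule bij_betw_trans[OF bij_betw_ones bij_betw_add_parity])
  have dist: "hamming_dist xs ys \<le> 2 \<longleftrightarrow> card (sym_diff (?f xs) (?f ys)) \<le> 2"
    if "xs \<in> ?V" "ys \<in> ?V" for xs ys
  proof -
    have "ones xs \<subseteq> {..<n}" "ones ys \<subseteq> {..<n}" "length xs = length ys"
      using that by (auto simp: binary_strings_def ones_def)
    then show ?thesis
      using card_sym_diff_add_parity[of "ones xs" n "ones ys"] by (simp add: hamming_dist_ones)
  qed
  have finV: "finite ?V"
    using bij_betw_finite[OF bij_betw_ones[of n]] by simp
  show ?thesis
  proof (intro set_eqI iffI)
    fix \<rho> assume "\<rho> \<in> (`) ?f ` vietoris_rips ?V hamming_dist 2"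
    then obtain \<sigma> where \<sigma>1: "\<rho> = ?f ` \<sigma>" "\<sigma> \<in> vietoris_rips ?V hamming_dist 2"
      by (rule imageE)
    then have \<sigma>: "\<rho> = ?f ` \<sigma>" "\<sigma> \<noteq> {}" "\<sigma> \<subseteq> ?V"
      "\<And>x y. x \<in> \<sigma> \<Longrightarrow> y \<in> \<sigma> \<Longrightarrow> hamming_dist x y \<le> 2"
      by (simp_all add: vietoris_rips_iff)
    have "\<rho> \<noteq> {}" using \<sigma>(1,2) by simp
    moreover have "\<rho> \<subseteq> ?W" using \<sigma>(1,3) bij unfolding bij_betw_def by blast
    moreover have "card (sym_diff a b) \<le> 2" if ab: "a \<in> \<rho>" "b \<in> \<rho>" for a b
    proof -
      obtain x y where xy: "x \<in> \<sigma>" "y \<in> \<sigma>" "a = ?f x" "b = ?f y"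
        using ab unfolding \<sigma>(1) by blast
      have "x \<in> ?V" "y \<in> ?V" using xy(1,2) \<sigma>(3) by (simp_all add: subsetD)
      then show ?thesis unfolding xy(3,4) using \<sigma>(4)[OF xy(1,2)] dist[of x y] by simp
    qed
    ultimately show "\<rho> \<in> even_cliques (Suc n)" unfolding even_cliques_def by blast
  next
    fix \<rho> assume \<rho>: "\<rho> \<in> even_cliques (Suc n)"
    then have "\<rho> \<subseteq> ?f ` ?V" using bij unfolding bij_betw_def even_cliques_def by blast
    then obtain \<sigma> where \<sigma>: "\<sigma> \<subseteq> ?V" "\<rho> = ?f ` \<sigma>" by (rule subset_imageE)
    have "\<sigma> \<noteq> {}" using \<rho> \<sigma>(2) unfolding even_cliques_def by blast
    moreover have "hamming_dist x y \<le> 2" if "x \<in> \<sigma>" "y \<in> \<sigma>" for x y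
    proof -
      have "card (sym_diff (?f x) (?f y)) \<le> 2"
        using \<rho> that unfolding even_cliques_def \<sigma>(2) by simp
      moreover have "x \<in> ?V" "y \<in> ?V" using that \<sigma>(1) by (simp_all add: subsetD)
      ultimately show ?thesis using dist[of x y] by simp
    qed
    ultimately have "\<sigma> \<in> vietoris_rips ?V hamming_dist 2"
      unfolding vietoris_rips_iff using \<sigma>(1) finite_subset[OF \<sigma>(1) finV] by blast
    then show "\<rho> \<in> (`) ?f ` vietoris_rips ?V hamming_dist 2" using \<sigma>(2) by blast
  qed
qed

lemma finite_complex_vietoris_rips:
  assumes "finite M"
  shows "finite_complex (vietoris_rips M d r)"
proof (rule finite_complexI)
  have "vietoris_rips M d r \<subseteq> Pow M" by (auto simp: vietoris_rips_iff)
  then show "finite (vietoris_rips M d r)" by (rule finite_subset) (simp add: assms)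
  fix \<sigma> assume \<sigma>: "\<sigma> \<in> vietoris_rips M d r"
  show "finite \<sigma>" "\<sigma> \<noteq> {}" using \<sigma> unfolding vietoris_rips_iff by blast+
  show "\<tau> \<in> vietoris_rips M d r" if "\<tau> \<subseteq> \<sigma>" "\<tau> \<noteq> {}" for \<tau>
    using \<sigma> that finite_subset[OF that(1)] unfolding vietoris_rips_iff by blast
qed

section \<open>The homotopy type\<close>

theorem theorem1:
  fixes n :: nat
  assumes "n \<ge> 3"
  shows "geometric_realization (vietoris_rips (binary_strings n) hamming_dist 2)
           homotopy_equivalent_space wedge_of_3_spheres (sphere_count n)"
proof -
  let ?K = "vietoris_rips (binary_strings n) hamming_dist 2"
  let ?L = "stars_and_tetras (Suc n) (cubes (Suc n))"
  let ?f = "add_parity n \<circ> ones"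
  have fin: "finite (binary_strings n)"
    using bij_betw_finite[OF bij_betw_ones[of n]] by simp
  have image: "(`) ?f ` ?K = ?L"
    unfolding vietoris_rips_relabelled by (rule even_cliques_eq) simp
  have "\<Union>?K \<subseteq> binary_strings n" by (auto simp: vietoris_rips_iff)
  moreover have "inj_on ?f (binary_strings n)"
    using bij_betw_trans[OF bij_betw_ones bij_betw_add_parity] by (rule bij_betw_imp_inj_on)
  ultimately have inj: "inj_on ?f (\<Union>?K)" by (rule inj_on_subset[rotated])
  have KL: "geometric_realization ?K homotopy_equivalent_space geometric_realization ?L"
    using homeomorphic_relabelled_realization(2)[OF finite_complex_vietoris_rips[OF fin] inj]
    unfolding image by (rule homeomorphic_imp_homotopy_equivalent_space)
  have "geometric_realization ?L homotopy_equivalent_space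
      wedge_sum (\<lambda>_. nsphere 3) (\<lambda>_. sphere_base) {..<card (critical_tetras (Suc n))}"
  proof (rule homotopy_equivalent_wedge_of_spheres)
    show "finite_complex ?L" by (rule finite_complex_stars_and_tetras) simp
    show "critical_tetras (Suc n) \<subseteq> ?L"
      by (auto simp: critical_tetras_def stars_and_tetras_def)
    show "\<tau> = \<sigma>" if "\<sigma> \<in> critical_tetras (Suc n)" "\<tau> \<in> ?L" "\<sigma> \<subseteq> \<tau>" for \<sigma> \<tau>
      using critical_tetras_facets[OF that] .
    show "card \<sigma> = Suc 3" if "\<sigma> \<in> critical_tetras (Suc n)" for \<sigma>
      using that card_tetra by (auto simp: critical_tetras_def)
    show "contractible_space (geometric_realization (?L - critical_tetras (Suc n)))"
      unfolding remove_critical_tetras by (rule contractible_low_complex) simp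
    \<comment> \<open>the vertex \<open>{}\<close>, presented as a neighbour of the odd set \<open>{0}\<close>\<close>
    have "{flip 0 {0}} \<in> low_complex (Suc n)"
      by (rule in_star[of "{0}"]) (auto simp: neighbours_def)
    then show "?L - critical_tetras (Suc n) \<noteq> {}"
      unfolding remove_critical_tetras by blast
  qed simp
  then have "geometric_realization ?L homotopy_equivalent_space wedge_of_3_spheres (sphere_count n)"
    unfolding card_critical_tetras wedge_of_3_spheres_def sphere_base_def .
  then show ?thesis by (rule homotopy_eqv_trans[OF KL])
qed

end
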